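(* Let $\mathbb X,\mathbb Y$ be Polish spaces, $(\Omega,\mathscr F,P)$ a probability space, $\mu$ a probability kernel from $\Omega$ to $\mathbb X$ and $\nu$ a probability kernel from $\Omega$ to $\mathbb Y$. Let $c:\Omega\times\mathbb X\times\mathbb Y\to[0,\infty]$ be a measurable function such that for each $\omega\in\Omega$, $(x,y)\mapsto c(\omega,x,y)$ is continuous, and for each $(x,y)\in\mathbb X\times\mathbb Y$, $\omega\mapsto c(\omega,x,y)$ is $\mathscr F$-measurable, and such that $$\mathbb E\int_{\mathbb X\times\mathbb Y}c(\omega,x,y)\,\mu_\omega(dx)\,\nu_\omega(dy)<+\infty .$$ Then $$C^{\mathrm{stoch}}(c,\mu,\nu)=\sup_{\substack{(\psi,\phi)\in L^1(\mu_\omega\times P)\times L^1(\nu_\omega\times P)\\ \phi-\psi\leq c}}\mathbb E\left(\int_{\mathbb Y}\phi(\omega,y)\,\nu_\omega(dy)-\int_{\mathbb X}\psi(\omega,x)\,\mu_\omega(dx)\right)$$ $$=\sup_{\substack{(\psi,\phi)\in Lip_b^\omega(\mathbb X)\times Lip_b^\omega(\mathbb Y)\\ \phi-\psi\leq c}}\mathbb E\left(\int_{\mathbb Y}\phi(\omega,y)\,\nu_\omega(dy)-\int_{\mathbb X}\psi(\omega,x)\,\mu_\omega(dx)\right).$$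
   Context: A probability kernel $\mu$ from $\Omega$ to a Polish space $\mathbb X$ (with Borel $\sigma$-field $\mathscr B(\mathbb X)$) is a map $\mu:\Omega\times\mathscr B(\mathbb X)\to[0,1]$ such that $\mu_\omega$ is a probability measure on $\mathbb X$ for each $\omega$ and $\omega\mapsto\mu_\omega(B)$ is $\mathscr F$-measurable for each $B\in\mathscr B(\mathbb X)$. $\mathbb E$ is expectation with respect to $P$ (in $\omega$). $\mathcal K(\mu,\nu)$ is the set of all probability kernels $\pi$ from $\Omega$ to $\mathbb X\times\mathbb Y$ with $\pi_\omega(\cdot\times\mathbb Y)=\mu_\omega$ and $\pi_\omega(\mathbb X\times\cdot)=\nu_\omega$ for all $\omega$, and $$C^{\mathrm{stoch}}(c,\mu,\nu):=\inf_{\pi\in\mathcal K(\mu,\nu)}\mathbb E\int_{\mathbb X\times\mathbb Y}c(\omega,x,y)\,\pi_\omega(dx,dy).$$ $L^1(\mu_\omega\times P)$ is the set of all measurable functions $\psi$ on $\Omega\times\mathbb X$ with $\mathbb E\int_{\mathbb X}|\psi(\omega,x)|\,\mu_\omega(dx)<+\infty$; $L^1(\nu_\omega\times P)$ is defined similarly on $\Omega\times\mathbb Y$. The notation $\phi-\psi\leq c$ means $\phi(\omega,y)-\psi(\omega,x)\leq c(\omega,x,y)$ for all $(\omega,x,y)\in\Omega\times\mathbb X\times\mathbb Y$. $\mathbb X$ and $\mathbb Y$ are equipped with fixed complete metrics $d_{\mathbb X},d_{\mathbb Y}$ inducing their topologies. $Lip_b^\omega(\mathbb X)$ is the space of all bounded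 measurable functions $\psi(\omega,x)$ on $\Omega\times\mathbb X$ such that $x\mapsto\psi(\omega,x)$ is Lipschitz continuous for each $\omega$ (the Lipschitz constant may depend on $\omega$); $Lip_b^\omega(\mathbb Y)$ is defined similarly. *)

theory Defs
  imports "HOL-Probability.Probability"
begin

text \<open>
  A Polish space is a type of class \<open>polish_space\<close>; its \<open>dist\<close> is the fixed complete metric.
  A probability kernel is a measurable map into the Giry space \<open>prob_algebra borel\<close>; the first lemma
  unfolds this into the usual definition. Functions of \<open>\<omega>\<close> are only constrained on \<open>space M\<close>.
\<close>

abbreviation prob_kernel :: "'w measure \<Rightarrow> ('w \<Rightarrow> 'x::topological_space measure) \<Rightarrow> bool" where
  "prob_kernel M \<kappa> \<equiv> \<kappa> \<in> M \<rightarrow>\<^sub>M prob_algebra borel"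

lemma prob_kernel_iff:
  "prob_kernel M \<kappa> \<longleftrightarrow>
     (\<forall>\<omega>\<in>space M. prob_space (\<kappa> \<omega>) \<and> sets (\<kappa> \<omega>) = sets borel) \<and>
     (\<forall>B\<in>sets borel. (\<lambda>\<omega>. emeasure (\<kappa> \<omega>) B) \<in> borel_measurable M)"
proof
  assume k: "prob_kernel M \<kappa>"
  have "prob_space (\<kappa> \<omega>) \<and> sets (\<kappa> \<omega>) = sets borel" if "\<omega> \<in> space M" for \<omega>
    using measurable_space[OF k that] by (simp add: space_prob_algebra)
  moreover have "(\<lambda>\<omega>. emeasure (\<kappa> \<omega>) B) \<in> borel_measurable M" if "B \<in> sets borel" for B
    using measurable_prob_algebraD[OF k] that by measurable
  ultimately show "(\<forall>\<omega>\<in>space M. prob_space (\<kappa> \<omega>) \<and> sets (\<kappa> \<omega>) = sets borel) \<and>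
     (\<forall>B\<in>sets borel. (\<lambda>\<omega>. emeasure (\<kappa> \<omega>) B) \<in> borel_measurable M)"
    by blast
next
  assume *: "(\<forall>\<omega>\<in>space M. prob_space (\<kappa> \<omega>) \<and> sets (\<kappa> \<omega>) = sets borel) \<and>
     (\<forall>B\<in>sets borel. (\<lambda>\<omega>. emeasure (\<kappa> \<omega>) B) \<in> borel_measurable M)"
  have "\<kappa> \<in> M \<rightarrow>\<^sub>M subprob_algebra borel"
    by (rule measurable_subprob_algebra) (use * in \<open>auto intro: prob_space_imp_subprob_space\<close>)
  then show "prob_kernel M \<kappa>"
    unfolding prob_algebra_def using * by (intro measurable_restrict_space2) auto
qed

definition kernel_couplings ::
  "'w measure \<Rightarrow> ('w \<Rightarrow> 'x::topological_space measure) \<Rightarrow> ('w \<Rightarrow> 'y::topological_space measure)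
    \<Rightarrow> ('w \<Rightarrow> ('x \<times> 'y) measure) set" where
  "kernel_couplings M \<mu> \<nu> =
     {\<pi>. prob_kernel M \<pi> \<and>
         (\<forall>\<omega>\<in>space M. distr (\<pi> \<omega>) borel fst = \<mu> \<omega> \<and> distr (\<pi> \<omega>) borel snd = \<nu> \<omega>)}"

definition C_stoch ::
  "'w measure \<Rightarrow> ('w \<Rightarrow> 'x::topological_space \<Rightarrow> 'y::topological_space \<Rightarrow> ennreal)
    \<Rightarrow> ('w \<Rightarrow> 'x measure) \<Rightarrow> ('w \<Rightarrow> 'y measure) \<Rightarrow> ennreal" where
  "C_stoch M c \<mu> \<nu> =
     (INF \<pi>\<in>kernel_couplings M \<mu> \<nu>. \<integral>\<^sup>+\<omega>. (\<integral>\<^sup>+(x, y). c \<omega> x y \<partial>\<pi> \<omega>) \<partial>M)"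

definition L1_kernel ::
  "'w measure \<Rightarrow> ('w \<Rightarrow> 'x::topological_space measure) \<Rightarrow> ('w \<Rightarrow> 'x \<Rightarrow> real) set" where
  "L1_kernel M \<kappa> =
     {f. (\<lambda>(\<omega>, x). f \<omega> x) \<in> borel_measurable (M \<Otimes>\<^sub>M borel) \<and>
         (\<integral>\<^sup>+\<omega>. (\<integral>\<^sup>+x. ennreal \<bar>f \<omega> x\<bar> \<partial>\<kappa> \<omega>) \<partial>M) < \<infinity>}"

text \<open>The bound is uniform in \<open>\<omega>\<close>, the Lipschitz constant is not.\<close>

definition Lip_b :: "'w measure \<Rightarrow> ('w \<Rightarrow> 'x::metric_space \<Rightarrow> real) set" where
  "Lip_b M =
     {f. (\<lambda>(\<omega>, x). f \<omega> x) \<in> borel_measurable (M \<Otimes>\<^sub>M borel) \<and>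
         (\<exists>B. \<forall>\<omega>\<in>space M. \<forall>x. \<bar>f \<omega> x\<bar> \<le> B) \<and>
         (\<forall>\<omega>\<in>space M. \<exists>L. L-lipschitz_on UNIV (f \<omega>))}"

definition dual_feasible ::
  "'w measure \<Rightarrow> ('w \<Rightarrow> 'x \<Rightarrow> 'y \<Rightarrow> ennreal) \<Rightarrow> ('w \<Rightarrow> 'x \<Rightarrow> real) \<Rightarrow> ('w \<Rightarrow> 'y \<Rightarrow> real) \<Rightarrow> bool" where
  "dual_feasible M c \<psi> \<phi> \<longleftrightarrow>
     (\<forall>\<omega>\<in>space M. \<forall>x y. ereal (\<phi> \<omega> y - \<psi> \<omega> x) \<le> enn2ereal (c \<omega> x y))"

text \<open>
  For functions in \<open>L1_kernel\<close> the inner integrals exist for almost every \<open>\<omega>\<close>; on the exceptional null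
  set the Bochner integral takes the value \<open>0\<close>, which does not affect the outer integral.
\<close>

definition dual_value ::
  "'w measure \<Rightarrow> ('w \<Rightarrow> 'x measure) \<Rightarrow> ('w \<Rightarrow> 'y measure)
    \<Rightarrow> ('w \<Rightarrow> 'x \<Rightarrow> real) \<Rightarrow> ('w \<Rightarrow> 'y \<Rightarrow> real) \<Rightarrow> real" where
  "dual_value M \<mu> \<nu> \<psi> \<phi> =
     (\<integral>\<omega>. ((\<integral>y. \<phi> \<omega> y \<partial>\<nu> \<omega>) - (\<integral>x. \<psi> \<omega> x \<partial>\<mu> \<omega>)) \<partial>M)"

end

theory Submission
  imports Defs
begin

text \<open>
  Weak duality is integration of \<open>\<phi> - \<psi> \<le> c\<close> against a coupling. For the converse the supremum and the
  infimum are approached by \<^emph>\<open>explicit formulas\<close> in \<open>(\<mu>\<^sub>\<omega>, \<nu>\<^sub>\<omega>, c\<^sub>\<omega>)\<close>, built from integrals and countable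
  infima only. Such formulas depend measurably on \<open>\<omega>\<close>, so that the couplings and potentials which they
  define are kernels and jointly measurable functions. For one \<open>\<omega>\<close> the construction is as follows.

  \<^item> The cost is replaced by a bounded Lipschitz minorant \<open>b\<close> (\<open>lip_minorant\<close>). The minorants increase
    to \<open>c\<close>, uniformly on compact sets as long as \<open>c\<close> is truncated (\<open>lip_minorant_compact\<close>).

  \<^item> For \<open>b\<close> the entropic regularisation with parameter \<open>\<epsilon>\<close> is solved by the Sinkhorn iteration. It
    produces potentials \<open>\<phi>, \<psi>\<close>, Lipschitz because they are smoothed \<open>b\<close>-transforms, and a density
    \<open>h = exp ((\<phi> - \<psi> - b) / \<epsilon>)\<close> relative to \<open>\<mu> \<otimes> \<nu>\<close> with first marginal \<open>\<mu>\<close>. The dual value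
    increases along the iteration by at least \<open>\<epsilon>\<close> times the relative entropy of \<open>\<nu>\<close> with respect to the second
    marginal, and is bounded, so that the second marginal comes close to \<open>\<nu>\<close> (\<open>defect_small\<close>).
    Since \<open>h ln h\<close> has nonnegative integral, the cost of \<open>h\<close> is at most the dual value up to a small
    error (\<open>cost_h'_le\<close>).

  \<^item> The pair \<open>(\<psi>, \<phi>)\<close> may violate \<open>\<phi> - \<psi> \<le> b\<close>. Replacing \<open>\<phi>\<close> by the \<open>b\<close>-transform of \<open>\<psi>\<close>
    repairs this, at a loss which vanishes with \<open>\<epsilon>\<close> (\<open>dual_gap\<close>): the normalisation
    \<open>\<integral> h(x, y) \<nu>(dy) = 1\<close> prevents \<open>h\<close> from being large on a ball that carries a definite amount of mass.

  \<^item> To pass from \<open>b\<close> to \<open>c\<close>, the density is cut off where \<open>c > b + \<delta>\<close>. By tightness and uniform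
    convergence on compact sets, little mass is lost (\<open>cut_near_optimal\<close>). The missing mass, enlarged by
    a fraction \<open>\<eta>\<close> of the whole, is then transported by a product measure (\<open>completion\<close>). As \<open>c\<close> is
    integrable with respect to \<open>\<mu> \<otimes> \<nu>\<close>, this costs little (\<open>completion_cost\<close>, \<open>plan_near_optimal\<close>).

  The parameters of this construction range over a countable set, and for almost every \<open>\<omega>\<close> some
  choice of them has gap at most \<open>4 \<delta>\<close>. Finitely many choices serve all \<open>\<omega>\<close> outside a set on
  which the cost of the product coupling has small integral. On that set the product coupling and the zero potentials
  are used (\<open>near_optimal_pair\<close>), so that the glued potentials remain uniformly bounded.
\<close>

section \<open>Integrals against kernels\<close>

text \<open>
  Pushing \<open>\<kappa> a\<close> forward along \<open>Pair a\<close> turns an integrand that depends on the parameter into a fixed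
  function on the product space.
\<close>

lemma kernel_integral_measurable:
  fixes f :: "'a \<Rightarrow> 'b::topological_space \<Rightarrow> real"
  assumes f: "(\<lambda>(a, y). f a y) \<in> borel_measurable (M \<Otimes>\<^sub>M borel)"
    and k: "prob_kernel M \<kappa>"
  shows "(\<lambda>a. \<integral>y. f a y \<partial>\<kappa> a) \<in> borel_measurable M"
proof -
  have k': "\<kappa> \<in> M \<rightarrow>\<^sub>M subprob_algebra borel"
    by (rule measurable_prob_algebraD[OF k])
  have id: "(\<lambda>(a, y). (a, y)) \<in> M \<Otimes>\<^sub>M borel \<rightarrow>\<^sub>M M \<Otimes>\<^sub>M (borel :: 'b measure)"
    by simp
  have d: "(\<lambda>a. distr (\<kappa> a) (M \<Otimes>\<^sub>M borel) (Pair a)) \<in> M \<rightarrow>\<^sub>M subprob_algebra (M \<Otimes>\<^sub>M borel)"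
    using measurable_distr2[OF id k'] .
  have "(\<lambda>a. \<integral>z. (case z of (a, y) \<Rightarrow> f a y) \<partial>distr (\<kappa> a) (M \<Otimes>\<^sub>M borel) (Pair a)) \<in> borel_measurable M"
    using measurable_compose[OF d integral_measurable_subprob_algebra[OF f]] .
  also have "?this \<longleftrightarrow> ?thesis"
  proof (rule measurable_cong)
    fix a assume a: "a \<in> space M"
    have s: "sets (\<kappa> a) = sets borel" using k a unfolding prob_kernel_iff by blast
    have Pa: "Pair a \<in> \<kappa> a \<rightarrow>\<^sub>M M \<Otimes>\<^sub>M borel"
      unfolding measurable_cong_sets[OF s refl] by (rule measurable_Pair1'[OF a])
    show "(\<integral>z. (case z of (a, y) \<Rightarrow> f a y) \<partial>distr (\<kappa> a) (M \<Otimes>\<^sub>M borel) (Pair a)) = (\<integral>y. f a y \<partial>\<kappa> a)"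
      using integral_distr[OF Pa f] by simp
  qed
  finally show ?thesis .
qed

lemma kernel_nn_integral_measurable:
  fixes f :: "'a \<Rightarrow> 'b::topological_space \<Rightarrow> ennreal"
  assumes f: "(\<lambda>(a, y). f a y) \<in> borel_measurable (M \<Otimes>\<^sub>M borel)"
    and k: "prob_kernel M \<kappa>"
  shows "(\<lambda>a. \<integral>\<^sup>+y. f a y \<partial>\<kappa> a) \<in> borel_measurable M"
  using nn_integral_measurable_subprob_algebra2[OF f measurable_prob_algebraD[OF k]] .

lemma prob_kernel_pair:
  fixes \<mu> :: "'w \<Rightarrow> 'x::second_countable_topology measure"
    and \<nu> :: "'w \<Rightarrow> 'y::second_countable_topology measure"
  assumes "prob_kernel M \<mu>" "prob_kernel M \<nu>"
  shows "prob_kernel M (\<lambda>\<omega>. \<mu> \<omega> \<Otimes>\<^sub>M \<nu> \<omega>)"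
  using measurable_pair_prob[OF assms] by (simp add: borel_prod)

section \<open>Lipschitz minorants of the cost\<close>

text \<open>
  Infima over a whole space need not be measurable in a parameter. All infima below therefore run along
  a fixed dense sequence; for Lipschitz functions this changes nothing.
\<close>

definition dense_seq :: "nat \<Rightarrow> 'a::second_countable_topology" where
  "dense_seq = (SOME s. \<forall>U. open U \<longrightarrow> U \<noteq> {} \<longrightarrow> (\<exists>n. s n \<in> U))"

lemma dense_seq:
  fixes U :: "'a::second_countable_topology set"
  assumes "open U" "U \<noteq> {}"
  shows "\<exists>n. dense_seq n \<in> U"
proof -
  obtain D :: "'a set" where D: "countable D" "\<And>U. open U \<Longrightarrow> U \<noteq> {} \<Longrightarrow> \<exists>d\<in>D. d \<in> U"
    using countable_dense_setE by metis
  have "D \<noteq> {}" using D(2)[of UNIV] by auto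
  then have "\<exists>s::nat \<Rightarrow> 'a. \<forall>U. open U \<longrightarrow> U \<noteq> {} \<longrightarrow> (\<exists>n. s n \<in> U)"
    by (intro exI[of _ "from_nat_into D"] allI impI) (metis D from_nat_into_surj)
  from someI_ex[OF this] show ?thesis using assms unfolding dense_seq_def by blast
qed

lemma dense_seq_near:
  fixes x :: "'a::{metric_space, second_countable_topology}"
  assumes "0 < e"
  shows "\<exists>n. dist x (dense_seq n) < e"
  using dense_seq[of "ball x e"] assms by auto

lemma cINF_nonneg_le:
  fixes f :: "nat \<Rightarrow> real"
  assumes "\<And>i. 0 \<le> f i"
  shows "(INF i. f i) \<le> f i"
  by (rule cINF_lower) (auto intro!: bdd_belowI2[where m=0] assms)

text \<open>
  The infimal convolution of the truncated function \<open>min f n\<close> with \<open>n\<close> times the distance.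
\<close>

definition lip_minorant :: "('a::{metric_space, second_countable_topology} \<Rightarrow> ennreal) \<Rightarrow> nat \<Rightarrow> 'a \<Rightarrow> real" where
  "lip_minorant f n z =
     (INF i. enn2real (min (f (dense_seq i)) (of_nat n)) + of_nat n * dist z (dense_seq i))"

lemma lip_minorant_le:
  "lip_minorant f n z \<le> enn2real (min (f (dense_seq i)) (of_nat n)) + of_nat n * dist z (dense_seq i)"
  unfolding lip_minorant_def by (rule cINF_nonneg_le) simp

lemma lip_minorant_nonneg: "0 \<le> lip_minorant f n z"
  unfolding lip_minorant_def by (rule cINF_greatest) auto

lemma lip_minorant_diff:
  "lip_minorant f n z \<le> lip_minorant f n w + of_nat n * dist z w"
proof -
  have "lip_minorant f n z - of_nat n * dist z w \<le> lip_minorant f n w"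
    unfolding lip_minorant_def[of f n w]
  proof (rule cINF_greatest)
    fix i :: nat
    have "real n * dist z (dense_seq i) \<le> real n * (dist z w + dist w (dense_seq i))"
      by (intro mult_left_mono dist_triangle) simp
    then show "lip_minorant f n z - of_nat n * dist z w
        \<le> enn2real (min (f (dense_seq i)) (of_nat n)) + real n * dist w (dense_seq i)"
      using lip_minorant_le[of f n z i] by (simp add: algebra_simps)
  qed simp
  then show ?thesis by simp
qed

lemma lip_minorant_abs_diff:
  "\<bar>lip_minorant f n z - lip_minorant f n w\<bar> \<le> of_nat n * dist z w"
  using lip_minorant_diff[of f n z w] lip_minorant_diff[of f n w z]
  by (auto simp: dist_commute abs_le_iff)

lemma lip_minorant_le_n: "lip_minorant f n z \<le> of_nat n"
proof (rule field_le_epsilon)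
  fix e :: real assume e: "0 < e"
  obtain i where i: "dist z (dense_seq i) < e / (real n + 1)"
    using dense_seq_near[of "e / (real n + 1)" z] e by auto
  have "real n * dist z (dense_seq i) \<le> (real n + 1) * dist z (dense_seq i)"
    by (simp add: mult_right_mono)
  also have "\<dots> \<le> e" using i by (simp add: field_simps)
  finally have a: "real n * dist z (dense_seq i) \<le> e" .
  have "enn2real (min (f (dense_seq i)) (of_nat n)) \<le> enn2real (of_nat n)"
    by (intro enn2real_mono) (auto simp: of_nat_less_top)
  then have "enn2real (min (f (dense_seq i)) (of_nat n)) \<le> real n" by simp
  with a lip_minorant_le[of f n z i] show "lip_minorant f n z \<le> real n + e" by simp
qed

lemma lip_minorant_le_cost:
  assumes c: "continuous_on UNIV f"
  shows "ennreal (lip_minorant f n z) \<le> f z"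
proof (cases "f z < \<top>")
  case True
  have "lip_minorant f n z \<le> enn2real (f z)"
  proof (rule field_le_epsilon)
    fix e :: real assume e: "0 < e"
    define U where "U = {w. f w < f z + ennreal (e / 2)} \<inter> ball z (e / (2 * (real n + 1)))"
    have "open {w. f w < f z + ennreal (e / 2)}"
      by (intro open_Collect_less c continuous_on_const)
    then have "open U" unfolding U_def by (intro open_Int open_ball)
    moreover have "z \<in> U"
      using e True ennreal_add_left_cancel_less[of "f z" 0 "ennreal (e / 2)"]
      by (auto simp: U_def)
    ultimately obtain i where i: "dense_seq i \<in> U"
      using dense_seq[of U] by blast
    have "real n * dist z (dense_seq i) \<le> (real n + 1) * dist z (dense_seq i)"
      by (simp add: mult_right_mono)
    also have "\<dots> \<le> e / 2" using i by (simp add: U_def field_simps)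
    finally have a: "real n * dist z (dense_seq i) \<le> e / 2" .
    have "enn2real (min (f (dense_seq i)) (of_nat n)) \<le> enn2real (f z + ennreal (e / 2))"
      using i True by (intro enn2real_mono) (auto simp: U_def min.coboundedI1)
    also have "\<dots> = enn2real (f z) + e / 2"
      using True e by (subst enn2real_plus) auto
    finally show "lip_minorant f n z \<le> enn2real (f z) + e"
      using a lip_minorant_le[of f n z i] by simp
  qed
  then have "ennreal (lip_minorant f n z) \<le> ennreal (enn2real (f z))" by (rule ennreal_leI)
  then show ?thesis using True by simp
next
  case False
  then have "f z = \<top>" using less_top[of "f z"] by blast
  then show ?thesis by simp
qed

text \<open>Pointwise convergence of the minorants; on compact sets it will be uniform.\<close>

lemma lip_minorant_eventually_ge:
  assumes c: "continuous_on UNIV f" and a: "ennreal a < f z" "0 < a"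
  shows "\<exists>n0. \<forall>n\<ge>n0. a \<le> lip_minorant f n z"
proof -
  have "open {w. ennreal a < f w}"
    by (intro open_Collect_less c continuous_on_const)
  then obtain r where r: "r > 0" "ball z r \<subseteq> {w. ennreal a < f w}"
    using a by (auto elim: openE)
  obtain n0 where n0: "real n0 \<ge> max a (a / r)" using real_arch_simple by blast
  show ?thesis
  proof (intro exI[of _ n0] allI impI)
    fix n assume "n \<ge> n0"
    then have "real n \<ge> a" "real n \<ge> a / r"
      using n0 by auto
    then have n: "real n \<ge> a" "real n * r \<ge> a"
      using r(1) by (auto simp: pos_divide_le_eq)
    show "a \<le> lip_minorant f n z"
      unfolding lip_minorant_def
    proof (rule cINF_greatest)
      fix i :: nat
      show "a \<le> enn2real (min (f (dense_seq i)) (of_nat n)) + real n * dist z (dense_seq i)"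
      proof (cases "dist z (dense_seq i) < r")
        case True
        then have "ennreal a \<le> min (f (dense_seq i)) (of_nat n)"
          using r n a by (auto simp: ennreal_of_nat_eq_real_of_nat intro: less_imp_le)
        then have "enn2real (ennreal a) \<le> enn2real (min (f (dense_seq i)) (of_nat n))"
          by (intro enn2real_mono) (auto simp: of_nat_less_top min_less_iff_disj)
        then have "a \<le> enn2real (min (f (dense_seq i)) (of_nat n))" using a by simp
        moreover have "0 \<le> real n * dist z (dense_seq i)" by simp
        ultimately show ?thesis by linarith
      next
        case False
        then have "a \<le> real n * dist z (dense_seq i)"
          using n(2) mult_left_mono[of r "dist z (dense_seq i)" "real n"] by simp
        then show ?thesis by (simp add: add_increasing)
      qed
    qed simp
  qed
qed

lemma lip_minorant_mono:
  assumes "m \<le> n" shows "lip_minorant f m z \<le> lip_minorant f n z"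
  unfolding lip_minorant_def[of f n]
proof (rule cINF_greatest)
  fix i :: nat
  have "enn2real (min (f (dense_seq i)) (of_nat m)) \<le> enn2real (min (f (dense_seq i)) (of_nat n))"
    using assms by (intro enn2real_mono min.mono) (auto simp: of_nat_less_top min_less_iff_disj)
  moreover have "real m * dist z (dense_seq i) \<le> real n * dist z (dense_seq i)"
    using assms by (intro mult_right_mono) auto
  ultimately show "lip_minorant f m z
      \<le> enn2real (min (f (dense_seq i)) (of_nat n)) + real n * dist z (dense_seq i)"
    using lip_minorant_le[of f m z i] by linarith
qed simp

text \<open>
  The sets on which the truncated function is less than \<open>\<delta>\<close> above the minorant are open, increase
  with \<open>n\<close> and cover the space, so that one of them contains the compact set. This is Dini's argument. The
  truncation at \<open>m\<close> is what makes a uniform bound possible where \<open>f\<close> is infinite.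
\<close>

lemma lip_minorant_compact:
  assumes c: "continuous_on UNIV f" and K: "compact K" and d: "0 < \<delta>" "0 < m"
  shows "\<exists>n0. \<forall>n\<ge>n0. \<forall>z\<in>K. min (f z) (ennreal m) \<le> ennreal (lip_minorant f n z + \<delta>)"
proof -
  define U where "U n = {z. min (f z) (ennreal m) < ennreal (lip_minorant f n z + \<delta>)}" for n
  have cl: "continuous_on UNIV (lip_minorant f n)" for n
    by (rule lipschitz_on_continuous_on[of "real n"])
      (auto intro!: lipschitz_onI simp: dist_real_def lip_minorant_abs_diff)
  have "open (U n)" for n
    unfolding U_def
    by (intro open_Collect_less continuous_on_min c continuous_on_const continuous_on_ennreal
        continuous_on_add cl)
  moreover have "\<exists>n. z \<in> U n" for z
  proof (cases "min (f z) (ennreal m) < ennreal \<delta>")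
    case True
    moreover have "ennreal \<delta> \<le> ennreal (lip_minorant f 0 z + \<delta>)"
      using lip_minorant_nonneg[of f 0 z] by (intro ennreal_leI) simp
    ultimately have "z \<in> U 0" unfolding U_def by auto
    then show ?thesis by blast
  next
    case False
    define v where "v = enn2real (min (f z) (ennreal m))"
    have v: "min (f z) (ennreal m) = ennreal v"
      by (simp add: v_def min_less_iff_disj)
    have v0: "\<delta> \<le> v"
    proof -
      have "ennreal \<delta> \<le> ennreal v" using False v by simp
      moreover have "0 \<le> v" by (simp add: v_def)
      ultimately show ?thesis by (simp add: ennreal_le_iff)
    qed
    have "ennreal (v - \<delta> / 2) < ennreal v"
      using v0 d by (intro ennreal_lessI) auto
    also have "\<dots> \<le> f z" using v by (metis min.cobounded1)
    finally obtain n where "v - \<delta> / 2 \<le> lip_minorant f n z"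
      using lip_minorant_eventually_ge[OF c, of "v - \<delta> / 2" z] v0 d by auto
    then have "ennreal v < ennreal (lip_minorant f n z + \<delta>)"
      using v0 d by (intro ennreal_lessI) auto
    then show ?thesis using v by (auto simp: U_def)
  qed
  ultimately obtain C where C: "finite C" "K \<subseteq> (\<Union>n\<in>C. U n)"
    using compactE_image[OF K, of UNIV U] by (metis UNIV_I UN_I subsetI)
  show ?thesis
  proof (intro exI[of _ "Max (insert 0 C)"] allI impI ballI)
    fix n z assume n: "Max (insert 0 C) \<le> n" and "z \<in> K"
    then obtain k where k: "k \<in> C" "z \<in> U k" using C by auto
    then have "k \<le> n" using n C(1) by auto
    then have "ennreal (lip_minorant f k z + \<delta>) \<le> ennreal (lip_minorant f n z + \<delta>)"
      by (intro ennreal_leI add_right_mono lip_minorant_mono)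
    then show "min (f z) (ennreal m) \<le> ennreal (lip_minorant f n z + \<delta>)"
      using k(2) by (auto simp: U_def)
  qed
qed

section \<open>Logarithmic exponential averages\<close>

lemma (in prob_space) integrable_bounded:
  fixes f :: "'a \<Rightarrow> real"
  assumes "f \<in> borel_measurable M" "\<And>x. \<bar>f x\<bar> \<le> R"
  shows "integrable M f"
  by (rule integrable_const_bound[where B=R]) (use assms in auto)

text \<open>
  The smoothed maximum of \<open>f\<close>; it tends to the essential supremum as \<open>\<epsilon>\<close> tends to \<open>0\<close>.
\<close>

definition log_int_exp :: "'a measure \<Rightarrow> real \<Rightarrow> ('a \<Rightarrow> real) \<Rightarrow> real" where
  "log_int_exp N \<epsilon> f = \<epsilon> * ln (\<integral>y. exp (f y / \<epsilon>) \<partial>N)"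

context prob_space
begin

lemma integrable_exp_bounded:
  fixes f :: "'a \<Rightarrow> real"
  assumes "0 < \<epsilon>" "f \<in> borel_measurable M" "\<And>x. \<bar>f x\<bar> \<le> R"
  shows "integrable M (\<lambda>y. exp (f y / \<epsilon>))"
proof (rule integrable_bounded[where R="exp (R / \<epsilon>)"])
  show "\<bar>exp (f x / \<epsilon>)\<bar> \<le> exp (R / \<epsilon>)" for x
    using assms(1) assms(3)[of x] by (auto simp: divide_right_mono)
qed (use assms in measurable)

lemma int_exp_pos:
  fixes f :: "'a \<Rightarrow> real"
  assumes "0 < \<epsilon>" "f \<in> borel_measurable M" "\<And>x. \<bar>f x\<bar> \<le> R"
  shows "0 < (\<integral>y. exp (f y / \<epsilon>) \<partial>M)"
proof -
  have "exp (- R / \<epsilon>) \<le> (\<integral>y. exp (f y / \<epsilon>) \<partial>M)"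
  proof (rule integral_ge_const[OF integrable_exp_bounded[OF assms]])
    have "exp (- R / \<epsilon>) \<le> exp (f x / \<epsilon>)" for x
      using assms(1) assms(3)[of x] by (intro exp_le_cancel_iff[THEN iffD2] divide_right_mono) auto
    then show "AE x in M. exp (- R / \<epsilon>) \<le> exp (f x / \<epsilon>)" by simp
  qed
  then show ?thesis by (rule less_le_trans[OF exp_gt_zero])
qed

lemma exp_log_int_exp:
  fixes f :: "'a \<Rightarrow> real"
  assumes "0 < \<epsilon>" "f \<in> borel_measurable M" "\<And>x. \<bar>f x\<bar> \<le> R"
  shows "exp (log_int_exp M \<epsilon> f / \<epsilon>) = (\<integral>y. exp (f y / \<epsilon>) \<partial>M)"
  using int_exp_pos[OF assms] assms(1) by (simp add: log_int_exp_def)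

lemma log_int_exp_normalised:
  fixes f :: "'a \<Rightarrow> real"
  assumes "0 < \<epsilon>" "f \<in> borel_measurable M" "\<And>x. \<bar>f x\<bar> \<le> R"
  shows "(\<integral>y. exp ((f y - log_int_exp M \<epsilon> f) / \<epsilon>) \<partial>M) = 1"
proof -
  have "(\<integral>y. exp ((f y - log_int_exp M \<epsilon> f) / \<epsilon>) \<partial>M)
      = (\<integral>y. exp (f y / \<epsilon>) \<partial>M) / exp (log_int_exp M \<epsilon> f / \<epsilon>)"
    by (simp add: diff_divide_distrib exp_diff)
  also have "\<dots> = 1"
    using int_exp_pos[OF assms] by (simp add: exp_log_int_exp[OF assms])
  finally show ?thesis .
qed

lemma log_int_exp_mono:
  fixes f g :: "'a \<Rightarrow> real"
  assumes e: "0 < \<epsilon>" and f: "f \<in> borel_measurable M" "\<And>x. \<bar>f x\<bar> \<le> R"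
    and g: "g \<in> borel_measurable M" "\<And>x. \<bar>g x\<bar> \<le> S"
    and le: "\<And>x. f x \<le> g x + a"
  shows "log_int_exp M \<epsilon> f \<le> log_int_exp M \<epsilon> g + a"
proof -
  have "(\<integral>y. exp (f y / \<epsilon>) \<partial>M) \<le> (\<integral>y. exp (a / \<epsilon>) * exp (g y / \<epsilon>) \<partial>M)"
  proof (rule integral_mono)
    show "exp (f y / \<epsilon>) \<le> exp (a / \<epsilon>) * exp (g y / \<epsilon>)" for y
      using le[of y] e by (simp add: divide_right_mono add.commute flip: exp_add add_divide_distrib)
  qed (use integrable_exp_bounded[OF e] f g in auto)
  also have "\<dots> = exp ((log_int_exp M \<epsilon> g + a) / \<epsilon>)"
    by (simp add: add_divide_distrib exp_add exp_log_int_exp[OF e g])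
  finally show ?thesis
    using e by (simp add: divide_le_cancel flip: exp_log_int_exp[OF e f])
qed

lemma log_int_exp_const [simp]: "0 < \<epsilon> \<Longrightarrow> log_int_exp M \<epsilon> (\<lambda>_. a) = a"
  by (simp add: log_int_exp_def prob_space)

lemma log_int_exp_bounded:
  fixes f :: "'a \<Rightarrow> real"
  assumes "0 < \<epsilon>" "f \<in> borel_measurable M" "\<And>x. \<bar>f x\<bar> \<le> R"
  shows "\<bar>log_int_exp M \<epsilon> f\<bar> \<le> R"
proof -
  have "log_int_exp M \<epsilon> f \<le> log_int_exp M \<epsilon> (\<lambda>_. 0) + R"
    by (rule log_int_exp_mono[where R=R and S=0]) (use assms in \<open>auto simp: abs_le_iff\<close>)
  moreover have "0 \<le> f x + R" for x using assms(3)[of x] by simp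
  then have "log_int_exp M \<epsilon> (\<lambda>_. 0) \<le> log_int_exp M \<epsilon> f + R"
    by (intro log_int_exp_mono[where R=0 and S=R]) (use assms in auto)
  ultimately show ?thesis using assms(1) by simp
qed

text \<open>
  Quantifies how close the smoothed maximum is to the maximum: a value that is almost attained on
  a set of mass \<open>\<kappa>\<close> is exceeded up to an error \<open>\<epsilon> * ln (1 / \<kappa>)\<close>.
\<close>

lemma log_int_exp_ge_on:
  fixes f :: "'a \<Rightarrow> real"
  assumes e: "0 < \<epsilon>" and f: "f \<in> borel_measurable M" "\<And>x. \<bar>f x\<bar> \<le> R"
    and A: "A \<in> events" "0 < \<kappa>" "\<kappa> \<le> prob A" and ge: "\<And>x. x \<in> A \<Longrightarrow> v \<le> f x + D"
  shows "v \<le> log_int_exp M \<epsilon> f + D + \<epsilon> * ln (1 / \<kappa>)"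
proof -
  have "\<kappa> * exp ((v - D) / \<epsilon>) \<le> prob A * exp ((v - D) / \<epsilon>)"
    using A by (intro mult_right_mono) auto
  also have "\<dots> = (\<integral>y. indicator A y * exp ((v - D) / \<epsilon>) \<partial>M)"
    using A(1) by simp
  also have "\<dots> \<le> (\<integral>y. exp (f y / \<epsilon>) \<partial>M)"
  proof (rule integral_mono)
    show "indicator A y * exp ((v - D) / \<epsilon>) \<le> exp (f y / \<epsilon>)" for y
      using ge[of y] e by (auto simp: indicator_def divide_right_mono)
  qed (use A(1) integrable_exp_bounded[OF e f] in \<open>auto intro: integrable_bounded[where R=1]\<close>)
  also have "\<dots> = exp (log_int_exp M \<epsilon> f / \<epsilon>)" by (simp add: exp_log_int_exp[OF e f])
  finally have "ln (\<kappa> * exp ((v - D) / \<epsilon>)) \<le> log_int_exp M \<epsilon> f / \<epsilon>"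
    using A(2) by (metis exp_gt_zero ln_exp ln_mono mult_pos_pos)
  then have "\<epsilon> * (ln \<kappa> + (v - D) / \<epsilon>) \<le> log_int_exp M \<epsilon> f"
    using e A(2) by (simp add: ln_mult field_simps)
  then show ?thesis using e A(2) by (simp add: ln_div distrib_left)
qed

end

section \<open>The Sinkhorn iteration\<close>

text \<open>
  Sinkhorn's algorithm in terms of the logarithms of the scaling factors. Only the potential on the
  second space is iterated; the one on the first space is determined by it (\<open>sinkhorn_dual\<close>).
\<close>

primrec sinkhorn ::
  "'x measure \<Rightarrow> 'y measure \<Rightarrow> ('x \<Rightarrow> 'y \<Rightarrow> real) \<Rightarrow> real \<Rightarrow> nat \<Rightarrow> 'y \<Rightarrow> real" where
  "sinkhorn \<mu> \<nu> b \<epsilon> 0 = (\<lambda>y. 0)"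
| "sinkhorn \<mu> \<nu> b \<epsilon> (Suc k) = (\<lambda>y. - log_int_exp \<mu> \<epsilon>
     (\<lambda>x. - log_int_exp \<nu> \<epsilon> (\<lambda>y'. sinkhorn \<mu> \<nu> b \<epsilon> k y' - b x y') - b x y))"

definition sinkhorn_dual ::
  "'x measure \<Rightarrow> 'y measure \<Rightarrow> ('x \<Rightarrow> 'y \<Rightarrow> real) \<Rightarrow> real \<Rightarrow> nat \<Rightarrow> 'x \<Rightarrow> real" where
  "sinkhorn_dual \<mu> \<nu> b \<epsilon> k x = log_int_exp \<nu> \<epsilon> (\<lambda>y. sinkhorn \<mu> \<nu> b \<epsilon> k y - b x y)"

definition sinkhorn_density ::
  "'x measure \<Rightarrow> 'y measure \<Rightarrow> ('x \<Rightarrow> 'y \<Rightarrow> real) \<Rightarrow> real \<Rightarrow> nat \<Rightarrow> 'x \<Rightarrow> 'y \<Rightarrow> real" where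
  "sinkhorn_density \<mu> \<nu> b \<epsilon> k x y =
     exp ((sinkhorn \<mu> \<nu> b \<epsilon> k y - sinkhorn_dual \<mu> \<nu> b \<epsilon> k x - b x y) / \<epsilon>)"

text \<open>
  The Sinkhorn density has the correct first marginal. Dividing by the density of the second
  marginal wherever that exceeds \<open>1\<close> gives a density both of whose marginals are dominated by the
  prescribed ones.
\<close>

definition sub_density ::
  "'x measure \<Rightarrow> 'y measure \<Rightarrow> ('x \<Rightarrow> 'y \<Rightarrow> real) \<Rightarrow> real \<Rightarrow> nat \<Rightarrow> 'x \<Rightarrow> 'y \<Rightarrow> real" where
  "sub_density \<mu> \<nu> b \<epsilon> k x y = sinkhorn_density \<mu> \<nu> b \<epsilon> k x y /
     max 1 (\<integral>x'. sinkhorn_density \<mu> \<nu> b \<epsilon> k x' y \<partial>\<mu>)"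

definition c_transform :: "('x::second_countable_topology \<Rightarrow> 'y \<Rightarrow> real) \<Rightarrow> ('x \<Rightarrow> real) \<Rightarrow> 'y \<Rightarrow> real" where
  "c_transform b \<psi> y = (INF i. \<psi> (dense_seq i) + b (dense_seq i) y)"

lemma exp_split:
  fixes p q r e :: real
  shows "exp ((p - q - r) / e) = exp (p / e) * exp ((- q - r) / e)"
    and "exp ((p - q - r) / e) = exp (- q / e) * exp ((p - r) / e)"
  by (simp_all add: diff_divide_distrib flip: exp_add)

text \<open>
  A single constant \<open>B\<close> serves as a bound and as a Lipschitz constant, as it does for \<open>lip_minorant\<close>.
\<close>

locale lipschitz_cost =
  fixes \<mu> :: "'x::polish_space measure" and \<nu> :: "'y::polish_space measure"
    and b :: "'x \<Rightarrow> 'y \<Rightarrow> real" and B :: real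
  assumes prob_\<mu>: "prob_space \<mu>" and prob_\<nu>: "prob_space \<nu>"
    and sets_\<mu> [measurable_cong]: "sets \<mu> = sets borel"
    and sets_\<nu> [measurable_cong]: "sets \<nu> = sets borel"
    and b_measurable [measurable]: "(\<lambda>(x, y). b x y) \<in> borel_measurable (borel \<Otimes>\<^sub>M borel)"
    and b_nonneg: "0 \<le> b x y" and b_le: "b x y \<le> B"
    and b_lip1: "\<bar>b x y - b x' y\<bar> \<le> B * dist x x'"
    and b_lip2: "\<bar>b x y - b x y'\<bar> \<le> B * dist y y'"
begin

sublocale X: prob_space \<mu> by (rule prob_\<mu>)
sublocale Y: prob_space \<nu> by (rule prob_\<nu>)
sublocale XY: pair_prob_space \<mu> \<nu> ..

lemma space_\<mu> [simp]: "space \<mu> = UNIV" using sets_eq_imp_space_eq[OF sets_\<mu>] by simp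
lemma space_\<nu> [simp]: "space \<nu> = UNIV" using sets_eq_imp_space_eq[OF sets_\<nu>] by simp

lemma prob_UNIV [simp]: "X.prob UNIV = 1" "Y.prob UNIV = 1"
  using X.prob_space Y.prob_space by simp_all

lemma B_nonneg: "0 \<le> B"
  using b_nonneg b_le by (meson order_trans)

lemma integral_swap:
  fixes f :: "'x \<Rightarrow> 'y \<Rightarrow> real"
  assumes [measurable]: "(\<lambda>(x, y). f x y) \<in> borel_measurable (borel \<Otimes>\<^sub>M borel)" and "\<And>x y. \<bar>f x y\<bar> \<le> R"
  shows "(\<integral>y. (\<integral>x. f x y \<partial>\<mu>) \<partial>\<nu>) = (\<integral>x. (\<integral>y. f x y \<partial>\<nu>) \<partial>\<mu>)"
  by (intro XY.Fubini_integral XY.integrable_bounded[where R=R]) (use assms in auto)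

end

locale sinkhorn_iteration = lipschitz_cost +
  fixes \<epsilon> :: real
  assumes eps: "0 < \<epsilon>"
begin

abbreviation "\<phi> \<equiv> sinkhorn \<mu> \<nu> b \<epsilon>"
abbreviation "\<psi> \<equiv> sinkhorn_dual \<mu> \<nu> b \<epsilon>"
abbreviation "h \<equiv> sinkhorn_density \<mu> \<nu> b \<epsilon>"
abbreviation "h' \<equiv> sub_density \<mu> \<nu> b \<epsilon>"
abbreviation "g k y \<equiv> (\<integral>x. h k x y \<partial>\<mu>)"

lemma \<phi>_Suc: "\<phi> (Suc k) y = - log_int_exp \<mu> \<epsilon> (\<lambda>x. - \<psi> k x - b x y)"
  by (simp add: sinkhorn_dual_def)

declare sinkhorn.simps(2) [simp del]

text \<open>
  The bounds grow with \<open>k\<close>. They serve integrability only; the estimates use the oscillation, which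
  is at most \<open>B\<close> in every step (\<open>\<phi>_osc\<close>).
\<close>

lemma \<phi>_measurable_bounded:
  "\<phi> k \<in> borel_measurable borel \<and> (\<forall>y. \<bar>\<phi> k y\<bar> \<le> 2 * real k * B)
   \<and> \<psi> k \<in> borel_measurable borel \<and> (\<forall>x. \<bar>\<psi> k x\<bar> \<le> (2 * real k + 1) * B)"
proof (induction k)
  have *: "\<psi> k \<in> borel_measurable borel \<and> (\<forall>x. \<bar>\<psi> k x\<bar> \<le> (2 * real k + 1) * B)"
    if [measurable]: "\<phi> k \<in> borel_measurable borel" and bd: "\<forall>y. \<bar>\<phi> k y\<bar> \<le> 2 * real k * B" for k
  proof
    show "\<psi> k \<in> borel_measurable borel"
      unfolding sinkhorn_dual_def log_int_exp_def by measurable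
    show "\<forall>x. \<bar>\<psi> k x\<bar> \<le> (2 * real k + 1) * B"
      unfolding sinkhorn_dual_def
    proof (intro allI Y.log_int_exp_bounded[OF eps])
      fix x y show "\<bar>\<phi> k y - b x y\<bar> \<le> (2 * real k + 1) * B"
        using bd[rule_format, of y] b_nonneg[of x y] b_le[of x y] by (simp add: algebra_simps abs_le_iff)
    qed measurable
  qed
  {
    case 0
    show ?case using *[of 0] by simp
  next
    case (Suc k)
    then have [measurable]: "\<psi> k \<in> borel_measurable borel" by simp
    have m: "\<phi> (Suc k) \<in> borel_measurable borel"
      unfolding \<phi>_Suc[abs_def] log_int_exp_def by measurable
    have "\<bar>\<phi> (Suc k) y\<bar> \<le> 2 * real (Suc k) * B" for y
      unfolding \<phi>_Suc abs_minus_cancel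
    proof (intro X.log_int_exp_bounded[OF eps])
      fix x show "\<bar>- \<psi> k x - b x y\<bar> \<le> 2 * real (Suc k) * B"
        using Suc b_nonneg[of x y] b_le[of x y] by (auto simp: algebra_simps abs_le_iff) (smt (verit))+
    qed measurable
    with m *[of "Suc k"] show ?case by blast
  }
qed

lemma \<phi>_measurable [measurable]: "\<phi> k \<in> borel_measurable borel"
  and \<psi>_measurable [measurable]: "\<psi> k \<in> borel_measurable borel"
  and \<phi>_bounded: "\<bar>\<phi> k y\<bar> \<le> 2 * real k * B"
  and \<psi>_bounded: "\<bar>\<psi> k x\<bar> \<le> (2 * real k + 1) * B"
  using \<phi>_measurable_bounded[of k] by auto

lemma \<phi>_minus_b: "\<bar>\<phi> k y - b x y\<bar> \<le> (2 * real k + 1) * B"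
  using \<phi>_bounded[of k y] b_nonneg[of x y] b_le[of x y] by (simp add: algebra_simps abs_le_iff)

lemma \<psi>_minus_b: "\<bar>- \<psi> k x - b x y\<bar> \<le> (2 * real k + 2) * B"
  using \<psi>_bounded[of k x] b_nonneg[of x y] b_le[of x y] by (simp add: algebra_simps abs_le_iff)

text \<open>
  Both potentials inherit their modulus of continuity from \<open>b\<close>, as transforms do: the smoothed
  maximum is monotone and commutes with adding constants.
\<close>

lemma \<psi>_diff:
  assumes "\<And>y. b x' y \<le> b x y + a"
  shows "\<psi> k x \<le> \<psi> k x' + a"
  unfolding sinkhorn_dual_def
  by (rule Y.log_int_exp_mono[OF eps _ \<phi>_minus_b _ \<phi>_minus_b]) (use assms in \<open>auto simp: algebra_simps\<close>)

lemma \<phi>_diff: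
  assumes "\<And>x. b x y \<le> b x y' + a" "0 \<le> a"
  shows "\<phi> k y \<le> \<phi> k y' + a"
proof (cases k)
  case (Suc j)
  have "log_int_exp \<mu> \<epsilon> (\<lambda>x. - \<psi> j x - b x y') \<le> log_int_exp \<mu> \<epsilon> (\<lambda>x. - \<psi> j x - b x y) + a"
    by (rule X.log_int_exp_mono[OF eps _ \<psi>_minus_b _ \<psi>_minus_b]) (use assms in \<open>auto simp: algebra_simps\<close>)
  then show ?thesis unfolding Suc \<phi>_Suc by simp
qed (use assms in simp)

lemma \<psi>_lip: "\<bar>\<psi> k x - \<psi> k x'\<bar> \<le> B * dist x x'"
proof -
  have "b x y \<le> b x' y + B * dist x x'" "b x' y \<le> b x y + B * dist x x'" for y
    using b_lip1[of x y x'] by auto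
  then have "\<psi> k x \<le> \<psi> k x' + B * dist x x'" "\<psi> k x' \<le> \<psi> k x + B * dist x x'"
    by (auto intro!: \<psi>_diff)
  then show ?thesis by auto
qed

lemma \<phi>_lip: "\<phi> k y \<le> \<phi> k y' + B * dist y y'"
proof (rule \<phi>_diff)
  show "b x y \<le> b x y' + B * dist y y'" for x
    using b_lip2[of x y y'] by auto
qed (simp add: B_nonneg)

lemma \<phi>_osc: "\<phi> k y \<le> \<phi> k y' + B"
proof (rule \<phi>_diff)
  show "b x y \<le> b x y' + B" for x
    using b_le[of x y] b_nonneg[of x y'] by auto
qed (simp add: B_nonneg)

lemma h_measurable [measurable]: "(\<lambda>(x, y). h k x y) \<in> borel_measurable (borel \<Otimes>\<^sub>M borel)"
  unfolding sinkhorn_density_def by measurable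

lemma h_pos: "0 < h k x y"
  by (simp add: sinkhorn_density_def)

lemma exponent_bounded: "\<bar>\<phi> j y - \<psi> k x - b x y\<bar> \<le> (2 * real j + 2 * real k + 2) * B"
  using \<phi>_bounded[of j y] \<psi>_minus_b[of k x y] by (simp add: algebra_simps abs_le_iff)

lemma h_bounded: "\<exists>R. \<forall>x y. h k x y \<le> R"
proof (intro exI allI)
  fix x y
  show "h k x y \<le> exp ((2 * real k + 2 * real k + 2) * B / \<epsilon>)"
    using exponent_bounded[of k y k x] eps
    by (auto simp: sinkhorn_density_def abs_le_iff intro!: divide_right_mono)
qed

text \<open>
  The potential \<open>\<psi> k\<close> is chosen precisely so that the first marginal is exact.
\<close>

lemma int_h [simp]: "(\<integral>y. h k x y \<partial>\<nu>) = 1"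
  using Y.log_int_exp_normalised[OF eps _ \<phi>_minus_b[of k _ x]]
  by (simp add: sinkhorn_density_def sinkhorn_dual_def algebra_simps)

text \<open>
  The next iterate divides the scaling factor by the density \<open>g k\<close> of the second marginal, which corrects that marginal
  and disturbs the first one.
\<close>

lemma g_eq: "g k y = exp ((\<phi> k y - \<phi> (Suc k) y) / \<epsilon>)"
proof -
  have "g k y = (\<integral>x. exp (\<phi> k y / \<epsilon>) * exp ((- \<psi> k x - b x y) / \<epsilon>) \<partial>\<mu>)"
    unfolding sinkhorn_density_def exp_split(1) ..
  also have "\<dots> = exp (\<phi> k y / \<epsilon>) * exp (log_int_exp \<mu> \<epsilon> (\<lambda>x. - \<psi> k x - b x y) / \<epsilon>)"
    by (simp add: X.exp_log_int_exp[OF eps _ \<psi>_minus_b])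
  also have "\<dots> = exp ((\<phi> k y - \<phi> (Suc k) y) / \<epsilon>)"
    unfolding \<phi>_Suc by (simp add: diff_divide_distrib add_divide_distrib flip: exp_add)
  finally show ?thesis .
qed


abbreviation "V k \<equiv> (\<integral>y. \<phi> k y \<partial>\<nu>) - (\<integral>x. \<psi> k x \<partial>\<mu>)"
abbreviation "defect k \<equiv> (\<integral>y. max 0 (1 - g k y) \<partial>\<nu>)"

lemma \<phi>_integrable [simp]: "integrable \<nu> (\<phi> k)"
  by (rule Y.integrable_bounded[OF _ \<phi>_bounded]) measurable

lemma \<psi>_integrable [simp]: "integrable \<mu> (\<psi> k)"
  by (rule X.integrable_bounded[OF _ \<psi>_bounded]) measurable

lemma g_pos: "0 < g k y"
  by (simp add: g_eq)

lemma g_bounded: "\<exists>R. \<forall>y. \<bar>g k y\<bar> \<le> R"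
proof -
  have "\<bar>g k y\<bar> \<le> exp ((2 * real k * B + 2 * real (Suc k) * B) / \<epsilon>)" for y
    using \<phi>_bounded[of k y] \<phi>_bounded[of "Suc k" y] eps
    by (auto simp: g_eq abs_le_iff intro!: divide_right_mono)
  then show ?thesis by blast
qed

lemma g_integrable [simp]: "integrable \<nu> (g k)"
  using g_bounded[of k] by (auto intro: Y.integrable_bounded)

lemma h_integrable [simp]: "integrable \<nu> (h k x)" "integrable \<mu> (\<lambda>x. h k x y)"
proof -
  obtain R where R: "\<And>x y. h k x y \<le> R" using h_bounded by blast
  then have R': "\<bar>h k x y\<bar> \<le> R" for x y using h_pos[of k x y] by (simp add: abs_of_pos)
  show "integrable \<nu> (h k x)" "integrable \<mu> (\<lambda>x. h k x y)"
    by (auto intro!: X.integrable_bounded[OF _ R'] Y.integrable_bounded[OF _ R'])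
qed

lemma int_g [simp]: "(\<integral>y. g k y \<partial>\<nu>) = 1"
proof -
  obtain R where "\<And>x y. h k x y \<le> R" using h_bounded by blast
  then have "\<bar>h k x y\<bar> \<le> R" for x y using h_pos[of k x y] by (simp add: abs_of_pos)
  then have "(\<integral>y. g k y \<partial>\<nu>) = (\<integral>x. (\<integral>y. h k x y \<partial>\<nu>) \<partial>\<mu>)"
    by (intro integral_swap) auto
  then show ?thesis by (simp add: X.prob_space)
qed

lemma log_g: "\<phi> (Suc k) y - \<phi> k y = - \<epsilon> * ln (g k y)"
  using eps by (simp add: g_eq)

text \<open>
  The quotient of successive scaling factors on the first space is the density of the first marginal
  after the second one has been corrected, so that it has integral \<open>1\<close>. Its logarithm has integral at
  most \<open>0\<close> by \<open>ln t \<le> t - 1\<close>.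
\<close>

lemma \<psi>_decreases: "(\<integral>x. \<psi> (Suc k) x \<partial>\<mu>) \<le> (\<integral>x. \<psi> k x \<partial>\<mu>)"
proof -
  define q where "q x y = exp ((\<phi> (Suc k) y - \<psi> k x - b x y) / \<epsilon>)" for x y
  define R where "R = exp ((2 * real (Suc k) + 2 * real k + 2) * B / \<epsilon>)"
  have q[measurable]: "(\<lambda>(x, y). q x y) \<in> borel_measurable (borel \<Otimes>\<^sub>M borel)"
    unfolding q_def by measurable
  have qR: "\<bar>q x y\<bar> \<le> R" for x y
    using exponent_bounded[of "Suc k" y k x] eps
    unfolding q_def R_def by (auto simp: abs_le_iff intro!: divide_right_mono)
  have fx: "(\<integral>y. q x y \<partial>\<nu>) = exp ((\<psi> (Suc k) x - \<psi> k x) / \<epsilon>)" for x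
  proof -
    have "(\<integral>y. q x y \<partial>\<nu>) = (\<integral>y. exp (- \<psi> k x / \<epsilon>) * exp ((\<phi> (Suc k) y - b x y) / \<epsilon>) \<partial>\<nu>)"
      unfolding q_def exp_split(2) ..
    also have "\<dots> = exp (- \<psi> k x / \<epsilon>) * exp (\<psi> (Suc k) x / \<epsilon>)"
      unfolding sinkhorn_dual_def[of \<mu> \<nu> b \<epsilon> "Suc k"]
      by (simp add: Y.exp_log_int_exp[OF eps _ \<phi>_minus_b])
    also have "\<dots> = exp ((\<psi> (Suc k) x - \<psi> k x) / \<epsilon>)"
      by (simp add: diff_divide_distrib flip: exp_add)
    finally show ?thesis .
  qed
  have "(\<integral>x. q x y \<partial>\<mu>) = 1" for y
  proof -
    have "q x y = exp ((- \<psi> k x - b x y - log_int_exp \<mu> \<epsilon> (\<lambda>x. - \<psi> k x - b x y)) / \<epsilon>)" for x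
      unfolding q_def \<phi>_Suc by (simp add: algebra_simps)
    then show ?thesis
      using X.log_int_exp_normalised[where f="\<lambda>x. - \<psi> k x - b x y", OF eps _ \<psi>_minus_b] by simp
  qed
  then have q1: "(\<integral>x. (\<integral>y. q x y \<partial>\<nu>) \<partial>\<mu>) = 1"
    using integral_swap[OF q qR] by (simp add: Y.prob_space)
  have "integrable \<mu> (\<lambda>x. \<integral>y. q x y \<partial>\<nu>)"
    using q1 not_integrable_integral_eq by fastforce
  then have i: "integrable \<mu> (\<lambda>x. exp ((\<psi> (Suc k) x - \<psi> k x) / \<epsilon>))" by (simp add: fx)
  have "(\<integral>x. (\<psi> (Suc k) x - \<psi> k x) / \<epsilon> \<partial>\<mu>) \<le> (\<integral>x. exp ((\<psi> (Suc k) x - \<psi> k x) / \<epsilon>) - 1 \<partial>\<mu>)"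
  proof (rule integral_mono)
    show "(\<psi> (Suc k) x - \<psi> k x) / \<epsilon> \<le> exp ((\<psi> (Suc k) x - \<psi> k x) / \<epsilon>) - 1" for x
      using exp_ge_add_one_self[of "(\<psi> (Suc k) x - \<psi> k x) / \<epsilon>"] by linarith
  qed (use i in simp_all)
  also have "\<dots> = 0"
    using q1 i by (simp add: fx X.prob_space)
  finally show ?thesis using eps by (simp add: divide_le_0_iff)
qed

text \<open>
  Since \<open>ln h \<le> h - 1\<close> and \<open>h\<close> has total mass \<open>1\<close>, the exponent \<open>(\<phi> - \<psi> - b) / \<epsilon>\<close> has integral at
  most \<open>0\<close>.
\<close>

lemma V_le: "V k \<le> B"
proof -
  have bi: "integrable \<nu> (b x)" for x
    by (rule Y.integrable_bounded[where R=B]) (auto simp: b_nonneg b_le)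
  have "(\<integral>y. \<phi> k y \<partial>\<nu>) - B \<le> \<psi> k x" for x
  proof -
    have "(\<integral>y. (\<phi> k y - \<psi> k x - b x y) / \<epsilon> \<partial>\<nu>) \<le> (\<integral>y. h k x y - 1 \<partial>\<nu>)"
    proof (rule integral_mono)
      show "(\<phi> k y - \<psi> k x - b x y) / \<epsilon> \<le> h k x y - 1" for y
        using exp_ge_add_one_self[of "(\<phi> k y - \<psi> k x - b x y) / \<epsilon>"]
        unfolding sinkhorn_density_def by linarith
    qed (use bi in simp_all)
    also have "\<dots> = 0" by (simp add: Y.prob_space)
    finally have "(\<integral>y. \<phi> k y \<partial>\<nu>) - \<psi> k x - (\<integral>y. b x y \<partial>\<nu>) \<le> 0"
      using eps bi by (simp add: Y.prob_space divide_le_0_iff)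
    moreover have "(\<integral>y. b x y \<partial>\<nu>) \<le> B"
      by (rule Y.integral_le_const[OF bi]) (simp add: b_le)
    ultimately show ?thesis by simp
  qed
  then have "(\<integral>y. \<phi> k y \<partial>\<nu>) - B \<le> (\<integral>x. \<psi> k x \<partial>\<mu>)"
    by (intro X.integral_ge_const) simp_all
  then show ?thesis by simp
qed

text \<open>
  By \<open>\<psi>_decreases\<close> these increments bound from below those of the dual value, which is at most \<open>B\<close>.
\<close>

lemma increments_small:
  assumes "0 < \<tau>"
  shows "\<exists>k. (\<integral>y. \<phi> (Suc k) y - \<phi> k y \<partial>\<nu>) < \<tau>"
proof (rule ccontr)
  assume "\<not> ?thesis"
  then have *: "\<tau> \<le> (\<integral>y. \<phi> (Suc k) y \<partial>\<nu>) - (\<integral>y. \<phi> k y \<partial>\<nu>)" for k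
    by (simp add: not_less)
  have "V 0 + real k * \<tau> \<le> V k" for k
  proof (induction k)
    case (Suc k)
    then show ?case using *[of k] \<psi>_decreases[of k] by (simp add: algebra_simps)
  qed simp
  then have "real k * \<tau> \<le> B - V 0" for k using V_le[of k] by (smt (verit))
  moreover obtain k where "(B - V 0) / \<tau> < real k" using reals_Archimedean2 by blast
  ultimately show False using assms by (simp add: pos_divide_less_eq) (meson not_le)
qed

end

text \<open>
  A pointwise, one-sided form of Pinsker's inequality. With \<open>s = sqrt t\<close> one has \<open>(1 - s)\<^sup>2 \<le> t - 1 - ln t\<close> from
  \<open>ln s \<le> s - 1\<close>, and the deficit is at most \<open>2 \<bar>1 - s\<bar>\<close>.
\<close>

lemma deficit_le_entropy:
  fixes t \<tau> :: real
  assumes "0 < t" "0 < \<tau>"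
  shows "max 0 (1 - t) \<le> \<tau> + (t - 1 - ln t) / \<tau>"
proof -
  define s where "s = sqrt t"
  have s: "0 < s" "t = s\<^sup>2" using assms by (auto simp: s_def)
  have "ln t = 2 * ln s" using s by (simp add: ln_realpow)
  then have "(1 - s)\<^sup>2 \<le> t - 1 - ln t"
    using ln_le_minus_one[OF s(1)] s by (simp add: power2_eq_square algebra_simps)
  then have 1: "(1 - s)\<^sup>2 / \<tau> \<le> (t - 1 - ln t) / \<tau>"
    using assms by (intro divide_right_mono) auto
  have "max 0 (1 - t) \<le> 2 * \<bar>1 - s\<bar>"
  proof (cases "s \<le> 1")
    case True
    then have "(1 - s) * (1 + s) \<le> (1 - s) * 2" by (intro mult_left_mono) auto
    moreover have "1 - t = (1 - s) * (1 + s)" using s by (simp add: power2_eq_square algebra_simps)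
    ultimately show ?thesis using True by simp
  next
    case False
    then have "1 \<le> t" using s by simp
    then show ?thesis by simp
  qed
  also have "\<dots> \<le> \<tau> + (1 - s)\<^sup>2 / \<tau>"
  proof -
    have "0 \<le> (\<tau> - \<bar>1 - s\<bar>)\<^sup>2" by simp
    then have "2 * \<bar>1 - s\<bar> * \<tau> \<le> \<tau> * \<tau> + (1 - s)\<^sup>2"
      by (simp add: power2_diff) (simp add: power2_eq_square algebra_simps)
    then have "2 * \<bar>1 - s\<bar> \<le> (\<tau> * \<tau> + (1 - s)\<^sup>2) / \<tau>"
      using assms by (simp add: pos_le_divide_eq)
    then show ?thesis using assms by (simp add: add_divide_distrib)
  qed
  finally show ?thesis using 1 by linarith
qed

context sinkhorn_iteration
begin

lemma defect_integrable [simp]: "integrable \<nu> (\<lambda>y. max 0 (1 - g k y))"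
  by (rule Y.integrable_bounded[where R=1]) (use g_pos[of k] in \<open>auto simp: abs_if max_def less_imp_le\<close>)

text \<open>
  Integrating \<open>deficit_le_entropy\<close> bounds the defect by the relative entropy, that is, by the increment
  of the iteration divided by \<open>\<epsilon>\<close>.
\<close>

lemma defect_small:
  assumes "0 < \<tau>"
  shows "\<exists>k. defect k \<le> \<tau>"
proof -
  define t where "t = \<tau> / 2"
  have t: "0 < t" using assms by (simp add: t_def)
  obtain k where k: "(\<integral>y. \<phi> (Suc k) y - \<phi> k y \<partial>\<nu>) < \<epsilon> * t * t"
    using increments_small[of "\<epsilon> * t * t"] eps t by auto
  have "defect k \<le> (\<integral>y. t + (g k y - 1 + (\<phi> (Suc k) y - \<phi> k y) / \<epsilon>) / t \<partial>\<nu>)"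
  proof (rule integral_mono)
    fix y
    have "(\<phi> (Suc k) y - \<phi> k y) / \<epsilon> = - ln (g k y)" using log_g[of k y] eps by simp
    then show "max 0 (1 - g k y) \<le> t + (g k y - 1 + (\<phi> (Suc k) y - \<phi> k y) / \<epsilon>) / t"
      using deficit_le_entropy[OF g_pos t, of k y] by (simp add: algebra_simps)
  qed simp_all
  also have "\<dots> = t + ((\<integral>y. \<phi> (Suc k) y - \<phi> k y \<partial>\<nu>) / \<epsilon>) / t"
    by (simp add: Y.prob_space)
  also have "\<dots> \<le> t + t"
    using k t eps by (simp add: pos_divide_le_eq mult_ac)
  finally show ?thesis by (auto simp: t_def)
qed


abbreviation "\<phi>' k \<equiv> c_transform b (\<psi> k)"

lemma h'_measurable [measurable]: "(\<lambda>(x, y). h' k x y) \<in> borel_measurable (borel \<Otimes>\<^sub>M borel)"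
  unfolding sub_density_def by measurable

lemma h'_nonneg: "0 \<le> h' k x y"
  unfolding sub_density_def using h_pos[of k x y] by (intro divide_nonneg_nonneg) auto

lemma h'_le: "h' k x y \<le> h k x y"
  unfolding sub_density_def using h_pos[of k x y]
  by (simp add: divide_le_eq mult_ge1_I)

lemma h'_bounded: "\<exists>R. \<forall>x y. \<bar>h' k x y\<bar> \<le> R"
  using h_bounded[of k] h'_le[of k] h'_nonneg[of k] by (simp add: abs_of_nonneg) (meson order_trans)

lemma h'_marginals:
  "(\<integral>y. h' k x y \<partial>\<nu>) \<le> 1" "(\<integral>x. h' k x y \<partial>\<mu>) = min 1 (g k y)"
proof -
  obtain R where R: "\<And>x y. \<bar>h' k x y\<bar> \<le> R" using h'_bounded by blast
  have "(\<integral>y. h' k x y \<partial>\<nu>) \<le> (\<integral>y. h k x y \<partial>\<nu>)"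
    by (intro integral_mono Y.integrable_bounded[OF _ R] h'_le) auto
  then show "(\<integral>y. h' k x y \<partial>\<nu>) \<le> 1" by simp
  show "(\<integral>x. h' k x y \<partial>\<mu>) = min 1 (g k y)"
    unfolding sub_density_def by (simp add: min_def max_def)
qed

lemma mass_h': "(\<integral>x. (\<integral>y. h' k x y \<partial>\<nu>) \<partial>\<mu>) = 1 - defect k"
proof -
  obtain R where R: "\<And>x y. \<bar>h' k x y\<bar> \<le> R" using h'_bounded by blast
  have "(\<integral>x. (\<integral>y. h' k x y \<partial>\<nu>) \<partial>\<mu>) = (\<integral>y. min 1 (g k y) \<partial>\<nu>)"
    using integral_swap[OF h'_measurable R] by (simp add: h'_marginals(2))
  also have "\<dots> = (\<integral>y. 1 - max 0 (1 - g k y) \<partial>\<nu>)"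
    by (intro Bochner_Integration.integral_cong) auto
  finally show ?thesis by simp
qed

text \<open>
  On the density \<open>h\<close> the cost is \<open>\<phi> - \<psi> - \<epsilon> ln h\<close>, and \<open>h ln h \<ge> h - 1\<close> has nonnegative
  integral. The integral of \<open>\<phi>\<close> is taken with respect to the inexact second marginal. As that
  marginal has mass \<open>1\<close>, a constant may be subtracted from \<open>\<phi>\<close>, so that the error involves the
  oscillation of \<open>\<phi>\<close> only.
\<close>

lemma cost_h'_le: "(\<integral>x. (\<integral>y. b x y * h' k x y \<partial>\<nu>) \<partial>\<mu>) \<le> V k + 2 * B * defect k"
proof -
  obtain R where R0: "\<And>x y. h k x y \<le> R" using h_bounded by blast
  then have R: "\<bar>h k x y\<bar> \<le> R" for x y using h_pos[of k x y] by (simp add: abs_of_pos)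
  have R_nonneg: "0 \<le> R" using R abs_ge_zero order_trans by blast
  define P where "P = 2 * real k * B"
  have bR: "\<bar>b x y * h' k x y\<bar> \<le> B * R" for x y
    unfolding abs_mult using b_nonneg b_le h'_nonneg B_nonneg order_trans[OF h'_le R0]
    by (intro mult_mono) (auto simp: abs_of_nonneg)
  have pR: "\<bar>\<phi> k y * h k x y\<bar> \<le> P * R" for x y
    unfolding abs_mult P_def using \<phi>_bounded[of k y] R[of x y] B_nonneg by (intro mult_mono) auto
  have pi: "integrable \<nu> (\<lambda>y. \<phi> k y * h k x y)" for x
    by (rule Y.integrable_bounded[OF _ pR]) measurable
  have ip: "integrable \<mu> (\<lambda>x. \<integral>y. \<phi> k y * h k x y \<partial>\<nu>)"
  proof (rule X.integrable_bounded[where R="P * R"])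
    show "\<bar>\<integral>y. \<phi> k y * h k x y \<partial>\<nu>\<bar> \<le> P * R" for x
    proof (rule order_trans[OF integral_abs_bound])
      show "(\<integral>y. \<bar>\<phi> k y * h k x y\<bar> \<partial>\<nu>) \<le> P * R"
        by (rule Y.integral_le_const) (use pi pR in auto)
    qed
  qed measurable
  have "(\<integral>y. b x y * h' k x y \<partial>\<nu>) \<le> (\<integral>y. \<phi> k y * h k x y \<partial>\<nu>) - \<psi> k x" for x
  proof -
    have "(\<integral>y. b x y * h' k x y \<partial>\<nu>) \<le> (\<integral>y. \<phi> k y * h k x y - \<psi> k x * h k x y - \<epsilon> * (h k x y - 1) \<partial>\<nu>)"
    proof (rule integral_mono)
      fix y
      have "1 - 1 / h k x y \<le> ln (h k x y)"
        using ln_le_minus_one[of "1 / h k x y"] h_pos[of k x y] by (simp add: ln_div)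
      then have "h k x y * (1 - 1 / h k x y) \<le> h k x y * ln (h k x y)"
        using h_pos[of k x y] by (intro mult_left_mono) auto
      then have "\<epsilon> * (h k x y - 1) \<le> \<epsilon> * (h k x y * ln (h k x y))"
        using eps h_pos[of k x y] by (intro mult_left_mono) (auto simp: right_diff_distrib)
      also have "\<dots> = h k x y * (\<phi> k y - \<psi> k x - b x y)"
        using eps by (simp add: sinkhorn_density_def)
      finally have "b x y * h k x y \<le> \<phi> k y * h k x y - \<psi> k x * h k x y - \<epsilon> * (h k x y - 1)"
        by (simp add: algebra_simps)
      moreover have "b x y * h' k x y \<le> b x y * h k x y"
        by (intro mult_left_mono h'_le b_nonneg)
      ultimately show "b x y * h' k x y \<le> \<phi> k y * h k x y - \<psi> k x * h k x y - \<epsilon> * (h k x y - 1)"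
        by (rule order_trans[rotated])
    qed (use pi in \<open>auto intro!: Y.integrable_bounded[OF _ bR]\<close>)
    also have "\<dots> = (\<integral>y. \<phi> k y * h k x y \<partial>\<nu>) - \<psi> k x"
      using pi by simp
    finally show ?thesis .
  qed
  then have "(\<integral>x. (\<integral>y. b x y * h' k x y \<partial>\<nu>) \<partial>\<mu>) \<le> (\<integral>x. (\<integral>y. \<phi> k y * h k x y \<partial>\<nu>) - \<psi> k x \<partial>\<mu>)"
  proof (intro integral_mono)
    show "integrable \<mu> (\<lambda>x. \<integral>y. b x y * h' k x y \<partial>\<nu>)"
    proof (rule X.integrable_bounded[where R="B * R"])
      show "\<bar>\<integral>y. b x y * h' k x y \<partial>\<nu>\<bar> \<le> B * R" for x
      proof (rule order_trans[OF integral_abs_bound])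
        show "(\<integral>y. \<bar>b x y * h' k x y\<bar> \<partial>\<nu>) \<le> B * R"
          by (rule Y.integral_le_const) (use bR in \<open>auto intro!: Y.integrable_bounded[where R="B * R"]\<close>)
      qed
    qed measurable
  qed (use ip in auto)
  also have "\<dots> = (\<integral>x. (\<integral>y. \<phi> k y * h k x y \<partial>\<nu>) \<partial>\<mu>) - (\<integral>x. \<psi> k x \<partial>\<mu>)"
    using ip by simp
  also have "(\<integral>x. (\<integral>y. \<phi> k y * h k x y \<partial>\<nu>) \<partial>\<mu>) = (\<integral>y. \<phi> k y * g k y \<partial>\<nu>)"
    by (subst integral_swap[symmetric, OF _ pR]) auto
  also have "(\<integral>y. \<phi> k y * g k y \<partial>\<nu>) \<le> (\<integral>y. \<phi> k y \<partial>\<nu>) + 2 * B * defect k"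
  proof -
    obtain G where G: "\<And>y. \<bar>g k y\<bar> \<le> G" using g_bounded by blast
    \<comment> \<open>an arbitrary reference value of the potential\<close>
    define p where "p = \<phi> k undefined"
    have pg: "integrable \<nu> (\<lambda>y. \<phi> k y * g k y)"
    proof (rule Y.integrable_bounded[where R="P * G"])
      show "\<bar>\<phi> k y * g k y\<bar> \<le> P * G" for y
        unfolding abs_mult P_def using \<phi>_bounded[of k y] G[of y] B_nonneg by (intro mult_mono) auto
    qed measurable
    have "(\<integral>y. \<phi> k y * g k y \<partial>\<nu>) \<le> (\<integral>y. \<phi> k y + p * (g k y - 1) + B * (g k y - 1 + 2 * max 0 (1 - g k y)) \<partial>\<nu>)"
    proof (rule integral_mono[OF pg])
      fix y
      have "(\<phi> k y - p) * (g k y - 1) \<le> \<bar>\<phi> k y - p\<bar> * \<bar>g k y - 1\<bar>"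
        by (metis abs_ge_self abs_mult)
      also have "\<dots> \<le> B * \<bar>g k y - 1\<bar>"
        using \<phi>_osc[of k y undefined] \<phi>_osc[of k undefined y]
        by (intro mult_right_mono) (auto simp: p_def)
      also have "\<bar>g k y - 1\<bar> = g k y - 1 + 2 * max 0 (1 - g k y)"
        by (simp add: abs_if max_def)
      finally show "\<phi> k y * g k y \<le> \<phi> k y + p * (g k y - 1) + B * (g k y - 1 + 2 * max 0 (1 - g k y))"
        by (simp add: algebra_simps)
    qed simp
    then show ?thesis by simp
  qed
  finally show ?thesis by simp
qed

lemma \<phi>'_le: "\<phi>' k y \<le> \<psi> k x + b x y"
proof (rule field_le_epsilon)
  fix e :: real assume e: "0 < e"
  obtain i where i: "dist x (dense_seq i) < e / (2 * B + 1)"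
    using dense_seq_near[of "e / (2 * B + 1)" x] e B_nonneg by auto
  have lb: "\<phi>' k y \<le> \<psi> k (dense_seq i) + b (dense_seq i) y"
    unfolding c_transform_def
  proof (rule cINF_lower)
    have "- ((2 * real k + 1) * B) \<le> \<psi> k x + b x y" for x
      using \<psi>_bounded[of k x] b_nonneg[of x y] by linarith
    then show "bdd_below (range (\<lambda>i. \<psi> k (dense_seq i) + b (dense_seq i) y))"
      by (intro bdd_belowI2[where m="- ((2 * real k + 1) * B)"]) auto
  qed simp
  have "2 * B * dist x (dense_seq i) \<le> (2 * B + 1) * dist x (dense_seq i)"
    by (intro mult_right_mono) auto
  also have "\<dots> \<le> e" using i B_nonneg by (simp add: field_simps)
  finally show "\<phi>' k y \<le> \<psi> k x + b x y + e"
    using lb \<psi>_lip[of k x "dense_seq i"] b_lip1[of x y "dense_seq i"] by linarith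
qed

lemma \<phi>'_greatest:
  assumes "\<And>x. a \<le> \<psi> k x + b x y"
  shows "a \<le> \<phi>' k y"
  unfolding c_transform_def using assms by (intro cINF_greatest) auto

lemma \<phi>'_lip: "\<bar>\<phi>' k y - \<phi>' k y'\<bar> \<le> B * dist y y'"
proof -
  have "\<phi>' k y - B * dist y y' \<le> \<phi>' k y'" for y y'
  proof (rule \<phi>'_greatest)
    fix x show "\<phi>' k y - B * dist y y' \<le> \<psi> k x + b x y'"
      using \<phi>'_le[of k y x] b_lip2[of x y y'] by linarith
  qed
  from this[of y y'] this[of y' y] show ?thesis by (auto simp: dist_commute abs_le_iff)
qed

lemma \<phi>'_bounded: "\<bar>\<phi>' k y\<bar> \<le> (2 * real k + 2) * B"
proof -
  have "- ((2 * real k + 2) * B) \<le> \<phi>' k y"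
  proof (rule \<phi>'_greatest)
    fix x show "- ((2 * real k + 2) * B) \<le> \<psi> k x + b x y"
      using \<psi>_bounded[of k x] b_nonneg[of x y] B_nonneg by (simp add: algebra_simps)
  qed
  moreover have "\<phi>' k y \<le> (2 * real k + 2) * B"
    using \<phi>'_le[of k y undefined] \<psi>_bounded[of k undefined] b_le[of undefined y]
    by (simp add: algebra_simps)
  ultimately show ?thesis by (simp add: abs_le_iff)
qed

lemma \<phi>'_measurable [measurable]: "\<phi>' k \<in> borel_measurable borel"
proof (rule borel_measurable_continuous_onI)
  show "continuous_on UNIV (\<phi>' k)"
    by (rule lipschitz_on_continuous_on[where L=B])
      (auto intro!: lipschitz_onI simp: dist_real_def \<phi>'_lip B_nonneg)
qed

text \<open>
  The normalisation says that \<open>\<psi> k x\<close> is the smoothed maximum of \<open>\<phi> k - b x\<close>. Hence it almost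
  dominates every value of that function which is nearly attained on a set of definite mass.
\<close>

lemma \<phi>_le_\<phi>':
  assumes "A \<in> sets borel" "0 < \<kappa>" "\<kappa> \<le> Y.prob A"
    and "\<And>y' x. y' \<in> A \<Longrightarrow> \<phi> k y - b x y \<le> \<phi> k y' - b x y' + D"
  shows "\<phi> k y \<le> \<phi>' k y + (D + \<epsilon> * ln (1 / \<kappa>))"
proof -
  have "\<phi> k y - (D + \<epsilon> * ln (1 / \<kappa>)) \<le> \<phi>' k y"
  proof (rule \<phi>'_greatest)
    fix x
    have "\<phi> k y - b x y \<le> \<psi> k x + D + \<epsilon> * ln (1 / \<kappa>)"
      unfolding sinkhorn_dual_def
      by (rule Y.log_int_exp_ge_on[OF eps _ \<phi>_minus_b]) (use assms sets_\<nu> in auto)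
    then show "\<phi> k y - (D + \<epsilon> * ln (1 / \<kappa>)) \<le> \<psi> k x + b x y" by simp
  qed
  then show ?thesis by simp
qed

text \<open>
  On the set \<open>S\<close> the preceding lemma applies with a small neighbourhood of \<open>y\<close>, outside \<open>S\<close> it applies
  with the whole space, and the oscillation bounds enter instead of the Lipschitz bounds. The estimate is
  uniform in \<open>k\<close>, so that \<open>\<epsilon>\<close> can be chosen before the number of iterations.
\<close>

lemma dual_gap:
  assumes S: "S \<in> sets borel" and \<kappa>: "0 < \<kappa>"  and r: "0 \<le> r"
    and *: "\<And>y. y \<in> S \<Longrightarrow> \<exists>A\<in>sets borel. \<kappa> \<le> Y.prob A \<and> (\<forall>y'\<in>A. dist y y' \<le> r)"
    and 1: "\<kappa> \<le> 1"
  shows "V k \<le> (\<integral>y. \<phi>' k y \<partial>\<nu>) - (\<integral>x. \<psi> k x \<partial>\<mu>) + 2 * B * r + \<epsilon> * ln (1 / \<kappa>) + 2 * B * (1 - Y.prob S)"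
proof -
  have nn: "0 \<le> \<epsilon> * ln (1 / \<kappa>)" using eps \<kappa> 1 by simp
  have "\<phi> k y \<le> \<phi>' k y + (2 * B * r + \<epsilon> * ln (1 / \<kappa>)) + 2 * B * indicator (- S) y" for y
  proof (cases "y \<in> S")
    case True
    then obtain A where A: "A \<in> sets borel" "\<kappa> \<le> Y.prob A" "\<And>y'. y' \<in> A \<Longrightarrow> dist y y' \<le> r"
      using * by blast
    have "\<phi> k y - b x y \<le> \<phi> k y' - b x y' + 2 * B * r" if "y' \<in> A" for x y'
      using \<phi>_lip[of k y y'] b_lip2[of x y y'] mult_left_mono[OF A(3)[OF that] B_nonneg]
      by linarith
    from \<phi>_le_\<phi>'[OF A(1) \<kappa> A(2) this] True show ?thesis by simp
  next
    case False
    have "\<phi> k y - b x y \<le> \<phi> k y' - b x y' + 2 * B" for x y'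
      using \<phi>_osc[of k y y'] b_nonneg[of x y] b_le[of x y'] by simp
    then have "\<phi> k y \<le> \<phi>' k y + (2 * B + \<epsilon> * ln (1 / 1))"
      by (intro \<phi>_le_\<phi>'[where A=UNIV]) auto
    moreover have "0 \<le> B * r" using r B_nonneg by simp
    ultimately show ?thesis using False nn by simp
  qed
  moreover have i: "integrable \<nu> (\<phi>' k)" by (rule Y.integrable_bounded[OF _ \<phi>'_bounded]) measurable
  moreover have i2: "integrable \<nu> (indicat_real (- S))"
    by (rule Y.integrable_bounded[where R=1]) (use S in auto)
  ultimately have "(\<integral>y. \<phi> k y \<partial>\<nu>)
      \<le> (\<integral>y. \<phi>' k y + (2 * B * r + \<epsilon> * ln (1 / \<kappa>)) + 2 * B * indicator (- S) y \<partial>\<nu>)"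
    by (intro integral_mono) auto
  also have "\<dots> = (\<integral>y. \<phi>' k y \<partial>\<nu>) + (2 * B * r + \<epsilon> * ln (1 / \<kappa>)) + 2 * B * (1 - Y.prob S)"
    using i i2 S Y.prob_compl[of S] by (simp add: sets_\<nu> Compl_eq_Diff_UNIV)
  finally show ?thesis by simp
qed

end

text \<open>
  Almost every point lies in one of countably many balls of positive measure; finitely many of them
  carry almost all mass, and the smallest of their measures is \<open>\<kappa>\<close>. The value \<open>1\<close> is included in the
  minimum to keep it well defined when the finite family is empty.
\<close>

lemma small_cells_cover:
  fixes r \<tau> :: real and M :: "'a::{metric_space, second_countable_topology} measure"
  assumes p: "prob_space M" and M: "sets M = sets borel"
    and r: "0 < r" and \<tau>: "0 < \<tau>"
  shows "\<exists>S\<in>sets borel. \<exists>\<kappa>. 0 < \<kappa> \<and> \<kappa> \<le> 1 \<and> 1 - measure M S \<le> \<tau> \<and>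
    (\<forall>y\<in>S. \<exists>A\<in>sets borel. \<kappa> \<le> measure M A \<and> (\<forall>y'\<in>A. dist y y' \<le> r))"
proof -
  interpret prob_space M by (rule p)
  define U :: "nat \<Rightarrow> 'a set" where "U i = ball (dense_seq i) (r / 2)" for i
  have U: "U i \<in> events" for i by (simp add: M U_def)
  define J where "J N = {i. i < N \<and> 0 < prob (U i)}" for N :: nat
  have S: "(\<Union>i\<in>J N. U i) \<in> events" for N using U by auto
  have "(\<lambda>N. prob (\<Union>i\<in>J N. U i)) \<longlonglongrightarrow> prob (\<Union>N. \<Union>i\<in>J N. U i)"
    by (rule finite_Lim_measure_incseq) (use S in \<open>auto simp: incseq_def J_def intro: less_le_trans\<close>)
  also have "prob (\<Union>N. \<Union>i\<in>J N. U i) = 1"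
  proof -
    have "AE y in M. \<forall>i. prob (U i) = 0 \<longrightarrow> y \<notin> U i"
      unfolding AE_all_countable
    proof
      fix i
      show "AE y in M. prob (U i) = 0 \<longrightarrow> y \<notin> U i"
        using AE_iff_null_sets[OF U, of i] by (cases "prob (U i) = 0") (auto simp: emeasure_eq_measure null_sets_def U)
    qed
    then have "AE y in M. y \<in> (\<Union>N. \<Union>i\<in>J N. U i)"
    proof (rule AE_mp, intro AE_I2 impI)
      fix y assume *: "\<forall>i. prob (U i) = 0 \<longrightarrow> y \<notin> U i"
      obtain i where "dist y (dense_seq i) < r / 2" using dense_seq_near[of "r / 2" y] r by auto
      then have i: "y \<in> U i" by (simp add: U_def dist_commute)
      then have "i \<in> J (Suc i)" using * by (auto simp: J_def zero_less_measure_iff)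
      with i show "y \<in> (\<Union>N. \<Union>i\<in>J N. U i)" by blast
    qed
    then show ?thesis using S by (subst prob_eq_1) auto
  qed
  finally have "\<exists>N. 1 - \<tau> < prob (\<Union>i\<in>J N. U i)"
    using \<tau> order_tendstoD(1)[of _ 1 sequentially "1 - \<tau>"] by (fastforce dest: eventually_happens)
  then obtain N where "1 - \<tau> < prob (\<Union>i\<in>J N. U i)" by blast
  then have N: "1 - prob (\<Union>i\<in>J N. U i) \<le> \<tau>" by linarith
  define \<kappa> where "\<kappa> = Min (insert 1 ((\<lambda>i. prob (U i)) ` J N))"
  have fin: "finite (insert 1 ((\<lambda>i. prob (U i)) ` J N))" by (simp add: J_def)
  have "0 < \<kappa>" unfolding \<kappa>_def using fin by (subst Min_gr_iff) (auto simp: J_def)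
  moreover have "\<kappa> \<le> 1" unfolding \<kappa>_def by (rule Min_le[OF fin]) simp
  moreover have "\<exists>A\<in>sets borel. \<kappa> \<le> prob A \<and> (\<forall>y'\<in>A. dist y y' \<le> r)" if y: "y \<in> (\<Union>i\<in>J N. U i)" for y
  proof -
    obtain i where i: "i \<in> J N" "y \<in> U i" using y by blast
    have "\<kappa> \<le> prob (U i)" unfolding \<kappa>_def by (rule Min_le[OF fin]) (use i in simp)
    moreover have "dist y y' \<le> r" if "y' \<in> U i" for y'
      using dist_triangle3[of y y' "dense_seq i"] that i by (simp add: U_def)
    ultimately show ?thesis using U M by blast
  qed
  ultimately show ?thesis using N S[of N] M by blast
qed

text \<open>
  The order of the choices is: the scale \<open>e\<close> with its cells and \<open>\<kappa>\<close>, then \<open>\<epsilon> = 1 / (j + 1)\<close> with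
  \<open>\<epsilon> * ln (1 / \<kappa>) \<le> e\<close>, then the number \<open>k\<close> of iterations.
\<close>

lemma (in lipschitz_cost) near_optimal:
  assumes \<delta>: "0 < \<delta>"
  shows "\<exists>j k. (\<integral>x. (\<integral>y. sub_density \<mu> \<nu> b (1 / real (Suc j)) k x y \<partial>\<nu>) \<partial>\<mu>) \<ge> 1 - \<delta> \<and>
    (\<integral>x. (\<integral>y. b x y * sub_density \<mu> \<nu> b (1 / real (Suc j)) k x y \<partial>\<nu>) \<partial>\<mu>)
      \<le> (\<integral>y. c_transform b (sinkhorn_dual \<mu> \<nu> b (1 / real (Suc j)) k) y \<partial>\<nu>)
        - (\<integral>x. sinkhorn_dual \<mu> \<nu> b (1 / real (Suc j)) k x \<partial>\<mu>) + \<delta>"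
proof -
  define e where "e = \<delta> / (8 * B + 4)"
  have e: "0 < e" "2 * B * e \<le> \<delta> / 4" "e \<le> \<delta> / 4"
    using \<delta> B_nonneg by (auto simp: e_def field_simps)
  obtain S \<kappa> where S: "S \<in> sets borel" "0 < \<kappa>" "\<kappa> \<le> 1" "1 - Y.prob S \<le> e"
    "\<And>y. y \<in> S \<Longrightarrow> \<exists>A\<in>sets borel. \<kappa> \<le> Y.prob A \<and> (\<forall>y'\<in>A. dist y y' \<le> e)"
    using small_cells_cover[OF prob_\<nu> sets_\<nu> e(1) e(1)] by blast
  obtain j :: nat where j: "ln (1 / \<kappa>) / e \<le> real j" using real_arch_simple by blast
  define \<epsilon> where "\<epsilon> = 1 / real (Suc j)"
  have "ln (1 / \<kappa>) \<le> real (Suc j) * e"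
    using j e(1) by (simp add: pos_divide_le_eq algebra_simps)
  then have eps0: "0 < \<epsilon>" "\<epsilon> * ln (1 / \<kappa>) \<le> e"
    by (simp_all add: \<epsilon>_def pos_divide_le_eq mult.commute)
  interpret sinkhorn_iteration \<mu> \<nu> b B \<epsilon> by unfold_locales (rule eps0)
  obtain k where k: "defect k \<le> e" using defect_small[OF e(1)] by blast
  have gap: "V k \<le> (\<integral>y. \<phi>' k y \<partial>\<nu>) - (\<integral>x. \<psi> k x \<partial>\<mu>) + 2 * B * e + \<epsilon> * ln (1 / \<kappa>)
      + 2 * B * (1 - Y.prob S)"
    by (rule dual_gap[OF S(1,2) less_imp_le[OF e(1)] S(5) S(3)])
  have "2 * B * (1 - Y.prob S) \<le> 2 * B * e" "2 * B * defect k \<le> 2 * B * e"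
    using S(4) k B_nonneg by (simp_all add: mult_left_mono)
  then have "(\<integral>x. (\<integral>y. b x y * h' k x y \<partial>\<nu>) \<partial>\<mu>) \<le> (\<integral>y. \<phi>' k y \<partial>\<nu>) - (\<integral>x. \<psi> k x \<partial>\<mu>) + \<delta>"
    using cost_h'_le[of k] gap e eps0 by linarith
  moreover have "(\<integral>x. (\<integral>y. h' k x y \<partial>\<nu>) \<partial>\<mu>) \<ge> 1 - \<delta>"
    using mass_h'[of k] k e(3) \<delta> by linarith
  ultimately show ?thesis unfolding \<epsilon>_def by blast
qed

section \<open>Completing a sub-coupling\<close>

text \<open>
  The sub-coupling scaled by \<open>1 - \<eta>\<close>, plus the normalised product of the marginals that are then
  missing. Without scaling, the mass by which the product is divided could be arbitrarily small compared
  with the cost; the scaling keeps it above \<open>\<eta>\<close>.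
\<close>

definition completion ::
  "'x measure \<Rightarrow> 'y measure \<Rightarrow> real \<Rightarrow> ('x \<Rightarrow> 'y \<Rightarrow> real) \<Rightarrow> 'x \<Rightarrow> 'y \<Rightarrow> real" where
  "completion \<mu> \<nu> \<eta> h x y = (1 - \<eta>) * h x y +
     (1 - (1 - \<eta>) * (\<integral>y. h x y \<partial>\<nu>)) * (1 - (1 - \<eta>) * (\<integral>x. h x y \<partial>\<mu>))
       / (1 - (1 - \<eta>) * (\<integral>x. (\<integral>y. h x y \<partial>\<nu>) \<partial>\<mu>))"

locale sub_coupling = pair_prob_space \<mu> \<nu> for \<mu> :: "'x measure" and \<nu> :: "'y measure" +
  fixes h :: "'x \<Rightarrow> 'y \<Rightarrow> real" and \<eta> :: real
  assumes h_measurable [measurable]: "(\<lambda>(x, y). h x y) \<in> borel_measurable (\<mu> \<Otimes>\<^sub>M \<nu>)"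
    and h_nonneg: "0 \<le> h x y" and h_bdd: "\<exists>R. \<forall>x y. h x y \<le> R"
    and marg1: "(\<integral>y. h x y \<partial>\<nu>) \<le> 1" and marg2: "(\<integral>x. h x y \<partial>\<mu>) \<le> 1"
    and \<eta>: "0 < \<eta>" "\<eta> \<le> 1"
begin

abbreviation "d1 x \<equiv> 1 - (\<integral>y. h x y \<partial>\<nu>)"
abbreviation "d2 y \<equiv> 1 - (\<integral>x. h x y \<partial>\<mu>)"
abbreviation "missing \<equiv> 1 - (\<integral>x. (\<integral>y. h x y \<partial>\<nu>) \<partial>\<mu>)"
abbreviation "H \<equiv> completion \<mu> \<nu> \<eta> h"

definition "R = (SOME R. \<forall>x y. h x y \<le> R)"

lemma h_le: "h x y \<le> R"
  using someI_ex[OF h_bdd] unfolding R_def by blast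

lemma h_abs: "\<bar>h x y\<bar> \<le> R"
  using h_nonneg h_le by (simp add: abs_of_nonneg)

lemma h_sections: "x \<in> space \<mu> \<Longrightarrow> integrable \<nu> (h x)" "y \<in> space \<nu> \<Longrightarrow> integrable \<mu> (\<lambda>x. h x y)"
  by (auto intro!: M1.integrable_bounded[OF _ h_abs] M2.integrable_bounded[OF _ h_abs])

lemma d1_bounds: "0 \<le> d1 x" "d1 x \<le> 1"
  using marg1[of x] by (simp_all add: h_nonneg)

lemma d2_bounds: "0 \<le> d2 y" "d2 y \<le> 1"
  using marg2[of y] by (simp_all add: h_nonneg)

lemma d_measurable [measurable]: "d1 \<in> borel_measurable \<mu>" "d2 \<in> borel_measurable \<nu>"
  by measurable

lemma d_integrable [simp]:
  "integrable \<mu> d1" "integrable \<nu> d2"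
  "integrable \<mu> (\<lambda>x. \<integral>y. h x y \<partial>\<nu>)" "integrable \<nu> (\<lambda>y. \<integral>x. h x y \<partial>\<mu>)"
proof -
  show 1: "integrable \<mu> d1" "integrable \<nu> d2"
    using d1_bounds d2_bounds
    by (auto intro!: M1.integrable_bounded[where R=1] M2.integrable_bounded[where R=1] simp: h_nonneg)
  show "integrable \<mu> (\<lambda>x. \<integral>y. h x y \<partial>\<nu>)" "integrable \<nu> (\<lambda>y. \<integral>x. h x y \<partial>\<mu>)"
    using Bochner_Integration.integrable_diff[OF M1.integrable_const[of 1] 1(1)]
      Bochner_Integration.integrable_diff[OF M2.integrable_const[of 1] 1(2)] by simp_all
qed

lemma int_d: "(\<integral>x. d1 x \<partial>\<mu>) = missing" "(\<integral>y. d2 y \<partial>\<nu>) = missing"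
proof -
  show "(\<integral>x. d1 x \<partial>\<mu>) = missing" by (simp add: M1.prob_space)
  have "(\<integral>y. (\<integral>x. h x y \<partial>\<mu>) \<partial>\<nu>) = (\<integral>x. (\<integral>y. h x y \<partial>\<nu>) \<partial>\<mu>)"
    by (rule Fubini_integral, rule integrable_bounded[where R=R]) (use h_abs in auto)
  then show "(\<integral>y. d2 y \<partial>\<nu>) = missing" by (simp add: M2.prob_space)
qed

lemma missing_nonneg: "0 \<le> missing"
proof -
  have "0 \<le> (\<integral>x. d1 x \<partial>\<mu>)" by (rule integral_nonneg_AE) (use d1_bounds in auto)
  then show ?thesis unfolding int_d(1) .
qed

definition "slack = 1 - (1 - \<eta>) * (\<integral>x. (\<integral>y. h x y \<partial>\<nu>) \<partial>\<mu>)"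

lemma slack_eq: "slack = \<eta> + (1 - \<eta>) * missing"
  by (simp add: slack_def algebra_simps)

lemma slack_ge: "\<eta> \<le> slack" "0 < slack"
proof -
  have "0 \<le> (1 - \<eta>) * missing" using \<eta> missing_nonneg by (intro mult_nonneg_nonneg) auto
  then show "\<eta> \<le> slack" "0 < slack" using \<eta> unfolding slack_eq by auto
qed

lemma H_eq: "H x y = (1 - \<eta>) * h x y + (\<eta> + (1 - \<eta>) * d1 x) * (\<eta> + (1 - \<eta>) * d2 y) / slack"
proof -
  have "1 - (1 - \<eta>) * t = \<eta> + (1 - \<eta>) * (1 - t)" for t :: real by (simp add: algebra_simps)
  then show ?thesis by (simp add: completion_def slack_def)
qed

lemma H_nonneg: "0 \<le> H x y"
  unfolding H_eq using \<eta> slack_ge h_nonneg d1_bounds d2_bounds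
  by (intro add_nonneg_nonneg mult_nonneg_nonneg divide_nonneg_pos) auto

lemma H_measurable [measurable]: "(\<lambda>(x, y). H x y) \<in> borel_measurable (\<mu> \<Otimes>\<^sub>M \<nu>)"
  unfolding H_eq by measurable

lemma H_bounded: "\<exists>R. \<forall>x y. \<bar>H x y\<bar> \<le> R"
proof (intro exI allI)
  fix x y
  have "(1 - \<eta>) * h x y \<le> 1 * R" using \<eta> h_nonneg h_le[of x y] by (intro mult_mono) auto
  moreover have "(\<eta> + (1 - \<eta>) * d1 x) * (\<eta> + (1 - \<eta>) * d2 y) / slack \<le> 1 * 1 / slack"
  proof -
    have "\<eta> + (1 - \<eta>) * t \<le> 1" if "t \<le> 1" for t
      using mult_left_mono[OF that, of "1 - \<eta>"] \<eta> by (simp add: algebra_simps)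
    then show ?thesis using \<eta> slack_ge d1_bounds[of x] d2_bounds[of y]
      by (intro divide_right_mono mult_mono add_nonneg_nonneg mult_nonneg_nonneg) auto
  qed
  ultimately show "\<bar>H x y\<bar> \<le> R + 1 / slack" using H_nonneg[of x y] unfolding H_eq by simp
qed

lemma mult_slack_cancel: "t * (\<eta> + (1 - \<eta>) * missing) / slack = t"
  using slack_ge(2) unfolding slack_eq[symmetric] by simp

lemma int_H: "x \<in> space \<mu> \<Longrightarrow> (\<integral>y. H x y \<partial>\<nu>) = 1" "y \<in> space \<nu> \<Longrightarrow> (\<integral>x. H x y \<partial>\<mu>) = 1"
proof -
  assume "x \<in> space \<mu>"
  then have "(\<integral>y. H x y \<partial>\<nu>) = (1 - \<eta>) * (\<integral>y. h x y \<partial>\<nu>)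
      + (\<eta> + (1 - \<eta>) * d1 x) * (\<eta> + (1 - \<eta>) * (\<integral>y. d2 y \<partial>\<nu>)) / slack"
    unfolding H_eq using h_sections(1)[of x] d_integrable(2) M2.prob_space by simp
  then show "(\<integral>y. H x y \<partial>\<nu>) = 1" unfolding int_d mult_slack_cancel by (simp add: algebra_simps)
next
  assume "y \<in> space \<nu>"
  then have "(\<integral>x. H x y \<partial>\<mu>) = (1 - \<eta>) * (\<integral>x. h x y \<partial>\<mu>)
      + (\<eta> + (1 - \<eta>) * d2 y) * (\<eta> + (1 - \<eta>) * (\<integral>x. d1 x \<partial>\<mu>)) / slack"
    unfolding H_eq using h_sections(2)[of y] d_integrable(1) M1.prob_space by simp
  then show "(\<integral>x. H x y \<partial>\<mu>) = 1" unfolding int_d mult_slack_cancel by (simp add: algebra_simps)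
qed

text \<open>
  Expanding the product of the missing marginals leaves \<open>\<eta>\<close> times the independent coupling and terms
  which contain at least one of the deficits \<open>d1\<close>, \<open>d2\<close>.
\<close>

lemma H_le: "H x y \<le> h x y + \<eta> + (1 + 1 / \<eta>) * (d1 x + d2 y)"
proof -
  have d: "0 \<le> d1 x" "d1 x \<le> 1" "0 \<le> d2 y" "d2 y \<le> 1"
    using d1_bounds[of x] d2_bounds[of y] by auto
  have "(\<eta> + (1 - \<eta>) * d1 x) * (\<eta> + (1 - \<eta>) * d2 y) / slack \<le> (\<eta> + d1 x) * (\<eta> + d2 y) / \<eta>"
    using d \<eta> slack_ge
    by (intro frac_le mult_mono add_left_mono mult_left_le_one_le add_nonneg_nonneg mult_nonneg_nonneg) auto
  also have "\<dots> = \<eta> + d1 x + d2 y + d1 x * d2 y / \<eta>"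
    using \<eta> by (simp add: field_simps)
  also have "\<dots> \<le> \<eta> + d1 x + d2 y + (d1 x + d2 y) / \<eta>"
    using d \<eta> mult_left_le[of "d2 y" "d1 x"] by (intro add_left_mono divide_right_mono) auto
  finally have 1: "(\<eta> + (1 - \<eta>) * d1 x) * (\<eta> + (1 - \<eta>) * d2 y) / slack
      \<le> \<eta> + d1 x + d2 y + (d1 x + d2 y) / \<eta>" .
  have 2: "(1 - \<eta>) * h x y \<le> h x y"
    using \<eta> h_nonneg[of x y] by (intro mult_left_le_one_le) auto
  have "(1 + 1 / \<eta>) * (d1 x + d2 y) = d1 x + d2 y + (d1 x + d2 y) / \<eta>"
    unfolding distrib_right by simp
  then show ?thesis using 1 2 unfolding H_eq by linarith
qed

text \<open>
  As the deficits lie between \<open>0\<close> and \<open>1\<close>, splitting the cost at the level \<open>K\<close> bounds its integral against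
  a deficit by \<open>K\<close> times the missing mass plus the tail of the cost.
\<close>

lemma completion_cost:
  fixes c :: "'x \<Rightarrow> 'y \<Rightarrow> ennreal" and K :: real
  assumes c [measurable]: "(\<lambda>(x, y). c x y) \<in> borel_measurable (\<mu> \<Otimes>\<^sub>M \<nu>)" and K: "0 \<le> K"
  shows "(\<integral>\<^sup>+(x, y). c x y * ennreal (H x y) \<partial>(\<mu> \<Otimes>\<^sub>M \<nu>))
    \<le> (\<integral>\<^sup>+(x, y). c x y * ennreal (h x y) \<partial>(\<mu> \<Otimes>\<^sub>M \<nu>))
      + ennreal \<eta> * (\<integral>\<^sup>+(x, y). c x y \<partial>(\<mu> \<Otimes>\<^sub>M \<nu>))
      + ennreal (1 + 1 / \<eta>) * (2 * (ennreal (K * missing)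
          + (\<integral>\<^sup>+(x, y). (if ennreal K < c x y then c x y else 0) \<partial>(\<mu> \<Otimes>\<^sub>M \<nu>))))"
proof -
  let ?P = "\<mu> \<Otimes>\<^sub>M \<nu>"
  let ?T = "\<lambda>x y. if ennreal K < c x y then c x y else 0"
  have cd: "c x y * ennreal d \<le> ennreal (K * d) + ?T x y" if "0 \<le> d" "d \<le> 1" for x y d
  proof (cases "ennreal K < c x y")
    case True
    have "c x y * ennreal d \<le> c x y * 1" using that by (intro mult_left_mono) auto
    then show ?thesis using True by (simp add: add_increasing)
  next
    case False
    then have "c x y * ennreal d \<le> ennreal K * ennreal d" by (intro mult_right_mono) auto
    then show ?thesis using False K that by (simp add: ennreal_mult)
  qed
  have *: "ennreal (a + \<eta> + (1 + 1 / \<eta>) * (p + q)) = ennreal a + ennreal \<eta> + ennreal (1 + 1 / \<eta>) * (ennreal p + ennreal q)"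
    if "0 \<le> a" "0 \<le> p" "0 \<le> q" for a p q
    using \<eta> that by (simp only: ennreal_plus ennreal_mult add_nonneg_nonneg mult_nonneg_nonneg
        less_imp_le zero_le_one divide_nonneg_pos)
  have "c x y * ennreal (H x y) \<le> c x y * ennreal (h x y) + ennreal \<eta> * c x y
      + ennreal (1 + 1 / \<eta>) * ((ennreal (K * d1 x) + ?T x y) + (ennreal (K * d2 y) + ?T x y))" for x y
  proof -
    have "ennreal (H x y) \<le> ennreal (h x y) + ennreal \<eta> + ennreal (1 + 1 / \<eta>) * (ennreal (d1 x) + ennreal (d2 y))"
    proof -
      have "ennreal (H x y) \<le> ennreal (h x y + \<eta> + (1 + 1 / \<eta>) * (d1 x + d2 y))"
        by (rule ennreal_leI[OF H_le])
      also have "\<dots> = ennreal (h x y) + ennreal \<eta> + ennreal (1 + 1 / \<eta>) * (ennreal (d1 x) + ennreal (d2 y))"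
        by (rule *[OF h_nonneg d1_bounds(1) d2_bounds(1)])
      finally show ?thesis .
    qed
    then have "c x y * ennreal (H x y)
        \<le> c x y * (ennreal (h x y) + ennreal \<eta> + ennreal (1 + 1 / \<eta>) * (ennreal (d1 x) + ennreal (d2 y)))"
      by (rule mult_left_mono) simp
    also have "\<dots> = c x y * ennreal (h x y) + ennreal \<eta> * c x y
        + ennreal (1 + 1 / \<eta>) * (c x y * ennreal (d1 x) + c x y * ennreal (d2 y))"
      by (simp add: distrib_left mult_ac)
    also have "\<dots> \<le> c x y * ennreal (h x y) + ennreal \<eta> * c x y
      + ennreal (1 + 1 / \<eta>) * ((ennreal (K * d1 x) + ?T x y) + (ennreal (K * d2 y) + ?T x y))"
      by (intro add_left_mono mult_left_mono add_mono cd d1_bounds d2_bounds) simp_all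
    finally show ?thesis .
  qed
  then have "(\<integral>\<^sup>+(x, y). c x y * ennreal (H x y) \<partial>?P)
    \<le> (\<integral>\<^sup>+(x, y). c x y * ennreal (h x y) + ennreal \<eta> * c x y
      + ennreal (1 + 1 / \<eta>) * ((ennreal (K * d1 x) + ?T x y) + (ennreal (K * d2 y) + ?T x y)) \<partial>?P)"
    by (intro nn_integral_mono) auto
  also have "\<dots> = (\<integral>\<^sup>+(x, y). c x y * ennreal (h x y) \<partial>?P) + ennreal \<eta> * (\<integral>\<^sup>+(x, y). c x y \<partial>?P)
      + ennreal (1 + 1 / \<eta>) * (((\<integral>\<^sup>+(x, y). ennreal (K * d1 x) \<partial>?P) + (\<integral>\<^sup>+(x, y). ?T x y \<partial>?P))
        + ((\<integral>\<^sup>+(x, y). ennreal (K * d2 y) \<partial>?P) + (\<integral>\<^sup>+(x, y). ?T x y \<partial>?P)))"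
    by (simp add: split_beta' nn_integral_add nn_integral_cmult)
  also have "(\<integral>\<^sup>+(x, y). ennreal (K * d1 x) \<partial>?P) = ennreal (K * missing)"
  proof -
    have "(\<integral>\<^sup>+(x, y). ennreal (K * d1 x) \<partial>?P) = (\<integral>\<^sup>+x. ennreal (K * d1 x) \<partial>\<mu>)"
      by (subst M2.nn_integral_fst[symmetric]) (simp_all add: M2.emeasure_space_1)
    also have "\<dots> = ennreal (\<integral>x. K * d1 x \<partial>\<mu>)"
      using K d1_bounds by (intro nn_integral_eq_integral integrable_mult_right d_integrable) simp
    also have "(\<integral>x. K * d1 x \<partial>\<mu>) = K * missing"
      using int_d(1) by simp
    finally show ?thesis .
  qed
  also have "(\<integral>\<^sup>+(x, y). ennreal (K * d2 y) \<partial>?P) = ennreal (K * missing)"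
  proof -
    have "(\<integral>\<^sup>+(x, y). ennreal (K * d2 y) \<partial>?P) = (\<integral>\<^sup>+y. ennreal (K * d2 y) \<partial>\<nu>)"
      by (subst nn_integral_snd[symmetric]) (simp_all add: M1.emeasure_space_1)
    also have "\<dots> = ennreal (\<integral>y. K * d2 y \<partial>\<nu>)"
      using K d2_bounds by (intro nn_integral_eq_integral integrable_mult_right d_integrable) simp
    also have "(\<integral>y. K * d2 y \<partial>\<nu>) = K * missing"
      using int_d(2) by simp
    finally show ?thesis .
  qed
  finally show ?thesis by (simp add: mult_2 add_ac)
qed

end

section \<open>Duality for a single marginal pair\<close>

definition cost_minorant ::
  "('x::polish_space \<Rightarrow> 'y::polish_space \<Rightarrow> ennreal) \<Rightarrow> nat \<Rightarrow> 'x \<Rightarrow> 'y \<Rightarrow> real" where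
  "cost_minorant c n x y = lip_minorant (\<lambda>(x, y). c x y) n (x, y)"

definition dual_left ::
  "'x::polish_space measure \<Rightarrow> 'y::polish_space measure \<Rightarrow> ('x \<Rightarrow> 'y \<Rightarrow> ennreal)
    \<Rightarrow> nat \<Rightarrow> nat \<Rightarrow> nat \<Rightarrow> 'x \<Rightarrow> real" where
  "dual_left \<mu> \<nu> c n j k = sinkhorn_dual \<mu> \<nu> (cost_minorant c n) (1 / real (Suc j)) k"

definition dual_right ::
  "'x::polish_space measure \<Rightarrow> 'y::polish_space measure \<Rightarrow> ('x \<Rightarrow> 'y \<Rightarrow> ennreal)
    \<Rightarrow> nat \<Rightarrow> nat \<Rightarrow> nat \<Rightarrow> 'y \<Rightarrow> real" where
  "dual_right \<mu> \<nu> c n j k = c_transform (cost_minorant c n) (dual_left \<mu> \<nu> c n j k)"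

text \<open>
  Cutting off where the minorant is far below the cost makes the cost of what remains comparable to
  its cost with respect to the minorant, even where \<open>c\<close> is infinite.
\<close>

definition cut_density ::
  "real \<Rightarrow> 'x::polish_space measure \<Rightarrow> 'y::polish_space measure \<Rightarrow> ('x \<Rightarrow> 'y \<Rightarrow> ennreal)
    \<Rightarrow> nat \<Rightarrow> nat \<Rightarrow> nat \<Rightarrow> 'x \<Rightarrow> 'y \<Rightarrow> real" where
  "cut_density \<delta> \<mu> \<nu> c n j k x y =
     (if c x y \<le> ennreal (cost_minorant c n x y + \<delta>)
      then sub_density \<mu> \<nu> (cost_minorant c n) (1 / real (Suc j)) k x y else 0)"

definition plan_density ::
  "real \<Rightarrow> 'x::polish_space measure \<Rightarrow> 'y::polish_space measure \<Rightarrow> ('x \<Rightarrow> 'y \<Rightarrow> ennreal)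
    \<Rightarrow> nat \<Rightarrow> nat \<Rightarrow> nat \<Rightarrow> nat \<Rightarrow> 'x \<Rightarrow> 'y \<Rightarrow> real" where
  "plan_density \<delta> \<mu> \<nu> c n j k i = completion \<mu> \<nu> (1 / real (Suc i)) (cut_density \<delta> \<mu> \<nu> c n j k)"

lemma cost_minorant_lip:
  "\<bar>cost_minorant c n x y - cost_minorant c n x' y\<bar> \<le> real n * dist x x'"
  "\<bar>cost_minorant c n x y - cost_minorant c n x y'\<bar> \<le> real n * dist y y'"
  using lip_minorant_abs_diff[of "\<lambda>(x, y). c x y" n "(x, y)" "(x', y)"]
    lip_minorant_abs_diff[of "\<lambda>(x, y). c x y" n "(x, y)" "(x, y')"]
  by (simp_all add: cost_minorant_def dist_Pair_Pair)

lemma cost_minorant_bounds: "0 \<le> cost_minorant c n x y" "cost_minorant c n x y \<le> real n"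
  by (simp_all add: cost_minorant_def lip_minorant_nonneg lip_minorant_le_n)

lemma cost_minorant_measurable:
  "(\<lambda>(x, y). cost_minorant c n x y) \<in> borel_measurable (borel \<Otimes>\<^sub>M borel)"
proof -
  have "continuous_on UNIV (lip_minorant (\<lambda>(x, y). c x y) n)"
    by (rule lipschitz_on_continuous_on[of "real n"])
      (auto intro!: lipschitz_onI simp: dist_real_def lip_minorant_abs_diff)
  then have "lip_minorant (\<lambda>(x, y). c x y) n \<in> borel_measurable borel"
    by (rule borel_measurable_continuous_onI)
  then show ?thesis by (simp add: cost_minorant_def borel_prod)
qed

lemma compact_carries_mass:
  fixes N :: "'z::polish_space measure"
  assumes N: "prob_space N" "sets N = sets borel" and t: "0 < t"
  shows "\<exists>K. compact K \<and> measure N (- K) \<le> t"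
proof -
  interpret N: prob_space N by (rule N)
  have sp: "space N = UNIV" using sets_eq_imp_space_eq[OF N(2)] by simp
  have "emeasure N UNIV = (SUP K\<in>{K. K \<subseteq> UNIV \<and> compact K}. emeasure N K)"
    by (rule inner_regular[OF N(2)]) simp_all
  then have eq: "(SUP K\<in>{K. K \<subseteq> UNIV \<and> compact K}. emeasure N K) = 1"
    using N.emeasure_space_1 sp by simp
  have "ennreal (1 - t) < 1" using t ennreal_lessI[of 1 "1 - t"] by simp
  then obtain K where K: "compact K" "ennreal (1 - t) < emeasure N K"
    unfolding eq[symmetric] less_SUP_iff by blast
  have Kb: "K \<in> sets N" using compact_imp_closed[OF K(1)] N(2) by (simp add: borel_closed)
  have "\<not> ennreal (N.prob K) \<le> ennreal (1 - t)"
    using K(2) by (simp add: N.emeasure_eq_measure not_le)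
  then have "1 - t \<le> N.prob K" using ennreal_leI[of "N.prob K" "1 - t"] by linarith
  then have "N.prob (- K) \<le> t" using N.prob_compl[OF Kb] sp by (simp add: Compl_eq_Diff_UNIV)
  with K show ?thesis by blast
qed

locale continuous_cost =
  fixes \<mu> :: "'x::polish_space measure" and \<nu> :: "'y::polish_space measure"
    and c :: "'x \<Rightarrow> 'y \<Rightarrow> ennreal"
  assumes prob_\<mu>: "prob_space \<mu>" and prob_\<nu>: "prob_space \<nu>"
    and sets_\<mu> [measurable_cong]: "sets \<mu> = sets borel"
    and sets_\<nu> [measurable_cong]: "sets \<nu> = sets borel"
    and c_cont: "continuous_on UNIV (\<lambda>(x, y). c x y)"
begin

sublocale L: lipschitz_cost \<mu> \<nu> "cost_minorant c n" "real n" for n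
  by (intro lipschitz_cost.intro prob_\<mu> prob_\<nu> sets_\<mu> sets_\<nu> cost_minorant_measurable cost_minorant_lip
      cost_minorant_bounds)

sublocale S: sinkhorn_iteration \<mu> \<nu> "cost_minorant c n" "real n" "1 / real (Suc j)" for n j
  by unfold_locales simp

declare of_nat_Suc [simp del]

abbreviation "P \<equiv> \<mu> \<Otimes>\<^sub>M \<nu>"
abbreviation "b \<equiv> cost_minorant c"

lemma c_measurable [measurable]: "(\<lambda>(x, y). c x y) \<in> borel_measurable (borel \<Otimes>\<^sub>M borel)"
  using borel_measurable_continuous_onI[OF c_cont] by (simp add: borel_prod)

lemma minorant_le_cost: "ennreal (b n x y) \<le> c x y"
  using lip_minorant_le_cost[OF c_cont, of n "(x, y)"] by (simp add: cost_minorant_def)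

lemma cut_measurable [measurable]:
  "(\<lambda>(x, y). cut_density \<delta> \<mu> \<nu> c n j k x y) \<in> borel_measurable (borel \<Otimes>\<^sub>M borel)"
  unfolding cut_density_def by measurable

lemma cut_le: "cut_density \<delta> \<mu> \<nu> c n j k x y \<le> S.h' n j k x y"
  by (simp add: cut_density_def S.h'_nonneg)

lemma cut_nonneg: "0 \<le> cut_density \<delta> \<mu> \<nu> c n j k x y"
  by (simp add: cut_density_def S.h'_nonneg)

sublocale C: sub_coupling \<mu> \<nu> "cut_density \<delta> \<mu> \<nu> c n j k" "1 / real (Suc i)" for \<delta> n j k i
proof
  obtain R where R: "\<And>x y. \<bar>S.h' n j k x y\<bar> \<le> R" using S.h'_bounded by blast
  have Rc: "\<bar>cut_density \<delta> \<mu> \<nu> c n j k x y\<bar> \<le> R" for x y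
    using cut_le[of \<delta> n j k x y] cut_nonneg[of \<delta> n j k x y] R[of x y] by linarith
  show "\<exists>R. \<forall>x y. cut_density \<delta> \<mu> \<nu> c n j k x y \<le> R" using Rc abs_le_D1 by blast
  show "(\<integral>y. cut_density \<delta> \<mu> \<nu> c n j k x y \<partial>\<nu>) \<le> 1" for x
  proof (rule order_trans[OF integral_mono S.h'_marginals(1)])
    show "integrable \<nu> (cut_density \<delta> \<mu> \<nu> c n j k x)"
      by (rule L.Y.integrable_bounded[OF _ Rc]) measurable
    show "integrable \<nu> (S.h' n j k x)" by (rule L.Y.integrable_bounded[OF _ R]) measurable
  qed (rule cut_le)
  show "(\<integral>x. cut_density \<delta> \<mu> \<nu> c n j k x y \<partial>\<mu>) \<le> 1" for y
  proof (rule order_trans[OF integral_mono])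
    show "integrable \<mu> (\<lambda>x. cut_density \<delta> \<mu> \<nu> c n j k x y)"
      by (rule L.X.integrable_bounded[OF _ Rc]) measurable
    show "integrable \<mu> (\<lambda>x. S.h' n j k x y)" by (rule L.X.integrable_bounded[OF _ R]) measurable
    show "(\<integral>x. S.h' n j k x y \<partial>\<mu>) \<le> 1" using S.h'_marginals(2)[of n j k y] by simp
  qed (rule cut_le)
qed (simp_all add: cut_nonneg)

lemma dual_right_le: "dual_right \<mu> \<nu> c n j k y \<le> dual_left \<mu> \<nu> c n j k x + b n x y"
  unfolding dual_right_def dual_left_def by (rule S.\<phi>'_le)

abbreviation "V n j k \<equiv> (\<integral>y. dual_right \<mu> \<nu> c n j k y \<partial>\<nu>) - (\<integral>x. dual_left \<mu> \<nu> c n j k x \<partial>\<mu>)"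

abbreviation "I \<equiv> \<integral>\<^sup>+(x, y). c x y \<partial>P"

lemma iterated_integral:
  fixes f :: "'x \<Rightarrow> 'y \<Rightarrow> real"
  assumes [measurable]: "(\<lambda>(x, y). f x y) \<in> borel_measurable (borel \<Otimes>\<^sub>M borel)" and R: "\<And>x y. \<bar>f x y\<bar> \<le> R"
  shows "integrable P (\<lambda>(x, y). f x y)" "(\<integral>x. (\<integral>y. f x y \<partial>\<nu>) \<partial>\<mu>) = (\<integral>(x, y). f x y \<partial>P)"
    "(\<integral>y. (\<integral>x. f x y \<partial>\<mu>) \<partial>\<nu>) = (\<integral>(x, y). f x y \<partial>P)"
proof -
  show i: "integrable P (\<lambda>(x, y). f x y)"
    by (rule L.XY.integrable_bounded[where R=R]) (use R in auto)
  show "(\<integral>x. (\<integral>y. f x y \<partial>\<nu>) \<partial>\<mu>) = (\<integral>(x, y). f x y \<partial>P)"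
    using L.XY.integral_fst'[OF i] by simp
  then show "(\<integral>y. (\<integral>x. f x y \<partial>\<mu>) \<partial>\<nu>) = (\<integral>(x, y). f x y \<partial>P)"
    using L.integral_swap[OF assms] by simp
qed

lemma b_abs: "\<bar>b n x y\<bar> \<le> real n"
  using L.b_nonneg[of n x y] L.b_le[of n x y] by simp

text \<open>
  Weak duality against the independent coupling.
\<close>

lemma V_le:
  assumes "I < \<infinity>"
  shows "V n j k \<le> enn2real I"
proof -
  have bi: "integrable \<nu> (b n x)" for x by (rule L.Y.integrable_bounded[OF _ b_abs]) measurable
  have ri: "integrable \<nu> (dual_right \<mu> \<nu> c n j k)"
    unfolding dual_right_def dual_left_def by (rule L.Y.integrable_bounded[OF _ S.\<phi>'_bounded]) measurable
  have li: "integrable \<mu> (dual_left \<mu> \<nu> c n j k)"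
    unfolding dual_left_def by simp
  have bb: "integrable \<mu> (\<lambda>x. \<integral>y. b n x y \<partial>\<nu>)"
  proof (rule L.X.integrable_bounded[where R="real n"])
    show "\<bar>\<integral>y. b n x y \<partial>\<nu>\<bar> \<le> real n" for x
      by (rule order_trans[OF integral_abs_bound L.Y.integral_le_const])
        (use bi b_abs in auto)
  qed measurable
  have "(\<integral>y. dual_right \<mu> \<nu> c n j k y \<partial>\<nu>) \<le> dual_left \<mu> \<nu> c n j k x + (\<integral>y. b n x y \<partial>\<nu>)" for x
  proof -
    have "(\<integral>y. dual_right \<mu> \<nu> c n j k y \<partial>\<nu>) \<le> (\<integral>y. dual_left \<mu> \<nu> c n j k x + b n x y \<partial>\<nu>)"
      by (rule integral_mono) (use ri bi dual_right_le in auto)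
    then show ?thesis using bi by simp
  qed
  then have "(\<integral>y. dual_right \<mu> \<nu> c n j k y \<partial>\<nu>) \<le> (\<integral>x. dual_left \<mu> \<nu> c n j k x + (\<integral>y. b n x y \<partial>\<nu>) \<partial>\<mu>)"
    by (intro L.X.integral_ge_const) (use li bb in auto)
  also have "\<dots> = (\<integral>x. dual_left \<mu> \<nu> c n j k x \<partial>\<mu>) + (\<integral>(x, y). b n x y \<partial>P)"
    using li bb iterated_integral(2)[OF L.b_measurable b_abs] by simp
  also have "(\<integral>(x, y). b n x y \<partial>P) \<le> enn2real I"
  proof -
    have "ennreal (\<integral>(x, y). b n x y \<partial>P) = (\<integral>\<^sup>+(x, y). ennreal (b n x y) \<partial>P)"
      by (subst nn_integral_eq_integral[symmetric])
        (use iterated_integral(1)[OF L.b_measurable b_abs] in \<open>auto simp: L.b_nonneg split_beta'\<close>)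
    also have "\<dots> \<le> I" by (intro nn_integral_mono) (auto simp: minorant_le_cost)
    finally have "enn2real (ennreal (\<integral>(x, y). b n x y \<partial>P)) \<le> enn2real I"
      using assms by (intro enn2real_mono) auto
    moreover have "0 \<le> (\<integral>(x, y). b n x y \<partial>P)"
      by (rule integral_nonneg_AE) (auto simp: L.b_nonneg)
    ultimately show ?thesis by simp
  qed
  finally show ?thesis by simp
qed

text \<open>
  Mass is cut off only outside a compact product set or where \<open>b\<close> reaches a large level \<open>m\<close>, once
  \<open>n\<close> is so large that the minorant is within \<open>\<delta>\<close> of \<open>min c (m + \<delta>)\<close> on that compact set. The former
  part is small because the marginals are tight, the latter by Markov's inequality: the \<open>b\<close>-cost is at most the
  cost of the independent coupling up to a small error, whatever \<open>n\<close> is.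
\<close>

lemma cut_near_optimal:
  assumes I: "I < \<infinity>" and \<delta>: "0 < \<delta>" and \<tau>: "0 < \<tau>"
  shows "\<exists>n j k. 1 - (\<integral>x. (\<integral>y. cut_density \<delta> \<mu> \<nu> c n j k x y \<partial>\<nu>) \<partial>\<mu>) \<le> \<tau> \<and>
    0 \<le> V n j k + 2 * \<delta> \<and>
    (\<integral>\<^sup>+(x, y). c x y * ennreal (cut_density \<delta> \<mu> \<nu> c n j k x y) \<partial>P) \<le> ennreal (V n j k + 2 * \<delta>)"
proof -
  define t where "t = \<tau> / 4"
  have t: "0 < t" using \<tau> by (simp add: t_def)
  \<comment> \<open>chosen so that a density with cost at most \<open>enn2real I + 1\<close> has mass at most \<open>t\<close> above level \<open>m\<close>\<close>
  define m where "m = (enn2real I + 1) / t"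
  have m: "0 < m" using t by (simp add: m_def add_nonneg_pos)
  obtain K1 where K1: "compact K1" "L.X.prob (- K1) \<le> t"
    using compact_carries_mass[OF prob_\<mu> sets_\<mu> t] by blast
  obtain K2 where K2: "compact K2" "L.Y.prob (- K2) \<le> t"
    using compact_carries_mass[OF prob_\<nu> sets_\<nu> t] by blast
  have Kb [measurable]: "K1 \<in> sets borel" "K2 \<in> sets borel"
    using K1 K2 by (auto intro: borel_closed compact_imp_closed)
  obtain n where n: "\<And>z. z \<in> K1 \<times> K2 \<Longrightarrow>
      min (case z of (x, y) \<Rightarrow> c x y) (ennreal (m + \<delta>)) \<le> ennreal (lip_minorant (\<lambda>(x, y). c x y) n z + \<delta>)"
    using lip_minorant_compact[OF c_cont compact_Times[OF K1(1) K2(1)] \<delta>, of "m + \<delta>"] m \<delta>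
    by auto
  define d where "d = min \<delta> (min t 1)"
  have d: "0 < d" "d \<le> \<delta>" "d \<le> t" "d \<le> 1" using \<delta> t by (auto simp: d_def)
  obtain j k where jk: "(\<integral>x. (\<integral>y. S.h' n j k x y \<partial>\<nu>) \<partial>\<mu>) \<ge> 1 - d"
    "(\<integral>x. (\<integral>y. b n x y * S.h' n j k x y \<partial>\<nu>) \<partial>\<mu>) \<le> V n j k + d"
    using L.near_optimal[OF d(1), of n] unfolding dual_right_def dual_left_def by blast
  let ?h = "S.h' n j k" and ?q = "cut_density \<delta> \<mu> \<nu> c n j k"
  obtain R where R: "\<And>x y. \<bar>?h x y\<bar> \<le> R" using S.h'_bounded by blast
  have R0: "0 \<le> R" using R abs_ge_zero order_trans by blast
  have qR: "\<bar>?q x y\<bar> \<le> R" for x y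
    using cut_le[of \<delta> n j k x y] cut_nonneg[of \<delta> n j k x y] R[of x y] by linarith
  have bR: "\<bar>b n x y * ?h x y\<bar> \<le> real n * R" for x y
    unfolding abs_mult using b_abs R by (intro mult_mono) auto
  have i1: "\<bar>?h x y * indicator (- K1) x\<bar> \<le> R" for x y using R[of x y] R0 by (simp add: indicator_def)
  have i2: "\<bar>?h x y * indicator (- K2) y\<bar> \<le> R" for x y using R[of x y] R0 by (simp add: indicator_def)
  note Ih = iterated_integral[where f="?h", OF S.h'_measurable R]
  note Iq = iterated_integral[where f="?q", OF cut_measurable qR]
  have bm [measurable]: "(\<lambda>(x, y). b n x y * ?h x y) \<in> borel_measurable (borel \<Otimes>\<^sub>M borel)" by measurable
  note Ib = iterated_integral[OF bm bR]
  have m1: "(\<lambda>(x, y). ?h x y * indicator (- K1) x) \<in> borel_measurable (borel \<Otimes>\<^sub>M borel)" by measurable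
  have m2: "(\<lambda>(x, y). ?h x y * indicator (- K2) y) \<in> borel_measurable (borel \<Otimes>\<^sub>M borel)" by measurable
  note I1 = iterated_integral[OF m1 i1] and I2 = iterated_integral[OF m2 i2]
  have int_b: "(\<integral>(x, y). b n x y * ?h x y \<partial>P) \<le> V n j k + d" using jk(2) Ib(2) by simp
  have b_nn: "0 \<le> (\<integral>(x, y). b n x y * ?h x y \<partial>P)"
    by (rule integral_nonneg_AE) (auto simp: L.b_nonneg S.h'_nonneg)
  have ih1: "(\<integral>(x, y). ?h x y \<partial>P) \<le> 1"
    using S.mass_h'[of n j k] Ih(2) by (simp add: integral_nonneg_AE)
  have "?h x y \<le> ?q x y + ?h x y * indicator (- K1) x + ?h x y * indicator (- K2) y + (b n x y * ?h x y) / m" for x y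
  proof -
    have nn: "0 \<le> ?h x y" "0 \<le> (b n x y * ?h x y) / m"
      using S.h'_nonneg L.b_nonneg m by simp_all
    consider "c x y \<le> ennreal (b n x y + \<delta>)" | "x \<notin> K1" | "y \<notin> K2"
      | "\<not> c x y \<le> ennreal (b n x y + \<delta>)" "x \<in> K1" "y \<in> K2" by blast
    then show ?thesis
    proof cases
      case 1
      then have "?q x y = ?h x y" by (simp add: cut_density_def)
      then show ?thesis using nn by simp
    next
      case 4
      then have "ennreal (m + \<delta>) \<le> ennreal (b n x y + \<delta>)"
        using n[of "(x, y)"] by (auto simp: cost_minorant_def min_le_iff_disj)
      then have "m \<le> b n x y"
        using L.b_nonneg[of n x y] \<delta> by (subst (asm) ennreal_le_iff) auto
      then have "?h x y * m \<le> b n x y * ?h x y"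
        using nn(1) by (simp add: mult.commute mult_right_mono)
      then have "?h x y \<le> b n x y * ?h x y / m" using m by (simp add: pos_le_divide_eq)
      then show ?thesis using 4 cut_nonneg[of \<delta> n j k x y] by simp
    qed (use nn cut_nonneg[of \<delta> n j k x y] in simp_all)
  qed
  then have "(\<integral>(x, y). ?h x y \<partial>P) \<le> (\<integral>z. (\<lambda>(x, y). ?q x y) z + (\<lambda>(x, y). ?h x y * indicator (- K1) x) z
      + (\<lambda>(x, y). ?h x y * indicator (- K2) y) z + (\<lambda>(x, y). b n x y * ?h x y) z / m \<partial>P)"
    by (intro integral_mono Bochner_Integration.integrable_add integrable_divide Ih(1) Iq(1) I1(1) I2(1) Ib(1))
      (auto simp: split_beta')
  also have "\<dots> = (\<integral>(x, y). ?q x y \<partial>P) + (\<integral>(x, y). ?h x y * indicator (- K1) x \<partial>P)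
      + (\<integral>(x, y). ?h x y * indicator (- K2) y \<partial>P) + (\<integral>(x, y). b n x y * ?h x y \<partial>P) / m"
    using Iq(1) I1(1) I2(1) Ib(1) by simp
  also have "(\<integral>(x, y). ?h x y * indicator (- K1) x \<partial>P) \<le> t"
  proof -
    have "(\<integral>x. (\<integral>y. ?h x y \<partial>\<nu>) * indicator (- K1) x \<partial>\<mu>) \<le> (\<integral>x. indicator (- K1) x \<partial>\<mu>)"
    proof (rule integral_mono)
      show "integrable \<mu> (\<lambda>x. (\<integral>y. ?h x y \<partial>\<nu>) * indicator (- K1) x)"
        by (rule L.X.integrable_bounded[where R=1])
          (use S.h'_marginals(1)[of n j k] S.h'_nonneg[of n j k] in \<open>auto simp: indicator_def integral_nonneg_AE\<close>)
      show "integrable \<mu> (indicat_real (- K1))"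
        by (rule L.X.integrable_bounded[where R=1]) auto
      show "(\<integral>y. ?h x y \<partial>\<nu>) * indicator (- K1) x \<le> indicat_real (- K1) x" for x
        using S.h'_marginals(1)[of n j k x] by (simp add: indicator_def)
    qed
    also have "\<dots> \<le> t" using K1(2) by simp
    finally show ?thesis using I1(2) by simp
  qed
  also have "(\<integral>(x, y). ?h x y * indicator (- K2) y \<partial>P) \<le> t"
  proof -
    have "(\<integral>y. (\<integral>x. ?h x y \<partial>\<mu>) * indicator (- K2) y \<partial>\<nu>) \<le> (\<integral>y. indicator (- K2) y \<partial>\<nu>)"
    proof (rule integral_mono)
      have le: "(\<integral>x. ?h x y \<partial>\<mu>) \<le> 1" for y using S.h'_marginals(2)[of n j k y] by simp
      show "integrable \<nu> (\<lambda>y. (\<integral>x. ?h x y \<partial>\<mu>) * indicator (- K2) y)"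
        by (rule L.Y.integrable_bounded[where R=1])
          (use le S.h'_nonneg[of n j k] in \<open>auto simp: indicator_def integral_nonneg_AE\<close>)
      show "integrable \<nu> (indicat_real (- K2))"
        by (rule L.Y.integrable_bounded[where R=1]) auto
      show "(\<integral>x. ?h x y \<partial>\<mu>) * indicator (- K2) y \<le> indicat_real (- K2) y" for y
        using le[of y] by (simp add: indicator_def)
    qed
    also have "\<dots> \<le> t" using K2(2) by simp
    finally show ?thesis using I2(3) by simp
  qed
  also have "(\<integral>(x, y). b n x y * ?h x y \<partial>P) / m \<le> t"
  proof -
    have "(\<integral>(x, y). b n x y * ?h x y \<partial>P) \<le> t * m"
      using int_b V_le[OF I, of n j k] d(4) t by (simp add: m_def)
    then show ?thesis using m by (simp add: pos_divide_le_eq)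
  qed
  finally have "(\<integral>(x, y). ?h x y \<partial>P) \<le> (\<integral>(x, y). ?q x y \<partial>P) + t + t + t" by simp
  then have 1: "1 - (\<integral>x. (\<integral>y. ?q x y \<partial>\<nu>) \<partial>\<mu>) \<le> \<tau>"
    using jk(1) Ih(2) Iq(2) d(3) by (simp add: t_def)
  have 2: "0 \<le> V n j k + 2 * \<delta>" using b_nn int_b d(2) \<delta> by linarith
  have "(\<integral>\<^sup>+(x, y). c x y * ennreal (?q x y) \<partial>P) \<le> (\<integral>\<^sup>+(x, y). ennreal (b n x y * ?h x y + \<delta> * ?h x y) \<partial>P)"
  proof (intro nn_integral_mono, clarify)
    fix x y
    show "c x y * ennreal (?q x y) \<le> ennreal (b n x y * ?h x y + \<delta> * ?h x y)"
    proof (cases "c x y \<le> ennreal (b n x y + \<delta>)")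
      case True
      then have "c x y * ennreal (?q x y) \<le> ennreal (b n x y + \<delta>) * ennreal (?h x y)"
        by (intro mult_mono) (auto simp: cut_density_def)
      also have "\<dots> = ennreal (b n x y * ?h x y + \<delta> * ?h x y)"
        using L.b_nonneg[of n x y] \<delta> S.h'_nonneg[of n j k x y]
        by (simp add: distrib_right flip: ennreal_mult)
      finally show ?thesis .
    qed (simp add: cut_density_def)
  qed
  also have "\<dots> = (\<integral>\<^sup>+z. ennreal ((\<lambda>(x, y). b n x y * ?h x y) z + \<delta> * (\<lambda>(x, y). ?h x y) z) \<partial>P)"
    by (intro nn_integral_cong) (simp add: split_beta')
  also have "\<dots> = ennreal (\<integral>z. (\<lambda>(x, y). b n x y * ?h x y) z + \<delta> * (\<lambda>(x, y). ?h x y) z \<partial>P)"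
  proof (rule nn_integral_eq_integral)
    show "integrable P (\<lambda>z. (\<lambda>(x, y). b n x y * ?h x y) z + \<delta> * (\<lambda>(x, y). ?h x y) z)"
      by (intro Bochner_Integration.integrable_add integrable_mult_right Ib(1) Ih(1))
    have "0 \<le> b n x y * ?h x y + \<delta> * ?h x y" for x y
      using L.b_nonneg[of n x y] S.h'_nonneg[of n j k x y] \<delta> by (intro add_nonneg_nonneg mult_nonneg_nonneg) auto
    then show "AE z in P. 0 \<le> (\<lambda>(x, y). b n x y * ?h x y) z + \<delta> * (\<lambda>(x, y). ?h x y) z"
      by (simp add: split_beta')
  qed
  also have "(\<integral>z. (\<lambda>(x, y). b n x y * ?h x y) z + \<delta> * (\<lambda>(x, y). ?h x y) z \<partial>P)
      = (\<integral>(x, y). b n x y * ?h x y \<partial>P) + \<delta> * (\<integral>(x, y). ?h x y \<partial>P)"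
    using Ib(1) Ih(1) by simp
  also have "\<dots> \<le> V n j k + 2 * \<delta>"
  proof -
    have "\<delta> * (\<integral>(x, y). ?h x y \<partial>P) \<le> \<delta> * 1" using \<delta> ih1 by (intro mult_left_mono) auto
    then show ?thesis using int_b d(2) by linarith
  qed
  finally have "(\<integral>\<^sup>+(x, y). c x y * ennreal (?q x y) \<partial>P) \<le> ennreal (V n j k + 2 * \<delta>)"
    by (simp add: ennreal_leI)
  with 1 2 show ?thesis by blast
qed

lemma cost_tail_small:
  assumes I: "I < \<infinity>" and e: "0 < e"
  shows "\<exists>K::nat. (\<integral>\<^sup>+(x, y). (if ennreal (real K) < c x y then c x y else 0) \<partial>P) < ennreal e"
proof -
  let ?T = "\<lambda>K (x, y). if ennreal (real K) < c x y then c x y else 0"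
  have "(\<lambda>K. \<integral>\<^sup>+z. ?T K z \<partial>P) \<longlonglongrightarrow> (\<integral>\<^sup>+z. 0 \<partial>P)"
  proof (rule nn_integral_dominated_convergence[where w="\<lambda>(x, y). c x y"])
    have "AE z in P. (\<lambda>(x, y). c x y) z \<noteq> \<infinity>"
      by (rule nn_integral_PInf_AE) (use I in auto)
    then show "AE z in P. (\<lambda>K. ?T K z) \<longlonglongrightarrow> 0"
    proof (rule AE_mp, intro AE_I2 impI)
      fix z assume fin: "(\<lambda>(x, y). c x y) z \<noteq> \<infinity>"
      obtain K0 :: nat where K0: "enn2real ((\<lambda>(x, y). c x y) z) \<le> real K0" using real_arch_simple by blast
      have le: "(\<lambda>(x, y). c x y) z \<le> ennreal (real K)" if "K0 \<le> K" for K
      proof -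
        have "(\<lambda>(x, y). c x y) z = ennreal (enn2real ((\<lambda>(x, y). c x y) z))" using fin by (simp add: less_top)
        also have "\<dots> \<le> ennreal (real K)" using K0 that by (intro ennreal_leI) simp
        finally show ?thesis .
      qed
      have "?T K z = 0" if "K0 \<le> K" for K
        using leD[OF le[OF that]] by (cases z) simp
      then have "eventually (\<lambda>K. ?T K z = 0) sequentially" by (auto simp: eventually_sequentially)
      then show "(\<lambda>K. ?T K z) \<longlonglongrightarrow> 0" by (rule tendsto_eventually)
    qed
  qed (use I in auto)
  then have "eventually (\<lambda>K. (\<integral>\<^sup>+z. ?T K z \<partial>P) < ennreal e) sequentially"
    using e by (intro order_tendstoD(2)[where y=0]) simp_all
  then show ?thesis by (auto dest: eventually_happens)
qed

text \<open>
  The fraction \<open>\<eta>\<close> is fixed first, by the cost of the independent coupling; then the level \<open>K\<close>, by the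
  tail of the cost; and then the admissible missing mass \<open>\<tau>\<close>. Each of the two error terms in
  \<open>completion_cost\<close> is at most \<open>\<delta>\<close>, and \<open>cut_near_optimal\<close> contributes \<open>2 * \<delta>\<close>.
\<close>

lemma plan_near_optimal:
  assumes I: "I < \<infinity>" and \<delta>: "0 < \<delta>"
  shows "\<exists>n j k i. 0 \<le> V n j k + 4 * \<delta> \<and>
    (\<integral>\<^sup>+(x, y). c x y * ennreal (plan_density \<delta> \<mu> \<nu> c n j k i x y) \<partial>P) \<le> ennreal (V n j k + 4 * \<delta>)"
proof -
  obtain i :: nat where i: "enn2real I / \<delta> \<le> real i" using real_arch_simple by blast
  define \<eta> where "\<eta> = 1 / real (Suc i)"
  have \<eta>: "0 < \<eta>" by (simp add: \<eta>_def)
  have "enn2real I \<le> \<delta> * real (Suc i)" using i \<delta> by (simp add: pos_divide_le_eq algebra_simps of_nat_Suc)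
  then have \<eta>I: "\<eta> * enn2real I \<le> \<delta>" by (simp add: \<eta>_def pos_divide_le_eq)
  define A where "A = 1 + 1 / \<eta>"
  have A: "0 < A" using \<eta> by (simp add: A_def add_pos_pos)
  obtain K :: nat where K: "(\<integral>\<^sup>+(x, y). (if ennreal (real K) < c x y then c x y else 0) \<partial>P) < ennreal (\<delta> / (4 * A))"
    using cost_tail_small[OF I, of "\<delta> / (4 * A)"] A \<delta> by auto
  define \<tau> where "\<tau> = \<delta> / (4 * A * (real K + 1))"
  have \<tau>: "0 < \<tau>" using A \<delta> by (simp add: \<tau>_def)
  obtain n j k where *: "1 - (\<integral>x. (\<integral>y. cut_density \<delta> \<mu> \<nu> c n j k x y \<partial>\<nu>) \<partial>\<mu>) \<le> \<tau>"
    "0 \<le> V n j k + 2 * \<delta>"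
    "(\<integral>\<^sup>+(x, y). c x y * ennreal (cut_density \<delta> \<mu> \<nu> c n j k x y) \<partial>P) \<le> ennreal (V n j k + 2 * \<delta>)"
    using cut_near_optimal[OF I \<delta> \<tau>] by blast
  let ?miss = "1 - (\<integral>x. (\<integral>y. cut_density \<delta> \<mu> \<nu> c n j k x y \<partial>\<nu>) \<partial>\<mu>)"
  have Km: "real K * ?miss \<le> \<delta> / (4 * A)"
  proof -
    have "real K * ?miss \<le> real K * \<tau>" using *(1) by (intro mult_left_mono) auto
    also have "\<dots> \<le> (real K + 1) * \<tau>" using \<tau> by (intro mult_right_mono) auto
    also have "\<dots> = \<delta> / (4 * A)" using A by (simp add: \<tau>_def)
    finally show ?thesis .
  qed
  have "(\<integral>\<^sup>+(x, y). c x y * ennreal (plan_density \<delta> \<mu> \<nu> c n j k i x y) \<partial>P)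
      \<le> (\<integral>\<^sup>+(x, y). c x y * ennreal (cut_density \<delta> \<mu> \<nu> c n j k x y) \<partial>P) + ennreal \<eta> * I
      + ennreal A * (2 * (ennreal (real K * ?miss)
          + (\<integral>\<^sup>+(x, y). (if ennreal (real K) < c x y then c x y else 0) \<partial>P)))"
    unfolding plan_density_def A_def \<eta>_def by (rule C.completion_cost) simp_all
  also have "\<dots> \<le> ennreal (V n j k + 2 * \<delta>) + ennreal \<delta>
      + ennreal A * (2 * (ennreal (\<delta> / (4 * A)) + ennreal (\<delta> / (4 * A))))"
  proof (intro add_mono mult_left_mono *(3) less_imp_le[OF K] ennreal_leI Km)
    have "ennreal \<eta> * I = ennreal (\<eta> * enn2real I)"
      using I \<eta> by (simp add: ennreal_mult)
    also have "\<dots> \<le> ennreal \<delta>" using \<eta>I by (rule ennreal_leI)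
    finally show "ennreal \<eta> * I \<le> ennreal \<delta>" .
  qed simp_all
  also have "2 * (ennreal (\<delta> / (4 * A)) + ennreal (\<delta> / (4 * A))) = ennreal (\<delta> / A)"
  proof -
    have *: "2 * (ennreal r + ennreal r) = ennreal (4 * r)" if "0 \<le> r" for r
    proof -
      have "ennreal (4 * r) = ennreal ((r + r) + (r + r))" by (rule arg_cong[where f=ennreal]) simp
      also have "\<dots> = 2 * (ennreal r + ennreal r)"
        by (simp only: ennreal_plus that add_nonneg_nonneg mult_2)
      finally show ?thesis by (rule sym)
    qed
    have "4 * (\<delta> / (4 * A)) = \<delta> / A" using A by (simp add: divide_simps)
    moreover have "0 \<le> \<delta> / (4 * A)" using A \<delta> by simp
    ultimately show ?thesis by (metis *)
  qed
  also have "ennreal A * ennreal (\<delta> / A) = ennreal \<delta>"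
    using A \<delta> by (simp flip: ennreal_mult)
  also have "ennreal (V n j k + 2 * \<delta>) + ennreal \<delta> + ennreal \<delta> = ennreal (V n j k + 4 * \<delta>)"
  proof -
    have "ennreal (v + 2 * \<delta>) + ennreal \<delta> + ennreal \<delta> = ennreal (v + 4 * \<delta>)" if "0 \<le> v + 2 * \<delta>" for v
      using that \<delta> by (simp flip: ennreal_plus)
    then show ?thesis using *(2) by blast
  qed
  finally show ?thesis using *(2) \<delta> by (intro exI[of _ n] exI[of _ j] exI[of _ k] exI[of _ i]) simp
qed

end

section \<open>Measurable dependence on the parameter\<close>

lemma log_int_exp_kernel_measurable:
  fixes f :: "'a \<Rightarrow> 'b::topological_space \<Rightarrow> real"
  assumes [measurable]: "(\<lambda>(a, y). f a y) \<in> borel_measurable (A \<Otimes>\<^sub>M borel)" and k: "prob_kernel A \<kappa>"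
  shows "(\<lambda>a. log_int_exp (\<kappa> a) \<epsilon> (f a)) \<in> borel_measurable A"
proof -
  have "(\<lambda>a. \<integral>y. exp (f a y / \<epsilon>) \<partial>\<kappa> a) \<in> borel_measurable A"
    by (rule kernel_integral_measurable[OF _ k]) measurable
  then show ?thesis unfolding log_int_exp_def by measurable
qed

text \<open>
  Lets the measurability prover handle applications of functions of three arguments.
\<close>

lemma measurable_uncurry3:
  assumes "(\<lambda>((a, x), y). F a x y) \<in> (A \<Otimes>\<^sub>M X) \<Otimes>\<^sub>M Y \<rightarrow>\<^sub>M R"
    and "f \<in> N \<rightarrow>\<^sub>M A" "g \<in> N \<rightarrow>\<^sub>M X" "h \<in> N \<rightarrow>\<^sub>M Y"
  shows "(\<lambda>p. F (f p) (g p) (h p)) \<in> N \<rightarrow>\<^sub>M R"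
  using measurable_compose[OF measurable_Pair[OF measurable_Pair[OF assms(2,3)] assms(4)] assms(1)]
  by simp

locale stochastic_cost =
  fixes M :: "'w measure"
    and \<mu> :: "'w \<Rightarrow> 'x::polish_space measure" and \<nu> :: "'w \<Rightarrow> 'y::polish_space measure"
    and c :: "'w \<Rightarrow> 'x \<Rightarrow> 'y \<Rightarrow> ennreal"
  assumes kernel_\<mu>: "prob_kernel M \<mu>" and kernel_\<nu>: "prob_kernel M \<nu>"
    and c_measurable: "(\<lambda>(\<omega>, x, y). c \<omega> x y) \<in> borel_measurable (M \<Otimes>\<^sub>M borel \<Otimes>\<^sub>M borel)"
    and c_cont: "\<And>\<omega>. \<omega> \<in> space M \<Longrightarrow> continuous_on UNIV (\<lambda>(x, y). c \<omega> x y)"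
begin

lemma continuous_cost: "\<omega> \<in> space M \<Longrightarrow> continuous_cost (\<mu> \<omega>) (\<nu> \<omega>) (c \<omega>)"
  using kernel_\<mu> kernel_\<nu> c_cont unfolding prob_kernel_iff by (auto intro!: continuous_cost.intro)

lemma c_triple: "(\<lambda>((\<omega>, x), y). c \<omega> x y) \<in> borel_measurable ((M \<Otimes>\<^sub>M borel) \<Otimes>\<^sub>M borel)"
proof -
  have "(\<lambda>p. (fst (fst p), snd (fst p), snd p)) \<in> (M \<Otimes>\<^sub>M (borel :: 'x measure)) \<Otimes>\<^sub>M (borel :: 'y measure) \<rightarrow>\<^sub>M M \<Otimes>\<^sub>M borel \<Otimes>\<^sub>M borel"
    by measurable
  from measurable_compose[OF this c_measurable] show ?thesis by (simp add: split_beta')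
qed

lemmas c_measurable3 [measurable (raw)] = measurable_uncurry3[OF c_triple]

lemma kernel_\<mu>_ext: "prob_kernel (M \<Otimes>\<^sub>M N) (\<lambda>p. \<mu> (fst p))"
  using measurable_compose[OF measurable_fst kernel_\<mu>] .

lemma kernel_\<nu>_ext: "prob_kernel (M \<Otimes>\<^sub>M N) (\<lambda>p. \<nu> (fst p))"
  using measurable_compose[OF measurable_fst kernel_\<nu>] .

abbreviation "b n \<omega> \<equiv> cost_minorant (c \<omega>) n"

text \<open>
  A countable infimum of measurable functions, since the dense sequence does not depend on \<open>\<omega>\<close>.
\<close>

lemma b_measurable: "(\<lambda>((\<omega>, x), y). b n \<omega> x y) \<in> borel_measurable ((M \<Otimes>\<^sub>M borel) \<Otimes>\<^sub>M borel)"
proof -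
  let ?d = "dense_seq :: nat \<Rightarrow> 'x \<times> 'y"
  have "(\<lambda>p. INF i. enn2real (min (c (fst (fst p)) (fst (?d i)) (snd (?d i))) (of_nat n))
      + of_nat n * dist (snd (fst p), snd p) (?d i)) \<in> borel_measurable ((M \<Otimes>\<^sub>M (borel :: 'x measure)) \<Otimes>\<^sub>M (borel :: 'y measure))"
  proof (rule borel_measurable_cINF)
    fix i :: nat
    have d: "(\<lambda>p. dist (snd (fst p), snd p) (?d i)) \<in> borel_measurable ((M \<Otimes>\<^sub>M (borel :: 'x measure)) \<Otimes>\<^sub>M (borel :: 'y measure))"
      by (intro borel_measurable_dist borel_measurable_const) (simp flip: borel_prod)
    have c: "(\<lambda>p. c (fst (fst p)) (fst (?d i)) (snd (?d i))) \<in> borel_measurable ((M \<Otimes>\<^sub>M (borel :: 'x measure)) \<Otimes>\<^sub>M (borel :: 'y measure))"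
    proof -
      obtain u v where uv: "?d i = (u, v)" by (cases "?d i")
      have "(\<lambda>p. ((fst (fst p), u), v)) \<in> (M \<Otimes>\<^sub>M (borel :: 'x measure)) \<Otimes>\<^sub>M (borel :: 'y measure) \<rightarrow>\<^sub>M (M \<Otimes>\<^sub>M borel) \<Otimes>\<^sub>M borel"
        by measurable
      from measurable_compose[OF this c_triple] show ?thesis by (simp add: uv)
    qed
    show "(\<lambda>p. enn2real (min (c (fst (fst p)) (fst (?d i)) (snd (?d i))) (of_nat n))
        + of_nat n * dist (snd (fst p), snd p) (?d i)) \<in> borel_measurable ((M \<Otimes>\<^sub>M (borel :: 'x measure)) \<Otimes>\<^sub>M (borel :: 'y measure))"
      using d c by measurable
  qed (auto intro!: bdd_belowI2[where m=0])
  then show ?thesis by (simp add: cost_minorant_def lip_minorant_def split_beta')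
qed

lemmas b_measurable3 [measurable (raw)] = measurable_uncurry3[OF b_measurable]

lemma sinkhorn_measurable [measurable]:
  "(\<lambda>(\<omega>, y). sinkhorn (\<mu> \<omega>) (\<nu> \<omega>) (b n \<omega>) \<epsilon> k y) \<in> borel_measurable (M \<Otimes>\<^sub>M borel)"
  "(\<lambda>(\<omega>, x). sinkhorn_dual (\<mu> \<omega>) (\<nu> \<omega>) (b n \<omega>) \<epsilon> k x) \<in> borel_measurable (M \<Otimes>\<^sub>M borel)"
proof -
  have dual: "(\<lambda>p. sinkhorn_dual (\<mu> (fst p)) (\<nu> (fst p)) (b n (fst p)) \<epsilon> k (snd p)) \<in> borel_measurable (M \<Otimes>\<^sub>M borel)"
    if [measurable]: "(\<lambda>(\<omega>, y). sinkhorn (\<mu> \<omega>) (\<nu> \<omega>) (b n \<omega>) \<epsilon> k y) \<in> borel_measurable (M \<Otimes>\<^sub>M borel)" for k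
    unfolding sinkhorn_dual_def by (rule log_int_exp_kernel_measurable[OF _ kernel_\<nu>_ext]) measurable
  have 1: "(\<lambda>(\<omega>, y). sinkhorn (\<mu> \<omega>) (\<nu> \<omega>) (b n \<omega>) \<epsilon> k y) \<in> borel_measurable (M \<Otimes>\<^sub>M borel)" for k
  proof (induction k)
    case (Suc k)
    have [measurable]: "(\<lambda>(\<omega>, x). sinkhorn_dual (\<mu> \<omega>) (\<nu> \<omega>) (b n \<omega>) \<epsilon> k x) \<in> borel_measurable (M \<Otimes>\<^sub>M borel)"
      using dual[OF Suc] by (simp add: split_beta')
    have "(\<lambda>p. log_int_exp (\<mu> (fst p)) \<epsilon> (\<lambda>x. - sinkhorn_dual (\<mu> (fst p)) (\<nu> (fst p)) (b n (fst p)) \<epsilon> k x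
        - b n (fst p) x (snd p))) \<in> borel_measurable (M \<Otimes>\<^sub>M borel)"
      by (rule log_int_exp_kernel_measurable[OF _ kernel_\<mu>_ext]) measurable
    then show ?case by (simp add: sinkhorn_dual_def split_beta')
  qed simp
  show "(\<lambda>(\<omega>, y). sinkhorn (\<mu> \<omega>) (\<nu> \<omega>) (b n \<omega>) \<epsilon> k y) \<in> borel_measurable (M \<Otimes>\<^sub>M borel)" by (rule 1)
  show "(\<lambda>(\<omega>, x). sinkhorn_dual (\<mu> \<omega>) (\<nu> \<omega>) (b n \<omega>) \<epsilon> k x) \<in> borel_measurable (M \<Otimes>\<^sub>M borel)"
    using dual[OF 1] by (simp add: split_beta')
qed

lemma dual_left_measurable [measurable]:
  "(\<lambda>(\<omega>, x). dual_left (\<mu> \<omega>) (\<nu> \<omega>) (c \<omega>) n j k x) \<in> borel_measurable (M \<Otimes>\<^sub>M borel)"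
  unfolding dual_left_def by measurable

lemma dual_right_measurable [measurable]:
  "(\<lambda>(\<omega>, y). dual_right (\<mu> \<omega>) (\<nu> \<omega>) (c \<omega>) n j k y) \<in> borel_measurable (M \<Otimes>\<^sub>M borel)"
proof -
  have "(\<lambda>p. INF i. dual_left (\<mu> (fst p)) (\<nu> (fst p)) (c (fst p)) n j k (dense_seq i) + b n (fst p) (dense_seq i) (snd p))
      \<in> borel_measurable (M \<Otimes>\<^sub>M borel)"
  proof (rule borel_measurable_cINF)
    show "(\<lambda>p. dual_left (\<mu> (fst p)) (\<nu> (fst p)) (c (fst p)) n j k (dense_seq i) + b n (fst p) (dense_seq i) (snd p))
      \<in> borel_measurable (M \<Otimes>\<^sub>M borel)" for i by measurable
    fix p assume "p \<in> space (M \<Otimes>\<^sub>M (borel :: 'y measure))"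
    then have "fst p \<in> space M" by (simp add: space_pair_measure mem_Times_iff)
    then interpret C: continuous_cost "\<mu> (fst p)" "\<nu> (fst p)" "c (fst p)" by (rule continuous_cost)
    show "bdd_below (range (\<lambda>i. dual_left (\<mu> (fst p)) (\<nu> (fst p)) (c (fst p)) n j k (dense_seq i) + b n (fst p) (dense_seq i) (snd p)))"
      using C.dual_right_le[of n j k "snd p"] by (intro bdd_belowI2)
  qed simp
  then show ?thesis by (simp add: dual_right_def c_transform_def split_beta')
qed

lemma plan_density_measurable:
  "(\<lambda>((\<omega>, x), y). plan_density \<delta> (\<mu> \<omega>) (\<nu> \<omega>) (c \<omega>) n j k i x y) \<in> borel_measurable ((M \<Otimes>\<^sub>M borel) \<Otimes>\<^sub>M borel)"
proof -
  let ?\<epsilon> = "1 / real (Suc j)"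
  have "(\<lambda>((\<omega>, x), y). sinkhorn_density (\<mu> \<omega>) (\<nu> \<omega>) (b n \<omega>) ?\<epsilon> k x y) \<in> borel_measurable ((M \<Otimes>\<^sub>M borel) \<Otimes>\<^sub>M borel)"
    unfolding sinkhorn_density_def split_beta' by measurable
  note [measurable (raw)] = measurable_uncurry3[OF this]
  have "(\<lambda>p. \<integral>x. sinkhorn_density (\<mu> (fst p)) (\<nu> (fst p)) (b n (fst p)) ?\<epsilon> k x (snd p) \<partial>\<mu> (fst p)) \<in> borel_measurable (M \<Otimes>\<^sub>M borel)"
    by (rule kernel_integral_measurable[OF _ kernel_\<mu>_ext]) measurable
  then have [measurable]: "(\<lambda>(\<omega>, y). \<integral>x. sinkhorn_density (\<mu> \<omega>) (\<nu> \<omega>) (b n \<omega>) ?\<epsilon> k x y \<partial>\<mu> \<omega>) \<in> borel_measurable (M \<Otimes>\<^sub>M borel)"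
    by (simp add: split_beta')
  have "(\<lambda>((\<omega>, x), y). cut_density \<delta> (\<mu> \<omega>) (\<nu> \<omega>) (c \<omega>) n j k x y) \<in> borel_measurable ((M \<Otimes>\<^sub>M borel) \<Otimes>\<^sub>M borel)"
    unfolding cut_density_def sub_density_def split_beta' by measurable
  note [measurable (raw)] = measurable_uncurry3[OF this]
  have "(\<lambda>p. \<integral>x. cut_density \<delta> (\<mu> (fst p)) (\<nu> (fst p)) (c (fst p)) n j k x (snd p) \<partial>\<mu> (fst p)) \<in> borel_measurable (M \<Otimes>\<^sub>M borel)"
    by (rule kernel_integral_measurable[OF _ kernel_\<mu>_ext]) measurable
  then have [measurable]: "(\<lambda>(\<omega>, y). \<integral>x. cut_density \<delta> (\<mu> \<omega>) (\<nu> \<omega>) (c \<omega>) n j k x y \<partial>\<mu> \<omega>) \<in> borel_measurable (M \<Otimes>\<^sub>M borel)"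
    by (simp add: split_beta')
  have "(\<lambda>p. \<integral>y. cut_density \<delta> (\<mu> (fst p)) (\<nu> (fst p)) (c (fst p)) n j k (snd p) y \<partial>\<nu> (fst p)) \<in> borel_measurable (M \<Otimes>\<^sub>M borel)"
    by (rule kernel_integral_measurable[OF _ kernel_\<nu>_ext]) measurable
  then have [measurable]: "(\<lambda>(\<omega>, x). \<integral>y. cut_density \<delta> (\<mu> \<omega>) (\<nu> \<omega>) (c \<omega>) n j k x y \<partial>\<nu> \<omega>) \<in> borel_measurable (M \<Otimes>\<^sub>M borel)"
    by (simp add: split_beta')
  have [measurable]: "(\<lambda>\<omega>. \<integral>x. (\<integral>y. cut_density \<delta> (\<mu> \<omega>) (\<nu> \<omega>) (c \<omega>) n j k x y \<partial>\<nu> \<omega>) \<partial>\<mu> \<omega>) \<in> borel_measurable M"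
    by (rule kernel_integral_measurable[OF _ kernel_\<mu>]) measurable
  show ?thesis unfolding plan_density_def completion_def split_beta' by measurable
qed

end

section \<open>Weak duality\<close>

text \<open>
  The right-hand side is the integral of the positive part of \<open>f\<close>.
\<close>

lemma ennreal_integral_le:
  fixes f :: "'a \<Rightarrow> real"
  assumes "integrable N f"
  shows "ennreal (\<integral>x. f x \<partial>N) \<le> (\<integral>\<^sup>+x. ennreal (f x) \<partial>N)"
proof -
  have i: "integrable N (\<lambda>x. max 0 (f x))" using assms by simp
  have "ennreal (\<integral>x. f x \<partial>N) \<le> ennreal (\<integral>x. max 0 (f x) \<partial>N)"
    by (intro ennreal_leI integral_mono assms i) simp
  also have "\<dots> = (\<integral>\<^sup>+x. ennreal (max 0 (f x)) \<partial>N)"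
    by (rule nn_integral_eq_integral[symmetric, OF i]) simp
  also have "\<dots> = (\<integral>\<^sup>+x. ennreal (f x) \<partial>N)"
    by (intro nn_integral_cong) (simp add: max_def ennreal_neg)
  finally show ?thesis .
qed

lemma ereal_le_enn2ereal_ennreal: "ereal r \<le> enn2ereal (ennreal r)"
  by (cases "0 \<le> r") (auto simp: enn2ereal_ennreal ennreal_neg zero_ennreal.rep_eq)

lemma ereal_le_enn2ereal_imp: "ereal r \<le> enn2ereal z \<Longrightarrow> ennreal r \<le> z"
  by (metis e2ennreal_ereal e2ennreal_enn2ereal e2ennreal_mono)

lemma abs_integral_le_nn_integral:
  fixes f :: "'a \<Rightarrow> real"
  shows "ennreal \<bar>\<integral>x. f x \<partial>N\<bar> \<le> (\<integral>\<^sup>+x. ennreal \<bar>f x\<bar> \<partial>N)"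
proof (cases "integrable N f")
  case True
  then show ?thesis using integral_norm_bound_ennreal[of N f] by simp
qed (simp add: not_integrable_integral_eq)

lemma kernel_couplingsD:
  assumes "\<pi> \<in> kernel_couplings M \<mu> \<nu>"
  shows "prob_kernel M \<pi>" "\<omega> \<in> space M \<Longrightarrow> distr (\<pi> \<omega>) borel fst = \<mu> \<omega>"
    "\<omega> \<in> space M \<Longrightarrow> distr (\<pi> \<omega>) borel snd = \<nu> \<omega>"
  using assms by (auto simp: kernel_couplings_def)

lemma dual_inner_integrable:
  fixes \<mu> :: "'w \<Rightarrow> 'x::polish_space measure" and \<nu> :: "'w \<Rightarrow> 'y::polish_space measure"
  assumes k: "prob_kernel M \<mu>" "prob_kernel M \<nu>"
    and \<psi>: "\<psi> \<in> L1_kernel M \<mu>" and \<phi>: "\<phi> \<in> L1_kernel M \<nu>"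
  shows "integrable M (\<lambda>\<omega>. (\<integral>y. \<phi> \<omega> y \<partial>\<nu> \<omega>) - (\<integral>x. \<psi> \<omega> x \<partial>\<mu> \<omega>))"
proof -
  have *: "integrable M (\<lambda>\<omega>. \<integral>y. f \<omega> y \<partial>\<kappa> \<omega>)" if f: "f \<in> L1_kernel M \<kappa>" and k: "prob_kernel M \<kappa>"
    for f and \<kappa> :: "'w \<Rightarrow> 'z::polish_space measure"
  proof (rule integrableI_bounded)
    show "(\<lambda>\<omega>. \<integral>y. f \<omega> y \<partial>\<kappa> \<omega>) \<in> borel_measurable M"
      by (rule kernel_integral_measurable[OF _ k]) (use f in \<open>simp add: L1_kernel_def\<close>)
    have "(\<integral>\<^sup>+\<omega>. ennreal (norm (\<integral>y. f \<omega> y \<partial>\<kappa> \<omega>)) \<partial>M) \<le> (\<integral>\<^sup>+\<omega>. (\<integral>\<^sup>+y. ennreal \<bar>f \<omega> y\<bar> \<partial>\<kappa> \<omega>) \<partial>M)"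
      by (intro nn_integral_mono) (simp add: abs_integral_le_nn_integral)
    also have "\<dots> < \<infinity>" using f by (simp add: L1_kernel_def)
    finally show "(\<integral>\<^sup>+\<omega>. ennreal (norm (\<integral>y. f \<omega> y \<partial>\<kappa> \<omega>)) \<partial>M) < \<infinity>" .
  qed
  show ?thesis by (intro Bochner_Integration.integrable_diff *[OF \<phi> k(2)] *[OF \<psi> k(1)])
qed

lemma L1_kernel_AE_integrable:
  fixes \<kappa> :: "'w \<Rightarrow> 'z::polish_space measure"
  assumes f: "f \<in> L1_kernel M \<kappa>" and k: "prob_kernel M \<kappa>"
  shows "AE \<omega> in M. integrable (\<kappa> \<omega>) (f \<omega>)"
proof -
  have m [measurable]: "(\<lambda>(\<omega>, y). f \<omega> y) \<in> borel_measurable (M \<Otimes>\<^sub>M borel)" using f by (simp add: L1_kernel_def)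
  have "AE \<omega> in M. (\<integral>\<^sup>+y. ennreal \<bar>f \<omega> y\<bar> \<partial>\<kappa> \<omega>) \<noteq> \<infinity>"
  proof (rule nn_integral_PInf_AE)
    show "(\<lambda>\<omega>. \<integral>\<^sup>+y. ennreal \<bar>f \<omega> y\<bar> \<partial>\<kappa> \<omega>) \<in> borel_measurable M"
      by (rule kernel_nn_integral_measurable[OF _ k]) measurable
  qed (use f in \<open>simp add: L1_kernel_def less_top\<close>)
  then show ?thesis
  proof (rule AE_mp, intro AE_I2 impI integrableI_bounded)
    fix \<omega> assume w: "\<omega> \<in> space M" and fin: "(\<integral>\<^sup>+y. ennreal \<bar>f \<omega> y\<bar> \<partial>\<kappa> \<omega>) \<noteq> \<infinity>"
    have s: "sets (\<kappa> \<omega>) = sets borel" using k w unfolding prob_kernel_iff by blast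
    have "f \<omega> \<in> borel_measurable borel" using w by measurable
    then show "f \<omega> \<in> borel_measurable (\<kappa> \<omega>)" unfolding measurable_cong_sets[OF s refl] .
    show "(\<integral>\<^sup>+y. ennreal (norm (f \<omega> y)) \<partial>\<kappa> \<omega>) < \<infinity>" using fin by (simp add: less_top)
  qed
qed

text \<open>
  Only almost every \<open>\<omega>\<close> is covered by the pointwise inequality, as the potentials may fail to be
  integrable on a null set.
\<close>

lemma weak_duality:
  fixes \<mu> :: "'w \<Rightarrow> 'x::polish_space measure" and \<nu> :: "'w \<Rightarrow> 'y::polish_space measure"
  assumes k: "prob_kernel M \<mu>" "prob_kernel M \<nu>"
    and \<pi>: "\<pi> \<in> kernel_couplings M \<mu> \<nu>"
    and \<psi>: "\<psi> \<in> L1_kernel M \<mu>" and \<phi>: "\<phi> \<in> L1_kernel M \<nu>" and feas: "dual_feasible M c \<psi> \<phi>"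
  shows "ereal (dual_value M \<mu> \<nu> \<psi> \<phi>) \<le> enn2ereal (\<integral>\<^sup>+\<omega>. (\<integral>\<^sup>+(x, y). c \<omega> x y \<partial>\<pi> \<omega>) \<partial>M)"
proof -
  let ?u = "\<lambda>\<omega>. (\<integral>y. \<phi> \<omega> y \<partial>\<nu> \<omega>) - (\<integral>x. \<psi> \<omega> x \<partial>\<mu> \<omega>)"
  have AE: "AE \<omega> in M. ennreal (?u \<omega>) \<le> (\<integral>\<^sup>+(x, y). c \<omega> x y \<partial>\<pi> \<omega>)"
    using AE_space L1_kernel_AE_integrable[OF \<phi> k(2)] L1_kernel_AE_integrable[OF \<psi> k(1)]
  proof eventually_elim
    fix \<omega> assume w: "\<omega> \<in> space M" and i: "integrable (\<nu> \<omega>) (\<phi> \<omega>)" "integrable (\<mu> \<omega>) (\<psi> \<omega>)"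
    show "ennreal (?u \<omega>) \<le> (\<integral>\<^sup>+(x, y). c \<omega> x y \<partial>\<pi> \<omega>)"
    proof -
      have s [measurable_cong]: "sets (\<pi> \<omega>) = sets (borel \<Otimes>\<^sub>M borel)"
        using kernel_couplingsD(1)[OF \<pi>] w unfolding prob_kernel_iff borel_prod by blast
      have fs: "fst \<in> \<pi> \<omega> \<rightarrow>\<^sub>M borel" "snd \<in> \<pi> \<omega> \<rightarrow>\<^sub>M borel" by measurable
      have e: "\<mu> \<omega> = distr (\<pi> \<omega>) borel fst" "\<nu> \<omega> = distr (\<pi> \<omega>) borel snd"
        using kernel_couplingsD(2,3)[OF \<pi> w] by simp_all
      have m: "\<psi> \<omega> \<in> borel_measurable borel" "\<phi> \<omega> \<in> borel_measurable borel"
        using borel_measurable_integrable[OF i(2)] borel_measurable_integrable[OF i(1)]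
        unfolding e by simp_all
      have i': "integrable (\<pi> \<omega>) (\<lambda>z. \<psi> \<omega> (fst z))" "integrable (\<pi> \<omega>) (\<lambda>z. \<phi> \<omega> (snd z))"
        using i integrable_distr_eq[OF fs(1) m(1)] integrable_distr_eq[OF fs(2) m(2)] unfolding e by simp_all
      have "?u \<omega> = (\<integral>z. \<phi> \<omega> (snd z) - \<psi> \<omega> (fst z) \<partial>\<pi> \<omega>)"
        unfolding e integral_distr[OF fs(1) m(1)] integral_distr[OF fs(2) m(2)] using i' by simp
      also have "ennreal \<dots> \<le> (\<integral>\<^sup>+z. ennreal (\<phi> \<omega> (snd z) - \<psi> \<omega> (fst z)) \<partial>\<pi> \<omega>)"
        by (rule ennreal_integral_le) (use i' in simp)
      also have "\<dots> \<le> (\<integral>\<^sup>+(x, y). c \<omega> x y \<partial>\<pi> \<omega>)"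
        using feas w by (intro nn_integral_mono) (auto simp: dual_feasible_def intro!: ereal_le_enn2ereal_imp)
      finally show ?thesis .
    qed
  qed
  have "ereal (dual_value M \<mu> \<nu> \<psi> \<phi>) \<le> enn2ereal (ennreal (dual_value M \<mu> \<nu> \<psi> \<phi>))"
    by (rule ereal_le_enn2ereal_ennreal)
  also have "ennreal (dual_value M \<mu> \<nu> \<psi> \<phi>) \<le> (\<integral>\<^sup>+\<omega>. ennreal (?u \<omega>) \<partial>M)"
    unfolding dual_value_def by (rule ennreal_integral_le[OF dual_inner_integrable[OF k \<psi> \<phi>]])
  also have "\<dots> \<le> (\<integral>\<^sup>+\<omega>. (\<integral>\<^sup>+(x, y). c \<omega> x y \<partial>\<pi> \<omega>) \<partial>M)"
    by (rule nn_integral_mono_AE[OF AE])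
  finally show ?thesis by (simp add: less_eq_ennreal.rep_eq)
qed

lemma Lip_b_subset_L1:
  assumes M: "prob_space M" and k: "prob_kernel M \<kappa>" and f: "f \<in> Lip_b M"
  shows "f \<in> L1_kernel M \<kappa>"
proof -
  obtain B where B: "\<And>\<omega> x. \<omega> \<in> space M \<Longrightarrow> \<bar>f \<omega> x\<bar> \<le> B" using f by (auto simp: Lip_b_def)
  have "(\<integral>\<^sup>+\<omega>. (\<integral>\<^sup>+x. ennreal \<bar>f \<omega> x\<bar> \<partial>\<kappa> \<omega>) \<partial>M) \<le> (\<integral>\<^sup>+\<omega>. ennreal B \<partial>M)"
  proof (rule nn_integral_mono)
    fix \<omega> assume w: "\<omega> \<in> space M"
    then interpret K: prob_space "\<kappa> \<omega>" using k unfolding prob_kernel_iff by blast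
    have "(\<integral>\<^sup>+x. ennreal \<bar>f \<omega> x\<bar> \<partial>\<kappa> \<omega>) \<le> (\<integral>\<^sup>+x. ennreal B \<partial>\<kappa> \<omega>)"
      by (intro nn_integral_mono ennreal_leI B w)
    then show "(\<integral>\<^sup>+x. ennreal \<bar>f \<omega> x\<bar> \<partial>\<kappa> \<omega>) \<le> ennreal B" by (simp add: K.emeasure_space_1)
  qed
  also have "\<dots> < \<infinity>" using prob_space.emeasure_space_1[OF M] by simp
  finally show ?thesis using f by (simp add: L1_kernel_def Lip_b_def)
qed

section \<open>Piecing together over the parameter space\<close>

lemma Lip_b_zero: "(\<lambda>_ _. 0) \<in> Lip_b M"
  by (auto simp: Lip_b_def intro!: exI[of _ 0] lipschitz_onI)

lemma Lip_b_If:
  assumes A: "A \<in> sets M" and f: "f \<in> Lip_b M" and g: "g \<in> Lip_b M"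
  shows "(\<lambda>\<omega>. if \<omega> \<in> A then f \<omega> else g \<omega>) \<in> Lip_b M"
proof -
  obtain B1 where B1: "\<And>\<omega> x. \<omega> \<in> space M \<Longrightarrow> \<bar>f \<omega> x\<bar> \<le> B1" using f by (auto simp: Lip_b_def)
  obtain B2 where B2: "\<And>\<omega> x. \<omega> \<in> space M \<Longrightarrow> \<bar>g \<omega> x\<bar> \<le> B2" using g by (auto simp: Lip_b_def)
  have [measurable]: "(\<lambda>(\<omega>, x). f \<omega> x) \<in> borel_measurable (M \<Otimes>\<^sub>M borel)"
    "(\<lambda>(\<omega>, x). g \<omega> x) \<in> borel_measurable (M \<Otimes>\<^sub>M borel)" "A \<in> sets M"
    using f g A by (auto simp: Lip_b_def)
  have "(\<lambda>p. if fst p \<in> A then f (fst p) (snd p) else g (fst p) (snd p)) \<in> borel_measurable (M \<Otimes>\<^sub>M borel)"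
    by measurable
  then have "(\<lambda>(\<omega>, x). (if \<omega> \<in> A then f \<omega> else g \<omega>) x) \<in> borel_measurable (M \<Otimes>\<^sub>M borel)"
    by (simp add: split_beta' if_distribR)
  moreover have "\<forall>\<omega>\<in>space M. \<forall>x. \<bar>(if \<omega> \<in> A then f \<omega> else g \<omega>) x\<bar> \<le> max B1 B2"
    using B1 B2 by (auto simp: le_max_iff_disj)
  moreover have "\<forall>\<omega>\<in>space M. \<exists>L. L-lipschitz_on UNIV (if \<omega> \<in> A then f \<omega> else g \<omega>)"
    using f g by (auto simp: Lip_b_def)
  ultimately show ?thesis unfolding Lip_b_def by blast
qed

lemma kernel_couplings_If:
  assumes A: "A \<in> sets M" and "\<pi> \<in> kernel_couplings M \<mu> \<nu>" "\<pi>' \<in> kernel_couplings M \<mu> \<nu>"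
  shows "(\<lambda>\<omega>. if \<omega> \<in> A then \<pi> \<omega> else \<pi>' \<omega>) \<in> kernel_couplings M \<mu> \<nu>"
proof -
  have "prob_kernel M (\<lambda>\<omega>. if \<omega> \<in> A then \<pi> \<omega> else \<pi>' \<omega>)"
    by (rule measurable_If_set) (use assms in \<open>auto simp: kernel_couplings_def\<close>)
  then show ?thesis using assms by (auto simp: kernel_couplings_def)
qed

lemma dual_feasible_zero: "dual_feasible M c (\<lambda>_ _. 0) (\<lambda>_ _. 0)"
  by (simp add: dual_feasible_def flip: zero_ereal_def)

lemma dual_feasible_If:
  assumes "dual_feasible M c \<psi> \<phi>" "dual_feasible M c \<psi>' \<phi>'"
  shows "dual_feasible M c (\<lambda>\<omega>. if \<omega> \<in> A then \<psi> \<omega> else \<psi>' \<omega>) (\<lambda>\<omega>. if \<omega> \<in> A then \<phi> \<omega> else \<phi>' \<omega>)"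
  using assms by (auto simp: dual_feasible_def)

text \<open>
  Only finitely many of the given potentials are used, so that the bound of the glued ones can be
  uniform in \<open>\<omega>\<close>.
\<close>

lemma finite_gluing:
  fixes ok :: "nat \<Rightarrow> 'w set"
  assumes t: "\<And>t. \<pi> t \<in> kernel_couplings M \<mu> \<nu>" "\<And>t. \<psi> t \<in> Lip_b M" "\<And>t. \<phi> t \<in> Lip_b M"
      "\<And>t. dual_feasible M c (\<psi> t) (\<phi> t)" "\<And>t. ok t \<in> sets M"
    and \<pi>0: "\<pi>0 \<in> kernel_couplings M \<mu> \<nu>"
  shows "\<exists>p\<in>kernel_couplings M \<mu> \<nu>. \<exists>q\<in>Lip_b M. \<exists>r\<in>Lip_b M. dual_feasible M c q r \<and>
    (\<forall>\<omega>. (\<omega> \<in> (\<Union>t<T. ok t) \<longrightarrow> (\<exists>t. \<omega> \<in> ok t \<and> p \<omega> = \<pi> t \<omega> \<and> q \<omega> = \<psi> t \<omega> \<and> r \<omega> = \<phi> t \<omega>)) \<and>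
      (\<omega> \<notin> (\<Union>t<T. ok t) \<longrightarrow> p \<omega> = \<pi>0 \<omega> \<and> q \<omega> = (\<lambda>_. 0) \<and> r \<omega> = (\<lambda>_. 0)))"
proof (induction T)
  case 0
  show ?case
    by (rule bexI[OF _ \<pi>0], rule bexI[OF _ Lip_b_zero], rule bexI[OF _ Lip_b_zero])
      (simp add: dual_feasible_zero)
next
  case (Suc T)
  then obtain p q r where IH: "p \<in> kernel_couplings M \<mu> \<nu>" "q \<in> Lip_b M" "r \<in> Lip_b M" "dual_feasible M c q r"
    "\<And>\<omega>. \<omega> \<in> (\<Union>t<T. ok t) \<Longrightarrow> \<exists>t. \<omega> \<in> ok t \<and> p \<omega> = \<pi> t \<omega> \<and> q \<omega> = \<psi> t \<omega> \<and> r \<omega> = \<phi> t \<omega>"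
    "\<And>\<omega>. \<omega> \<notin> (\<Union>t<T. ok t) \<Longrightarrow> p \<omega> = \<pi>0 \<omega> \<and> q \<omega> = (\<lambda>_. 0) \<and> r \<omega> = (\<lambda>_. 0)"
    by blast
  show ?case
  proof (intro bexI conjI allI impI)
    show "dual_feasible M c (\<lambda>\<omega>. if \<omega> \<in> ok T then \<psi> T \<omega> else q \<omega>) (\<lambda>\<omega>. if \<omega> \<in> ok T then \<phi> T \<omega> else r \<omega>)"
      by (rule dual_feasible_If) (use t IH in auto)
    show "(\<lambda>\<omega>. if \<omega> \<in> ok T then \<pi> T \<omega> else p \<omega>) \<in> kernel_couplings M \<mu> \<nu>"
      by (rule kernel_couplings_If) (use t IH in auto)
    show "(\<lambda>\<omega>. if \<omega> \<in> ok T then \<psi> T \<omega> else q \<omega>) \<in> Lip_b M" "(\<lambda>\<omega>. if \<omega> \<in> ok T then \<phi> T \<omega> else r \<omega>) \<in> Lip_b M"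
      by (rule Lip_b_If; use t IH in auto)+
  next
    fix \<omega> assume "\<omega> \<in> (\<Union>t<Suc T. ok t)"
    then have "\<omega> \<in> ok T \<or> \<omega> \<in> (\<Union>t<T. ok t)" by (auto simp: less_Suc_eq)
    then show "\<exists>t. \<omega> \<in> ok t \<and> (if \<omega> \<in> ok T then \<pi> T \<omega> else p \<omega>) = \<pi> t \<omega> \<and>
      (if \<omega> \<in> ok T then \<psi> T \<omega> else q \<omega>) = \<psi> t \<omega> \<and> (if \<omega> \<in> ok T then \<phi> T \<omega> else r \<omega>) = \<phi> t \<omega>"
      using IH(5)[of \<omega>] by (cases "\<omega> \<in> ok T") auto
  next
    fix \<omega> assume "\<omega> \<notin> (\<Union>t<Suc T. ok t)"
    then have "\<omega> \<notin> ok T" "\<omega> \<notin> (\<Union>t<T. ok t)" by (auto simp: less_Suc_eq)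
    then show "(if \<omega> \<in> ok T then \<pi> T \<omega> else p \<omega>) = \<pi>0 \<omega>"
      "(if \<omega> \<in> ok T then \<psi> T \<omega> else q \<omega>) = (\<lambda>_. 0)" "(if \<omega> \<in> ok T then \<phi> T \<omega> else r \<omega>) = (\<lambda>_. 0)"
      using IH(6)[of \<omega>] by auto
  qed
qed

text \<open>
  Couplings with a jointly measurable density are kernels, by Fubini's theorem.
\<close>

lemma density_kernel_coupling:
  fixes \<mu> :: "'w \<Rightarrow> 'x::polish_space measure" and \<nu> :: "'w \<Rightarrow> 'y::polish_space measure"
  assumes k: "prob_kernel M \<mu>" "prob_kernel M \<nu>"
    and H: "(\<lambda>((\<omega>, x), y). H \<omega> x y) \<in> borel_measurable ((M \<Otimes>\<^sub>M borel) \<Otimes>\<^sub>M borel)"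
    and one: "\<And>\<omega> x. \<omega> \<in> space M \<Longrightarrow> (\<integral>\<^sup>+y. H \<omega> x y \<partial>\<nu> \<omega>) = (1 :: ennreal)"
      "\<And>\<omega> y. \<omega> \<in> space M \<Longrightarrow> (\<integral>\<^sup>+x. H \<omega> x y \<partial>\<mu> \<omega>) = 1"
  shows "(\<lambda>\<omega>. density (\<mu> \<omega> \<Otimes>\<^sub>M \<nu> \<omega>) (\<lambda>(x, y). H \<omega> x y)) \<in> kernel_couplings M \<mu> \<nu>"
proof -
  note [measurable (raw)] = measurable_uncurry3[OF H]
  let ?\<pi> = "\<lambda>\<omega>. density (\<mu> \<omega> \<Otimes>\<^sub>M \<nu> \<omega>) (\<lambda>(x, y). H \<omega> x y)"
  have *: "prob_space (?\<pi> \<omega>) \<and> sets (?\<pi> \<omega>) = sets borel \<and> distr (?\<pi> \<omega>) borel fst = \<mu> \<omega> \<and> distr (?\<pi> \<omega>) borel snd = \<nu> \<omega>"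
    if w: "\<omega> \<in> space M" for \<omega>
  proof -
    have s [measurable_cong]: "sets (\<mu> \<omega>) = sets borel" "sets (\<nu> \<omega>) = sets borel"
      using k w unfolding prob_kernel_iff by blast+
    interpret X: prob_space "\<mu> \<omega>" using k w unfolding prob_kernel_iff by blast
    interpret Y: prob_space "\<nu> \<omega>" using k w unfolding prob_kernel_iff by blast
    interpret XY: pair_prob_space "\<mu> \<omega>" "\<nu> \<omega>" ..
    have Hm [measurable]: "(\<lambda>(x, y). H \<omega> x y) \<in> borel_measurable (borel \<Otimes>\<^sub>M borel)"
      unfolding split_beta' using w by measurable
    have sp: "sets (?\<pi> \<omega>) = sets (borel \<Otimes>\<^sub>M borel)"
      by (simp cong: sets_pair_measure_cong add: s)
    have fm: "fst \<in> ?\<pi> \<omega> \<rightarrow>\<^sub>M borel" "snd \<in> ?\<pi> \<omega> \<rightarrow>\<^sub>M borel"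
      unfolding measurable_cong_sets[OF sp refl] by measurable
    have 1: "distr (?\<pi> \<omega>) borel fst = \<mu> \<omega>"
    proof (rule measure_eqI)
      fix A assume "A \<in> sets (distr (?\<pi> \<omega>) borel fst)"
      then have A [measurable]: "A \<in> sets borel" by simp
      have "emeasure (distr (?\<pi> \<omega>) borel fst) A = (\<integral>\<^sup>+z. indicator A z \<partial>distr (?\<pi> \<omega>) borel fst)"
        by simp
      also have "\<dots> = (\<integral>\<^sup>+z. indicator A (fst z) \<partial>?\<pi> \<omega>)"
        by (rule nn_integral_distr[OF fm(1)]) simp
      also have "\<dots> = (\<integral>\<^sup>+z. (case z of (x, y) \<Rightarrow> H \<omega> x y) * indicator A (fst z) \<partial>(\<mu> \<omega> \<Otimes>\<^sub>M \<nu> \<omega>))"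
        by (rule nn_integral_density) measurable
      also have "\<dots> = (\<integral>\<^sup>+x. (\<integral>\<^sup>+y. H \<omega> x y * indicator A x \<partial>\<nu> \<omega>) \<partial>\<mu> \<omega>)"
        by (subst Y.nn_integral_fst[symmetric]) (simp_all add: split_beta')
      also have "\<dots> = (\<integral>\<^sup>+x. indicator A x \<partial>\<mu> \<omega>)"
        using w by (intro nn_integral_cong, subst nn_integral_multc) (auto simp: one(1) )
      finally show "emeasure (distr (?\<pi> \<omega>) borel fst) A = emeasure (\<mu> \<omega>) A" using s by simp
    qed (simp add: s)
    have "distr (?\<pi> \<omega>) borel snd = \<nu> \<omega>"
    proof (rule measure_eqI)
      fix A assume "A \<in> sets (distr (?\<pi> \<omega>) borel snd)"
      then have A [measurable]: "A \<in> sets borel" by simp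
      have "emeasure (distr (?\<pi> \<omega>) borel snd) A = (\<integral>\<^sup>+z. indicator A z \<partial>distr (?\<pi> \<omega>) borel snd)"
        by simp
      also have "\<dots> = (\<integral>\<^sup>+z. indicator A (snd z) \<partial>?\<pi> \<omega>)"
        by (rule nn_integral_distr[OF fm(2)]) simp
      also have "\<dots> = (\<integral>\<^sup>+z. (case z of (x, y) \<Rightarrow> H \<omega> x y) * indicator A (snd z) \<partial>(\<mu> \<omega> \<Otimes>\<^sub>M \<nu> \<omega>))"
        by (rule nn_integral_density) measurable
      also have "\<dots> = (\<integral>\<^sup>+y. (\<integral>\<^sup>+x. H \<omega> x y * indicator A y \<partial>\<mu> \<omega>) \<partial>\<nu> \<omega>)"
        by (subst XY.nn_integral_snd[symmetric]) (simp_all add: split_beta')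
      also have "\<dots> = (\<integral>\<^sup>+y. indicator A y \<partial>\<nu> \<omega>)"
        using w by (intro nn_integral_cong, subst nn_integral_multc) (auto simp: one(2) )
      finally show "emeasure (distr (?\<pi> \<omega>) borel snd) A = emeasure (\<nu> \<omega>) A" using s by simp
    qed (simp add: s)
    moreover have "prob_space (?\<pi> \<omega>)"
      by (rule prob_space_distrD[OF fm(1)]) (unfold 1, rule X.prob_space_axioms)
    ultimately show ?thesis using sp 1 unfolding borel_prod by blast
  qed
  have "(\<lambda>\<omega>. emeasure (?\<pi> \<omega>) B) \<in> borel_measurable M" if B: "B \<in> sets (borel :: ('x \<times> 'y) measure)" for B
  proof -
    have B' [measurable]: "B \<in> sets ((borel :: 'x measure) \<Otimes>\<^sub>M (borel :: 'y measure))" using B unfolding borel_prod .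
    have "(\<lambda>\<omega>. \<integral>\<^sup>+z. H \<omega> (fst z) (snd z) * indicator B z \<partial>(\<mu> \<omega> \<Otimes>\<^sub>M \<nu> \<omega>)) \<in> borel_measurable M"
    proof (rule kernel_nn_integral_measurable[OF _ prob_kernel_pair[OF k]])
      show "(\<lambda>(\<omega>, z). H \<omega> (fst z) (snd z) * indicator B z) \<in> borel_measurable (M \<Otimes>\<^sub>M borel)"
        unfolding borel_prod[symmetric] by measurable
    qed
    also have "?this \<longleftrightarrow> (\<lambda>\<omega>. emeasure (?\<pi> \<omega>) B) \<in> borel_measurable M"
    proof (rule measurable_cong)
      fix \<omega> assume w: "\<omega> \<in> space M"
      have s [measurable_cong]: "sets (\<mu> \<omega>) = sets borel" "sets (\<nu> \<omega>) = sets borel"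
        using k w unfolding prob_kernel_iff by blast+
      have "(\<lambda>(x, y). H \<omega> x y) \<in> borel_measurable (\<mu> \<omega> \<Otimes>\<^sub>M \<nu> \<omega>)"
        unfolding split_beta' using w by measurable
      moreover have "B \<in> sets (\<mu> \<omega> \<Otimes>\<^sub>M \<nu> \<omega>)" by measurable
      ultimately show "(\<integral>\<^sup>+z. H \<omega> (fst z) (snd z) * indicator B z \<partial>(\<mu> \<omega> \<Otimes>\<^sub>M \<nu> \<omega>)) = emeasure (?\<pi> \<omega>) B"
        by (simp add: emeasure_density split_beta')
    qed
    finally show ?thesis .
  qed
  then have "prob_kernel M ?\<pi>" unfolding prob_kernel_iff using * by blast
  then show ?thesis using * by (simp add: kernel_couplings_def)
qed

context stochastic_cost
begin

lemma dual_Lip_b: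
  "(\<lambda>\<omega>. dual_left (\<mu> \<omega>) (\<nu> \<omega>) (c \<omega>) n j k) \<in> Lip_b M"
  "(\<lambda>\<omega>. dual_right (\<mu> \<omega>) (\<nu> \<omega>) (c \<omega>) n j k) \<in> Lip_b M"
proof -
  have "(\<forall>x. \<bar>dual_left (\<mu> \<omega>) (\<nu> \<omega>) (c \<omega>) n j k x\<bar> \<le> (2 * real k + 1) * real n) \<and>
      (\<forall>y. \<bar>dual_right (\<mu> \<omega>) (\<nu> \<omega>) (c \<omega>) n j k y\<bar> \<le> (2 * real k + 2) * real n) \<and>
      (real n)-lipschitz_on UNIV (dual_left (\<mu> \<omega>) (\<nu> \<omega>) (c \<omega>) n j k) \<and>
      (real n)-lipschitz_on UNIV (dual_right (\<mu> \<omega>) (\<nu> \<omega>) (c \<omega>) n j k)"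
    if "\<omega> \<in> space M" for \<omega>
  proof -
    interpret C: continuous_cost "\<mu> \<omega>" "\<nu> \<omega>" "c \<omega>" by (rule continuous_cost[OF that])
    show ?thesis
      unfolding dual_right_def dual_left_def
      by (intro conjI allI lipschitz_onI C.S.\<psi>_bounded C.S.\<phi>'_bounded)
        (simp_all only: dist_real_def C.S.\<psi>_lip C.S.\<phi>'_lip of_nat_0_le_iff)
  qed
  then show "(\<lambda>\<omega>. dual_left (\<mu> \<omega>) (\<nu> \<omega>) (c \<omega>) n j k) \<in> Lip_b M"
    "(\<lambda>\<omega>. dual_right (\<mu> \<omega>) (\<nu> \<omega>) (c \<omega>) n j k) \<in> Lip_b M"
    unfolding Lip_b_def using dual_left_measurable dual_right_measurable by blast+
qed

lemma dual_feasible_approx: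
  "dual_feasible M c (\<lambda>\<omega>. dual_left (\<mu> \<omega>) (\<nu> \<omega>) (c \<omega>) n j k) (\<lambda>\<omega>. dual_right (\<mu> \<omega>) (\<nu> \<omega>) (c \<omega>) n j k)"
  unfolding dual_feasible_def
proof (intro ballI allI)
  fix \<omega> x y assume "\<omega> \<in> space M"
  then interpret C: continuous_cost "\<mu> \<omega>" "\<nu> \<omega>" "c \<omega>" by (rule continuous_cost)
  have "ereal (dual_right (\<mu> \<omega>) (\<nu> \<omega>) (c \<omega>) n j k y - dual_left (\<mu> \<omega>) (\<nu> \<omega>) (c \<omega>) n j k x) \<le> ereal (b n \<omega> x y)"
    using C.dual_right_le[of n j k y x] by simp
  also have "\<dots> \<le> enn2ereal (ennreal (b n \<omega> x y))" by (rule ereal_le_enn2ereal_ennreal)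
  also have "\<dots> \<le> enn2ereal (c \<omega> x y)"
    using C.minorant_le_cost[of n x y] by (simp add: less_eq_ennreal.rep_eq)
  finally show "ereal (dual_right (\<mu> \<omega>) (\<nu> \<omega>) (c \<omega>) n j k y - dual_left (\<mu> \<omega>) (\<nu> \<omega>) (c \<omega>) n j k x)
      \<le> enn2ereal (c \<omega> x y)" .
qed

lemma plan_coupling:
  "(\<lambda>\<omega>. density (\<mu> \<omega> \<Otimes>\<^sub>M \<nu> \<omega>) (\<lambda>(x, y). ennreal (plan_density \<delta> (\<mu> \<omega>) (\<nu> \<omega>) (c \<omega>) n j k i x y)))
    \<in> kernel_couplings M \<mu> \<nu>"
proof (rule density_kernel_coupling[OF kernel_\<mu> kernel_\<nu>])
  show "(\<lambda>((\<omega>, x), y). ennreal (plan_density \<delta> (\<mu> \<omega>) (\<nu> \<omega>) (c \<omega>) n j k i x y))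
      \<in> borel_measurable ((M \<Otimes>\<^sub>M borel) \<Otimes>\<^sub>M borel)"
    using plan_density_measurable unfolding split_beta' by measurable
  fix \<omega> assume "\<omega> \<in> space M"
  then interpret C: continuous_cost "\<mu> \<omega>" "\<nu> \<omega>" "c \<omega>" by (rule continuous_cost)
  obtain R where R: "\<And>x y. \<bar>plan_density \<delta> (\<mu> \<omega>) (\<nu> \<omega>) (c \<omega>) n j k i x y\<bar> \<le> R"
    unfolding plan_density_def using C.C.H_bounded[of i \<delta> n j k] by blast
  have m [measurable]: "(\<lambda>(x, y). plan_density \<delta> (\<mu> \<omega>) (\<nu> \<omega>) (c \<omega>) n j k i x y) \<in> borel_measurable (borel \<Otimes>\<^sub>M borel)"
    unfolding plan_density_def completion_def by measurable
  show "(\<integral>\<^sup>+y. ennreal (plan_density \<delta> (\<mu> \<omega>) (\<nu> \<omega>) (c \<omega>) n j k i x y) \<partial>\<nu> \<omega>) = 1" for x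
    using C.C.H_nonneg[of i \<delta> n j k x] C.C.int_H(1)[of x i \<delta> n j k]
    by (subst nn_integral_eq_integral[OF C.L.Y.integrable_bounded[OF _ R]]) (simp_all add: plan_density_def)
  show "(\<integral>\<^sup>+x. ennreal (plan_density \<delta> (\<mu> \<omega>) (\<nu> \<omega>) (c \<omega>) n j k i x y) \<partial>\<mu> \<omega>) = 1" for y
    using C.C.H_nonneg[of i \<delta> n j k _ y] C.C.int_H(2)[of y i \<delta> n j k]
    by (subst nn_integral_eq_integral[OF C.L.X.integrable_bounded[OF _ R]]) (simp_all add: plan_density_def)
qed

lemma product_coupling: "(\<lambda>\<omega>. \<mu> \<omega> \<Otimes>\<^sub>M \<nu> \<omega>) \<in> kernel_couplings M \<mu> \<nu>"
proof -
  have "(\<lambda>\<omega>. density (\<mu> \<omega> \<Otimes>\<^sub>M \<nu> \<omega>) (\<lambda>(x, y). 1)) \<in> kernel_couplings M \<mu> \<nu>"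
  proof (rule density_kernel_coupling[OF kernel_\<mu> kernel_\<nu>])
    fix \<omega> assume w: "\<omega> \<in> space M"
    show "(\<integral>\<^sup>+y. 1 \<partial>\<nu> \<omega>) = 1" "(\<integral>\<^sup>+x. 1 \<partial>\<mu> \<omega>) = 1"
      using w kernel_\<mu> kernel_\<nu> unfolding prob_kernel_iff by (simp_all add: prob_space.emeasure_space_1)
  qed (simp add: split_beta')
  then show ?thesis by (simp add: split_beta' density_1)
qed

lemma plan_cost:
  assumes "\<omega> \<in> space M"
  shows "(\<integral>\<^sup>+(x, y). c \<omega> x y \<partial>density (\<mu> \<omega> \<Otimes>\<^sub>M \<nu> \<omega>) (\<lambda>(x, y). ennreal (plan_density \<delta> (\<mu> \<omega>) (\<nu> \<omega>) (c \<omega>) n j k i x y)))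
    = (\<integral>\<^sup>+(x, y). c \<omega> x y * ennreal (plan_density \<delta> (\<mu> \<omega>) (\<nu> \<omega>) (c \<omega>) n j k i x y) \<partial>(\<mu> \<omega> \<Otimes>\<^sub>M \<nu> \<omega>))"
proof -
  interpret C: continuous_cost "\<mu> \<omega>" "\<nu> \<omega>" "c \<omega>" by (rule continuous_cost[OF assms])
  have [measurable]: "(\<lambda>(x, y). plan_density \<delta> (\<mu> \<omega>) (\<nu> \<omega>) (c \<omega>) n j k i x y) \<in> borel_measurable (borel \<Otimes>\<^sub>M borel)"
    unfolding plan_density_def completion_def by measurable
  show ?thesis
    by (subst nn_integral_density) (measurable, simp add: split_beta' mult.commute)
qed

text \<open>
  The set of \<open>\<omega>\<close> for which the \<open>t\<close>-th parameter quadruple has gap at most \<open>4 * \<delta>\<close> is \<open>ok t\<close>. By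
  \<open>plan_near_optimal\<close> these sets cover every \<open>\<omega>\<close> at which the independent coupling has finite cost, hence
  almost every \<open>\<omega>\<close>, and by dominated convergence the cost of the independent coupling on the complement of
  finitely many of them is less than \<open>\<delta>\<close>.
\<close>

lemma near_optimal_pair:
  assumes M: "prob_space M" and fin: "(\<integral>\<^sup>+\<omega>. (\<integral>\<^sup>+(x, y). c \<omega> x y \<partial>(\<mu> \<omega> \<Otimes>\<^sub>M \<nu> \<omega>)) \<partial>M) < \<infinity>" and \<delta>: "0 < \<delta>"
  shows "\<exists>p\<in>kernel_couplings M \<mu> \<nu>. \<exists>q\<in>Lip_b M. \<exists>r\<in>Lip_b M. dual_feasible M c q r \<and>
    enn2ereal (\<integral>\<^sup>+\<omega>. (\<integral>\<^sup>+(x, y). c \<omega> x y \<partial>p \<omega>) \<partial>M) \<le> ereal (dual_value M \<mu> \<nu> q r + 5 * \<delta>)"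
proof -
  interpret M: prob_space M by (rule M)
  define \<psi> where "\<psi> = (\<lambda>(n, j, k, i :: nat) \<omega>. dual_left (\<mu> \<omega>) (\<nu> \<omega>) (c \<omega>) n j k)"
  define \<phi> where "\<phi> = (\<lambda>(n, j, k, i :: nat) \<omega>. dual_right (\<mu> \<omega>) (\<nu> \<omega>) (c \<omega>) n j k)"
  define \<pi> where "\<pi> = (\<lambda>(n, j, k, i) \<omega>. density (\<mu> \<omega> \<Otimes>\<^sub>M \<nu> \<omega>)
    (\<lambda>(x, y). ennreal (plan_density \<delta> (\<mu> \<omega>) (\<nu> \<omega>) (c \<omega>) n j k i x y)))"
  define v where "v q r \<omega> = (\<integral>y. r \<omega> y \<partial>\<nu> \<omega>) - (\<integral>x. q \<omega> x \<partial>\<mu> \<omega>)"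
    for q :: "'w \<Rightarrow> 'x \<Rightarrow> real" and r :: "'w \<Rightarrow> 'y \<Rightarrow> real" and \<omega>
  define J where "J p = (\<integral>\<^sup>+(x, y). c (fst p) x y \<partial>(snd p))" for p :: "'w \<times> ('x \<times> 'y) measure"
  define I where "I \<omega> = (\<integral>\<^sup>+(x, y). c \<omega> x y \<partial>(\<mu> \<omega> \<Otimes>\<^sub>M \<nu> \<omega>))" for \<omega>
  have \<pi>: "\<pi> s \<in> kernel_couplings M \<mu> \<nu>" for s
    unfolding \<pi>_def by (cases s) (simp only: prod.case plan_coupling)
  have Lip: "\<psi> s \<in> Lip_b M" "\<phi> s \<in> Lip_b M" for s
    unfolding \<psi>_def \<phi>_def by (cases s, simp only: prod.case dual_Lip_b)+
  have feas: "dual_feasible M c (\<psi> s) (\<phi> s)" for s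
    unfolding \<psi>_def \<phi>_def by (cases s) (simp only: prod.case dual_feasible_approx)
  have J_meas: "(\<lambda>\<omega>. J (\<omega>, p \<omega>)) \<in> borel_measurable M" if "p \<in> kernel_couplings M \<mu> \<nu>" for p
    unfolding J_def fst_conv snd_conv
  proof (rule kernel_nn_integral_measurable[OF _ kernel_couplingsD(1)[OF that]])
    show "(\<lambda>(\<omega>, x, y). c \<omega> x y) \<in> borel_measurable (M \<Otimes>\<^sub>M borel)"
      using c_measurable unfolding borel_prod .
  qed
  have v_int: "integrable M (v q r)" if "q \<in> Lip_b M" "r \<in> Lip_b M" for q r
    unfolding v_def
    by (intro dual_inner_integrable[OF kernel_\<mu> kernel_\<nu>] Lip_b_subset_L1[OF M] kernel_\<mu> kernel_\<nu> that)
  define ok where "ok t = {\<omega>\<in>space M. 0 \<le> v (\<psi> (from_nat t)) (\<phi> (from_nat t)) \<omega> + 4 * \<delta> \<and>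
      J (\<omega>, \<pi> (from_nat t) \<omega>) \<le> ennreal (v (\<psi> (from_nat t)) (\<phi> (from_nat t)) \<omega> + 4 * \<delta>)}" for t :: nat
  have ok_sets [measurable]: "ok t \<in> sets M" for t
  proof -
    have [measurable]: "v (\<psi> (from_nat t)) (\<phi> (from_nat t)) \<in> borel_measurable M"
      using v_int[OF Lip] by simp
    note [measurable] = J_meas[OF \<pi>[of "from_nat t"]]
    show ?thesis unfolding ok_def by measurable
  qed
  have ok_cover: "\<exists>t. \<omega> \<in> ok t" if w: "\<omega> \<in> space M" and I: "I \<omega> < \<infinity>" for \<omega>
  proof -
    interpret C: continuous_cost "\<mu> \<omega>" "\<nu> \<omega>" "c \<omega>" by (rule continuous_cost[OF w])
    obtain n j k i where *: "0 \<le> C.V n j k + 4 * \<delta>"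
      "(\<integral>\<^sup>+(x, y). c \<omega> x y * ennreal (plan_density \<delta> (\<mu> \<omega>) (\<nu> \<omega>) (c \<omega>) n j k i x y) \<partial>(\<mu> \<omega> \<Otimes>\<^sub>M \<nu> \<omega>))
        \<le> ennreal (C.V n j k + 4 * \<delta>)"
      using C.plan_near_optimal[OF I[unfolded I_def] \<delta>] by blast
    have "\<omega> \<in> ok (to_nat (n, j, k, i))"
      using * w unfolding ok_def J_def v_def \<psi>_def \<phi>_def \<pi>_def by (simp add: plan_cost[OF w])
    then show ?thesis by blast
  qed
  have I_meas [measurable]: "I \<in> borel_measurable M"
    using J_meas[OF product_coupling] by (simp add: J_def I_def[abs_def])
  define bad where "bad T = space M - (\<Union>t<T. ok t)" for T
  have "(\<lambda>T. \<integral>\<^sup>+\<omega>. I \<omega> * indicator (bad T) \<omega> \<partial>M) \<longlonglongrightarrow> (\<integral>\<^sup>+\<omega>. 0 \<partial>M)"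
  proof (rule nn_integral_dominated_convergence[where w=I])
    show "(\<lambda>\<omega>. I \<omega> * indicator (bad T) \<omega>) \<in> borel_measurable M" for T
      unfolding bad_def by measurable
    show "(\<integral>\<^sup>+\<omega>. I \<omega> \<partial>M) < \<infinity>" using fin by (simp add: I_def)
    show "AE \<omega> in M. I \<omega> * indicator (bad T) \<omega> \<le> I \<omega>" for T
      by (intro AE_I2) (simp add: indicator_def)
    have "AE \<omega> in M. I \<omega> \<noteq> \<infinity>"
      by (rule nn_integral_PInf_AE) (use fin in \<open>auto simp: I_def[symmetric]\<close>)
    then show "AE \<omega> in M. (\<lambda>T. I \<omega> * indicator (bad T) \<omega>) \<longlonglongrightarrow> 0"
    proof (rule AE_mp, intro AE_I2 impI)
      fix \<omega> assume "\<omega> \<in> space M" "I \<omega> \<noteq> \<infinity>"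
      then obtain t where t: "\<omega> \<in> ok t" using ok_cover[of \<omega>] by (auto simp: less_top)
      have "I \<omega> * indicator (bad T) \<omega> = 0" if "Suc t \<le> T" for T
        using t that by (auto simp: bad_def indicator_def)
      then have "eventually (\<lambda>T. I \<omega> * indicator (bad T) \<omega> = 0) sequentially"
        unfolding eventually_sequentially by blast
      then show "(\<lambda>T. I \<omega> * indicator (bad T) \<omega>) \<longlonglongrightarrow> 0" by (rule tendsto_eventually)
    qed
  qed auto
  then have "eventually (\<lambda>T. (\<integral>\<^sup>+\<omega>. I \<omega> * indicator (bad T) \<omega> \<partial>M) < ennreal \<delta>) sequentially"
    using \<delta> by (intro order_tendstoD(2)[where y=0]) simp_all
  then obtain T where T: "(\<integral>\<^sup>+\<omega>. I \<omega> * indicator (bad T) \<omega> \<partial>M) < ennreal \<delta>"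
    by (auto dest: eventually_happens)
  obtain p q r where pqr: "p \<in> kernel_couplings M \<mu> \<nu>" "q \<in> Lip_b M" "r \<in> Lip_b M" "dual_feasible M c q r"
    "\<And>\<omega>. \<omega> \<in> (\<Union>t<T. ok t) \<Longrightarrow> \<exists>t. \<omega> \<in> ok t \<and> p \<omega> = \<pi> (from_nat t) \<omega> \<and> q \<omega> = \<psi> (from_nat t) \<omega> \<and> r \<omega> = \<phi> (from_nat t) \<omega>"
    "\<And>\<omega>. \<omega> \<notin> (\<Union>t<T. ok t) \<Longrightarrow> p \<omega> = \<mu> \<omega> \<Otimes>\<^sub>M \<nu> \<omega> \<and> q \<omega> = (\<lambda>_. 0) \<and> r \<omega> = (\<lambda>_. 0)"
    using finite_gluing[where \<pi>="\<lambda>t. \<pi> (from_nat t)" and \<psi>="\<lambda>t. \<psi> (from_nat t)" and \<phi>="\<lambda>t. \<phi> (from_nat t)"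
        and ok=ok and T=T, OF \<pi> Lip feas ok_sets product_coupling] by blast
  have pt: "0 \<le> v q r \<omega> + 4 * \<delta> \<and> J (\<omega>, p \<omega>) \<le> ennreal (v q r \<omega> + 4 * \<delta>) + I \<omega> * indicator (bad T) \<omega>"
    if w: "\<omega> \<in> space M" for \<omega>
  proof (cases "\<omega> \<in> (\<Union>t<T. ok t)")
    case True
    then obtain t where t: "\<omega> \<in> ok t" "p \<omega> = \<pi> (from_nat t) \<omega>" "q \<omega> = \<psi> (from_nat t) \<omega>" "r \<omega> = \<phi> (from_nat t) \<omega>"
      using pqr(5) by blast
    have "v q r \<omega> = v (\<psi> (from_nat t)) (\<phi> (from_nat t)) \<omega>" by (simp add: v_def t)
    then show ?thesis using t(1) by (simp add: ok_def t(2) add_increasing2)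
  next
    case False
    then have "v q r \<omega> = 0" "J (\<omega>, p \<omega>) = I \<omega>" "\<omega> \<in> bad T"
      using pqr(6)[OF False] w by (simp_all add: v_def J_def I_def bad_def)
    then show ?thesis using \<delta> by simp
  qed
  have vi: "integrable M (\<lambda>\<omega>. v q r \<omega> + 4 * \<delta>)" using v_int[OF pqr(2,3)] by simp
  have dv: "dual_value M \<mu> \<nu> q r = (\<integral>\<omega>. v q r \<omega> \<partial>M)" by (simp add: dual_value_def v_def)
  have v_shift: "(\<integral>\<omega>. v q r \<omega> + 4 * \<delta> \<partial>M) = dual_value M \<mu> \<nu> q r + 4 * \<delta>"
    unfolding dv using v_int[OF pqr(2,3)] by (simp add: M.prob_space)
  have "(\<integral>\<^sup>+\<omega>. J (\<omega>, p \<omega>) \<partial>M) \<le> (\<integral>\<^sup>+\<omega>. ennreal (v q r \<omega> + 4 * \<delta>) + I \<omega> * indicator (bad T) \<omega> \<partial>M)"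
    using pt by (intro nn_integral_mono) blast
  also have "\<dots> = (\<integral>\<^sup>+\<omega>. ennreal (v q r \<omega> + 4 * \<delta>) \<partial>M) + (\<integral>\<^sup>+\<omega>. I \<omega> * indicator (bad T) \<omega> \<partial>M)"
  proof (rule nn_integral_add)
    show "(\<lambda>\<omega>. ennreal (v q r \<omega> + 4 * \<delta>)) \<in> borel_measurable M"
      using borel_measurable_integrable[OF vi] by measurable
    show "(\<lambda>\<omega>. I \<omega> * indicator (bad T) \<omega>) \<in> borel_measurable M" unfolding bad_def by measurable
  qed
  also have "(\<integral>\<^sup>+\<omega>. ennreal (v q r \<omega> + 4 * \<delta>) \<partial>M) = ennreal (\<integral>\<omega>. v q r \<omega> + 4 * \<delta> \<partial>M)"
    using pt by (intro nn_integral_eq_integral[OF vi] AE_I2) blast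
  also note v_shift
  finally have "(\<integral>\<^sup>+\<omega>. J (\<omega>, p \<omega>) \<partial>M) \<le> ennreal (dual_value M \<mu> \<nu> q r + 4 * \<delta>) + ennreal \<delta>"
    using T by (meson add_left_mono less_imp_le order_trans)
  moreover have nn: "0 \<le> dual_value M \<mu> \<nu> q r + 4 * \<delta>"
  proof -
    have "0 \<le> (\<integral>\<omega>. v q r \<omega> + 4 * \<delta> \<partial>M)" by (intro integral_nonneg_AE AE_I2) (use pt in blast)
    then show ?thesis unfolding v_shift .
  qed
  ultimately have "(\<integral>\<^sup>+\<omega>. J (\<omega>, p \<omega>) \<partial>M) \<le> ennreal (dual_value M \<mu> \<nu> q r + 5 * \<delta>)"
    using \<delta> by (simp add: add.assoc flip: ennreal_plus)
  then have "enn2ereal (\<integral>\<^sup>+\<omega>. J (\<omega>, p \<omega>) \<partial>M) \<le> ereal (dual_value M \<mu> \<nu> q r + 5 * \<delta>)"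
    using nn \<delta> by (simp add: less_eq_ennreal.rep_eq enn2ereal_ennreal)
  then show ?thesis using pqr(1-4) unfolding J_def fst_conv snd_conv by blast
qed

end

theorem theorem1p3:
  fixes M :: "'w measure"
    and \<mu> :: "'w \<Rightarrow> 'x::polish_space measure"
    and \<nu> :: "'w \<Rightarrow> 'y::polish_space measure"
    and c :: "'w \<Rightarrow> 'x \<Rightarrow> 'y \<Rightarrow> ennreal"
  assumes "prob_space M"
    and "prob_kernel M \<mu>"
    and "prob_kernel M \<nu>"
    and "(\<lambda>(\<omega>, x, y). c \<omega> x y) \<in> borel_measurable (M \<Otimes>\<^sub>M borel \<Otimes>\<^sub>M borel)"
    and "\<And>\<omega>. \<omega> \<in> space M \<Longrightarrow> continuous_on UNIV (\<lambda>(x, y). c \<omega> x y)"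
    and "\<And>x y. (\<lambda>\<omega>. c \<omega> x y) \<in> borel_measurable M"
    and "(\<integral>\<^sup>+\<omega>. (\<integral>\<^sup>+(x, y). c \<omega> x y \<partial>(\<mu> \<omega> \<Otimes>\<^sub>M \<nu> \<omega>)) \<partial>M) < \<infinity>"
  shows "enn2ereal (C_stoch M c \<mu> \<nu>) =
           (SUP (\<psi>, \<phi>)\<in>{(\<psi>, \<phi>). \<psi> \<in> L1_kernel M \<mu> \<and> \<phi> \<in> L1_kernel M \<nu> \<and> dual_feasible M c \<psi> \<phi>}.
              ereal (dual_value M \<mu> \<nu> \<psi> \<phi>))
       \<and> (SUP (\<psi>, \<phi>)\<in>{(\<psi>, \<phi>). \<psi> \<in> L1_kernel M \<mu> \<and> \<phi> \<in> L1_kernel M \<nu> \<and> dual_feasible M c \<psi> \<phi>}.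
              ereal (dual_value M \<mu> \<nu> \<psi> \<phi>)) =
         (SUP (\<psi>, \<phi>)\<in>{(\<psi>, \<phi>). \<psi> \<in> Lip_b M \<and> \<phi> \<in> Lip_b M \<and> dual_feasible M c \<psi> \<phi>}.
              ereal (dual_value M \<mu> \<nu> \<psi> \<phi>))"
    (is "_ = ?L1 \<and> _ = ?Lip")
proof -
  interpret stochastic_cost M \<mu> \<nu> c
    using assms(2-5) by unfold_locales
  have "?L1 \<le> enn2ereal (C_stoch M c \<mu> \<nu>)"
  proof (rule SUP_least, clarify)
    fix \<psi> \<phi> assume *: "\<psi> \<in> L1_kernel M \<mu>" "\<phi> \<in> L1_kernel M \<nu>" "dual_feasible M c \<psi> \<phi>"
    have "e2ennreal (ereal (dual_value M \<mu> \<nu> \<psi> \<phi>)) \<le> C_stoch M c \<mu> \<nu>"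
      unfolding C_stoch_def
    proof (rule INF_greatest)
      fix \<pi> assume "\<pi> \<in> kernel_couplings M \<mu> \<nu>"
      from weak_duality[OF assms(2,3) this *]
      show "e2ennreal (ereal (dual_value M \<mu> \<nu> \<psi> \<phi>)) \<le> (\<integral>\<^sup>+\<omega>. (\<integral>\<^sup>+(x, y). c \<omega> x y \<partial>\<pi> \<omega>) \<partial>M)"
        by (metis e2ennreal_mono e2ennreal_enn2ereal)
    qed
    then have "enn2ereal (ennreal (dual_value M \<mu> \<nu> \<psi> \<phi>)) \<le> enn2ereal (C_stoch M c \<mu> \<nu>)"
      by (simp add: less_eq_ennreal.rep_eq e2ennreal_ereal)
    then show "ereal (dual_value M \<mu> \<nu> \<psi> \<phi>) \<le> enn2ereal (C_stoch M c \<mu> \<nu>)"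
      using ereal_le_enn2ereal_ennreal order_trans by blast
  qed
  moreover have "?Lip \<le> ?L1"
    by (rule SUP_subset_mono) (auto intro: Lip_b_subset_L1[OF assms(1)] assms(2,3))
  moreover have "enn2ereal (C_stoch M c \<mu> \<nu>) \<le> ?Lip"
  proof (rule ereal_le_epsilon2)
    fix e :: real assume e: "0 < e"
    obtain p q r where pqr: "p \<in> kernel_couplings M \<mu> \<nu>" "q \<in> Lip_b M" "r \<in> Lip_b M" "dual_feasible M c q r"
      "enn2ereal (\<integral>\<^sup>+\<omega>. (\<integral>\<^sup>+(x, y). c \<omega> x y \<partial>p \<omega>) \<partial>M) \<le> ereal (dual_value M \<mu> \<nu> q r + 5 * (e / 5))"
      using near_optimal_pair[OF assms(1,7), of "e / 5"] e by auto
    have "enn2ereal (C_stoch M c \<mu> \<nu>) \<le> enn2ereal (\<integral>\<^sup>+\<omega>. (\<integral>\<^sup>+(x, y). c \<omega> x y \<partial>p \<omega>) \<partial>M)"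
      unfolding C_stoch_def less_eq_ennreal.rep_eq[symmetric] by (rule INF_lower[OF pqr(1)])
    also have "\<dots> \<le> ereal (dual_value M \<mu> \<nu> q r) + ereal e" using pqr(5) by simp
    also have "ereal (dual_value M \<mu> \<nu> q r) \<le> ?Lip"
      by (rule SUP_upper2[where i="(q, r)"]) (use pqr in auto)
    finally show "enn2ereal (C_stoch M c \<mu> \<nu>) \<le> ?Lip + ereal e" by (simp add: add_right_mono)
  qed
  ultimately show ?thesis by (metis (no_types, lifting) order_antisym order_trans)
qed

end
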